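(* Assume there are $\alpha,\gamma\ge0$ and constants $C_d,C_D$ with $d_j\le C_d(1+\mu_j)^\gamma$ and $\sum_{1\le j:\,\mu_j\le\Lambda}d_j\le C_D(1+\Lambda)^{\alpha+\gamma}$ for every $j\ge1$, $\Lambda\ge1$, and suppose that, for some $\beta\ge0$, $$\kappa_j:=\sup_{x\in M}K_j(x,x)\le C_\kappa(1+\mu_j)^\beta,\qquad j\ge1.$$ Let $q>0$ with $q\ge\beta$, $R>0$, $B>0$, and $B_\star\ge\max\{B,C_\kappa^{1/2}R\}$. Put $J_n=\{j\ge1:\mu_j\le\Lambda_{\max,n}\}$, and let $\widehat p_{J_n}$ be the positive sieve estimator with index set $J_n$, sieve radius $B_\star$ and penalty levels $\lambda_j>0$. With $\delta_n>0$ set $\rho_n^{\log}(R,\delta_n):=\rho_{\alpha,\gamma,q}(R,\delta_n)$, and suppose that $$\lambda_j^2\le C_\lambda\delta_nd_j,\quad j\in J_n,\qquad \sup_{u_0\in\mathcal U_q(R,B)}\mathbb P_{p_{u_0}}(\mathcal E_{J_n}^c)=o\big(\rho_n^{\log}(R,\delta_n)\big),\qquad R^2(1+\Lambda_{\max,n})^{-q}\le\rho_n^{\log}(R,\delta_n).$$ Then there is a constant $C=C(B_\star,q,\alpha,\gamma,C_d,C_D,C_\lambda,C_\kappa)>0$, independent of $n$ and of $u_0$, such that, for all sufficiently large $n$, each of the three quantities $$\sup_{u_0\in\mathcal U_q(R,B)}\mathbb E_{p_{u_0}}\mathrm{KL}(p_{u_0},\widehat p_{J_n}),\quad\sup_{u_0\in\mathcal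 U_q(R,B)}\mathbb E_{p_{u_0}}h^2(\widehat p_{J_n},p_{u_0}),\quad\sup_{u_0\in\mathcal U_q(R,B)}\mathbb E_{p_{u_0}}\|\widehat p_{J_n}-p_{u_0}\|_{L^2(M)}^2$$ is at most $C\rho_n^{\log}(R,\delta_n)$.
   Context: $(M,g)$ is a compact connected smooth Riemannian manifold without boundary, $\nu$ is Riemannian volume normalized so that $\nu(M)=1$, $L^2(M)=L^2(M,\nu)$ (real-valued). $L=-\Delta_M$ has distinct eigenvalues $0=\mu_0<\mu_1<\cdots$; $E_j=\ker(L-\mu_jI)$, $d_j=\dim E_j$, $P_j$ is the orthogonal projector onto $E_j$ with kernel $K_j(x,y)=\sum_{\ell=1}^{d_j}\phi_{j,\ell}(x)\phi_{j,\ell}(y)$ ($\{\phi_{j,\ell}\}_\ell$ any orthonormal basis of $E_j$). $\|f\|_{\mathcal V^{\mathrm{spec}}_q(M)}=\sum_{j\ge0}(1+\mu_j)^{q/2}\|P_jf\|_{L^2(M)}$. For measurable $u$: $A(u)=\log\int_Me^u\,d\nu$, $p_u=e^{u-A(u)}$. $\mathcal U_q(R,B)=\{u:\int_Mu\,d\nu=0,\ \|u\|_{\mathcal V^{\mathrm{spec}}_q(M)}\le R,\ \|u\|_{L^\infty(M)}\le B\}$. Estimator: given $X_1,\dots,X_n$ i.i.d. with law $p_{u_0}\,d\nu$, a finite $J\subset\{j\ge1\}$, radius $B_\star$ and penalties $\lambda_j>0$, let $F_J=\bigoplus_{j\in J}E_j$, $F_J(B_\star)=\{u\in F_J:\|u\|_\infty\le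 B_\star\}$, $\mathbb P_nf=\frac1n\sum_if(X_i)$; $\widehat u_J$ is the unique minimizer over $F_J(B_\star)$ of $-\mathbb P_nu+A(u)+4\sum_{j\in J}\lambda_j\|P_ju\|_{L^2(M)}$, and $\widehat p_J=p_{\widehat u_J}$. Event: with $\Phi_j=(\phi_{j,1},\dots,\phi_{j,d_j})$ and $Z_j=\mathbb P_n\Phi_j-\int_M\Phi_jp_{u_0}\,d\nu\in\mathbb R^{d_j}$, $\mathcal E_J=\{\|Z_j\|_2\le\lambda_j\text{ for every }j\in J\}$. Rate function: for $A,\delta>0$, $\rho_{\alpha,\gamma,q}(A,\delta)=A^{\frac{2\gamma}{q+\gamma}}\delta^{\frac{q}{q+\gamma}}$ if $0<q<\gamma$, and $\rho_{\alpha,\gamma,q}(A,\delta)=A^{\frac{2(\alpha+\gamma)}{q+\gamma+2\alpha}}\delta^{\frac{q+\alpha}{q+\gamma+2\alpha}}$ if $q\ge\gamma$. $\mathrm{KL}(p,q)=\int_Mp\log(p/q)\,d\nu$, $h^2(p,q)=\frac12\int_M(\sqrt p-\sqrt q)^2\,d\nu$. The quantities $\Lambda_{\max,n}$, $\delta_n$ and $\lambda_j$ are deterministic and may depend on $n$; $C_\lambda$ does not depend on $n$ or $j$. *)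

theory Defs
  imports "HOL-Probability.Probability" "HOL-Library.Landau_Symbols"
begin

section \<open>Smooth functions on open subsets of Euclidean space\<close>

definition partial :: "'n::finite \<Rightarrow> (real^'n \<Rightarrow> real) \<Rightarrow> real^'n \<Rightarrow> real" where
  "partial i f y = frechet_derivative f (at y) (axis i 1)"

primrec Ck_on :: "nat \<Rightarrow> (real^'n::finite) set \<Rightarrow> (real^'n \<Rightarrow> real) \<Rightarrow> bool" where
  "Ck_on 0 V f \<longleftrightarrow> continuous_on V f"
| "Ck_on (Suc k) V f \<longleftrightarrow> f differentiable_on V \<and> (\<forall>i. Ck_on k V (partial i f))"

text \<open>Only used for open \<open>V\<close>.\<close>

definition smooth_fun_on :: "(real^'n::finite) set \<Rightarrow> (real^'n \<Rightarrow> real) \<Rightarrow> bool" where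
  "smooth_fun_on V f \<longleftrightarrow> (\<forall>k. Ck_on k V f)"

section \<open>Smooth Riemannian manifolds\<close>

text \<open>The underlying point set of the manifold is the whole type \<open>'m\<close>, and \<open>CARD('n)\<close> is its
  dimension. A chart \<open>(U, x)\<close> is a coordinate domain together with a coordinate map, whose values
  outside \<open>U\<close> are irrelevant.\<close>

type_synonym ('m, 'n) chart = "'m set \<times> ('m \<Rightarrow> (real, 'n) vec)"

definition chart_image :: "('m, 'n::finite) chart \<Rightarrow> (real^'n) set" where
  "chart_image c = snd c ` fst c"

definition chart_inv :: "('m, 'n::finite) chart \<Rightarrow> real^'n \<Rightarrow> 'm" where
  "chart_inv c = inv_into (fst c) (snd c)"

definition transition :: "('m, 'n::finite) chart \<Rightarrow> ('m, 'n) chart \<Rightarrow> real^'n \<Rightarrow> real^'n" where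
  "transition c c' = snd c' \<circ> chart_inv c"

definition smooth_atlas :: "('m::topological_space, 'n::finite) chart set \<Rightarrow> bool" where
  "smooth_atlas \<A> \<longleftrightarrow>
     (\<Union>c\<in>\<A>. fst c) = UNIV \<and>
     (\<forall>c\<in>\<A>. open (fst c) \<and> open (chart_image c) \<and>
        homeomorphism (fst c) (chart_image c) (snd c) (chart_inv c)) \<and>
     (\<forall>c\<in>\<A>. \<forall>c'\<in>\<A>. \<forall>i.
        smooth_fun_on (snd c ` (fst c \<inter> fst c')) (\<lambda>y. transition c c' y $ i))"

text \<open>\<open>g c y\<close> is the matrix of components \<open>g_ij\<close> of the metric in the chart \<open>c\<close> at the point with
  coordinates \<open>y\<close>; the last clause is the transformation law of a covariant 2-tensor.\<close>

definition riemannian_metric ::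
  "('m::topological_space, 'n::finite) chart set \<Rightarrow> (('m, 'n) chart \<Rightarrow> real^'n \<Rightarrow> real^'n^'n) \<Rightarrow> bool"
where
  "riemannian_metric \<A> g \<longleftrightarrow>
     (\<forall>c\<in>\<A>. \<forall>i j. smooth_fun_on (chart_image c) (\<lambda>y. g c y $ i $ j)) \<and>
     (\<forall>c\<in>\<A>. \<forall>y\<in>chart_image c.
        transpose (g c y) = g c y \<and> (\<forall>v. v \<noteq> 0 \<longrightarrow> v \<bullet> (g c y *v v) > 0)) \<and>
     (\<forall>c\<in>\<A>. \<forall>c'\<in>\<A>. \<forall>x\<in>fst c \<inter> fst c'.
        (let D = jacobian (transition c c') (at (snd c x))
         in g c (snd c x) = transpose D ** g c' (snd c' x) ** D))"

definition riemannian_volume ::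
  "('m::topological_space, 'n::finite) chart set \<Rightarrow> (('m, 'n) chart \<Rightarrow> real^'n \<Rightarrow> real^'n^'n) \<Rightarrow>
     'm measure \<Rightarrow> bool"
where
  "riemannian_volume \<A> g vol \<longleftrightarrow>
     sets vol = sets borel \<and>
     (\<forall>c\<in>\<A>. \<forall>S\<in>sets borel. S \<subseteq> fst c \<longrightarrow>
        emeasure vol S = (\<integral>\<^sup>+y\<in>snd c ` S. ennreal (sqrt (det (g c y))) \<partial>lborel))"

definition normalized_volume ::
  "('m::topological_space, 'n::finite) chart set \<Rightarrow> (('m, 'n) chart \<Rightarrow> real^'n \<Rightarrow> real^'n^'n) \<Rightarrow>
     'm measure \<Rightarrow> bool"
where
  "normalized_volume \<A> g \<nu> \<longleftrightarrow> (\<exists>vol. riemannian_volume \<A> g vol \<and> \<nu> = uniform_measure vol UNIV)"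

definition smooth_on_manifold ::
  "('m, 'n::finite) chart set \<Rightarrow> ('m \<Rightarrow> real) \<Rightarrow> bool" where
  "smooth_on_manifold \<A> f \<longleftrightarrow> (\<forall>c\<in>\<A>. smooth_fun_on (chart_image c) (f \<circ> chart_inv c))"

section \<open>The Laplace--Beltrami operator and its eigenspaces\<close>

text \<open>\<open>(det g)^(-1/2) \<Sum>_i \<partial>_i ((det g)^(1/2) \<Sum>_j g^ij \<partial>_j f)\<close>, for \<open>f\<close> expressed in the
  coordinates of \<open>c\<close>.\<close>

definition laplacian_coord ::
  "(('m, 'n::finite) chart \<Rightarrow> real^'n \<Rightarrow> real^'n^'n) \<Rightarrow> ('m, 'n) chart \<Rightarrow> (real^'n \<Rightarrow> real) \<Rightarrow>
     real^'n \<Rightarrow> real"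
where
  "laplacian_coord g c f y =
     (\<Sum>i\<in>UNIV. partial i
        (\<lambda>z. sqrt (det (g c z)) * (\<Sum>j\<in>UNIV. matrix_inv (g c z) $ i $ j * partial j f z)) y)
     / sqrt (det (g c y))"

text \<open>\<open>has_laplacian \<A> g f h\<close> states \<open>\<Delta>f = h\<close>. The coordinate expression does not depend on
  the chart, so it may be required in every chart.\<close>

definition has_laplacian ::
  "('m, 'n::finite) chart set \<Rightarrow> (('m, 'n) chart \<Rightarrow> real^'n \<Rightarrow> real^'n^'n) \<Rightarrow>
     ('m \<Rightarrow> real) \<Rightarrow> ('m \<Rightarrow> real) \<Rightarrow> bool"
where
  "has_laplacian \<A> g f h \<longleftrightarrow>
     (\<forall>c\<in>\<A>. \<forall>x\<in>fst c. laplacian_coord g c (f \<circ> chart_inv c) (snd c x) = h x)"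

text \<open>\<open>ker (L - m I)\<close> for \<open>L = -\<Delta>\<close>.\<close>

definition eigenspace ::
  "('m, 'n::finite) chart set \<Rightarrow> (('m, 'n) chart \<Rightarrow> real^'n \<Rightarrow> real^'n^'n) \<Rightarrow> real \<Rightarrow>
     ('m \<Rightarrow> real) set"
where
  "eigenspace \<A> g m = {f. smooth_on_manifold \<A> f \<and> has_laplacian \<A> g f (\<lambda>x. - (m * f x))}"

section \<open>Function spaces\<close>

definition L2_space :: "'m measure \<Rightarrow> ('m \<Rightarrow> real) set" where
  "L2_space \<nu> = {f \<in> borel_measurable \<nu>. integrable \<nu> (\<lambda>x. (f x)\<^sup>2)}"

definition L2_norm :: "'m measure \<Rightarrow> ('m \<Rightarrow> real) \<Rightarrow> real" where
  "L2_norm \<nu> f = sqrt (\<integral>x. (f x)\<^sup>2 \<partial>\<nu>)"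

definition Linf_norm :: "'m measure \<Rightarrow> ('m \<Rightarrow> real) \<Rightarrow> ereal" where
  "Linf_norm \<nu> f = esssup \<nu> (\<lambda>x. ereal \<bar>f x\<bar>)"

definition orthonormal_basis ::
  "'m measure \<Rightarrow> ('m \<Rightarrow> real) set \<Rightarrow> nat \<Rightarrow> (nat \<Rightarrow> 'm \<Rightarrow> real) \<Rightarrow> bool" where
  "orthonormal_basis \<nu> V m \<phi> \<longleftrightarrow>
     (\<forall>k<m. \<forall>l<m. (\<integral>x. \<phi> k x * \<phi> l x \<partial>\<nu>) = (if k = l then 1 else 0)) \<and>
     V = {f. \<exists>a. f = (\<lambda>x. \<Sum>l<m. a l * \<phi> l x)}"

text \<open>The result is the literal function lying in \<open>V\<close>, not an a.e. class; it is unique whenever \<open>V\<close>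
  is a space of continuous functions and \<open>\<nu>\<close> charges all nonempty open sets.\<close>

definition proj :: "'m measure \<Rightarrow> ('m \<Rightarrow> real) set \<Rightarrow> ('m \<Rightarrow> real) \<Rightarrow> 'm \<Rightarrow> real" where
  "proj \<nu> V f = (THE h. h \<in> V \<and> (\<forall>e\<in>V. (\<integral>x. (f x - h x) * e x \<partial>\<nu>) = 0))"

section \<open>Spectral data of a compact Riemannian manifold\<close>

text \<open>\<open>d j\<close> is the dimension of \<open>E j\<close> and \<open>\<phi> j 0, \<dots>, \<phi> j (d j - 1)\<close> is an arbitrary orthonormal
  basis of it. The last assumption is the spectral theorem for \<open>L\<close>, i.e. the Hilbert sum
  decomposition of \<open>L\<^sup>2\<close> into the eigenspaces. It holds on every compact Riemannian manifold, but
  elliptic theory on manifolds is not available in the libraries.\<close>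

locale laplace_spectral_setting =
  fixes \<A> :: "('m::{t2_space, second_countable_topology}, 'n::finite) chart set"
    and g :: "('m, 'n) chart \<Rightarrow> real^'n \<Rightarrow> real^'n^'n"
    and \<nu> :: "'m measure"
    and \<mu> :: "nat \<Rightarrow> real"
    and E :: "nat \<Rightarrow> ('m \<Rightarrow> real) set"
    and d :: "nat \<Rightarrow> nat"
    and \<phi> :: "nat \<Rightarrow> nat \<Rightarrow> 'm \<Rightarrow> real"
  assumes compact_M: "compact (UNIV :: 'm set)"
    and connected_M: "connected (UNIV :: 'm set)"
    and atlas: "smooth_atlas \<A>"
    and metric: "riemannian_metric \<A> g"
    and volume: "normalized_volume \<A> g \<nu>"
    and mu_0: "\<mu> 0 = 0"
    and mu_increasing: "strict_mono \<mu>"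
    and mu_eigenvalues: "range \<mu> = {m. \<exists>f\<in>eigenspace \<A> g m. f \<noteq> (\<lambda>x. 0)}"
    and E_def: "\<And>j. E j = eigenspace \<A> g (\<mu> j)"
    and basis: "\<And>j. orthonormal_basis \<nu> (E j) (d j) (\<phi> j)"
    and spectral_theorem: "\<And>f. f \<in> L2_space \<nu> \<Longrightarrow>
          (\<lambda>N. L2_norm \<nu> (\<lambda>x. f x - (\<Sum>j<N. proj \<nu> (E j) f x))) \<longlonglongrightarrow> 0"

definition eigen_kernel ::
  "(nat \<Rightarrow> nat) \<Rightarrow> (nat \<Rightarrow> nat \<Rightarrow> 'm \<Rightarrow> real) \<Rightarrow> nat \<Rightarrow> 'm \<Rightarrow> 'm \<Rightarrow> real" where
  "eigen_kernel d \<phi> j x y = (\<Sum>l<d j. \<phi> j l x * \<phi> j l y)"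

text \<open>Takes the value \<open>\<infinity>\<close> when the series diverges.\<close>

definition spectral_norm ::
  "'m measure \<Rightarrow> (nat \<Rightarrow> real) \<Rightarrow> (nat \<Rightarrow> ('m \<Rightarrow> real) set) \<Rightarrow> real \<Rightarrow> ('m \<Rightarrow> real) \<Rightarrow> ennreal" where
  "spectral_norm \<nu> \<mu> E q f =
     (\<Sum>j. ennreal ((1 + \<mu> j) powr (q / 2) * L2_norm \<nu> (proj \<nu> (E j) f)))"

section \<open>Log-densities, losses and rates\<close>

definition log_partition :: "'m measure \<Rightarrow> ('m \<Rightarrow> real) \<Rightarrow> real" where
  "log_partition \<nu> u = ln (\<integral>x. exp (u x) \<partial>\<nu>)"

definition exp_density :: "'m measure \<Rightarrow> ('m \<Rightarrow> real) \<Rightarrow> 'm \<Rightarrow> real" where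
  "exp_density \<nu> u x = exp (u x - log_partition \<nu> u)"

definition log_class ::
  "'m measure \<Rightarrow> (nat \<Rightarrow> real) \<Rightarrow> (nat \<Rightarrow> ('m \<Rightarrow> real) set) \<Rightarrow> real \<Rightarrow> real \<Rightarrow> real \<Rightarrow>
     ('m \<Rightarrow> real) set"
where
  "log_class \<nu> \<mu> E q R B =
     {u \<in> L2_space \<nu>. (\<integral>x. u x \<partial>\<nu>) = 0 \<and> spectral_norm \<nu> \<mu> E q u \<le> ennreal R \<and>
        Linf_norm \<nu> u \<le> ereal B}"

definition KL_div :: "'m measure \<Rightarrow> ('m \<Rightarrow> real) \<Rightarrow> ('m \<Rightarrow> real) \<Rightarrow> real" where
  "KL_div \<nu> p r = (\<integral>x. p x * ln (p x / r x) \<partial>\<nu>)"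

definition hellinger_sq :: "'m measure \<Rightarrow> ('m \<Rightarrow> real) \<Rightarrow> ('m \<Rightarrow> real) \<Rightarrow> real" where
  "hellinger_sq \<nu> p r = (1 / 2) * (\<integral>x. (sqrt (p x) - sqrt (r x))\<^sup>2 \<partial>\<nu>)"

definition L2_dist_sq :: "'m measure \<Rightarrow> ('m \<Rightarrow> real) \<Rightarrow> ('m \<Rightarrow> real) \<Rightarrow> real" where
  "L2_dist_sq \<nu> p r = (L2_norm \<nu> (\<lambda>x. p x - r x))\<^sup>2"

definition rate :: "real \<Rightarrow> real \<Rightarrow> real \<Rightarrow> real \<Rightarrow> real \<Rightarrow> real" where
  "rate \<alpha> \<gamma> q A \<delta> =
     (if q < \<gamma> then A powr (2 * \<gamma> / (q + \<gamma>)) * \<delta> powr (q / (q + \<gamma>))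
      else A powr (2 * (\<alpha> + \<gamma>) / (q + \<gamma> + 2 * \<alpha>)) * \<delta> powr ((q + \<alpha>) / (q + \<gamma> + 2 * \<alpha>)))"

section \<open>The positive sieve estimator\<close>

text \<open>A sample of size \<open>n\<close> is a function \<open>X\<close> on \<open>{..<n}\<close>.\<close>

definition empirical_mean :: "nat \<Rightarrow> (nat \<Rightarrow> 'm) \<Rightarrow> ('m \<Rightarrow> real) \<Rightarrow> real" where
  "empirical_mean n X f = (\<Sum>i<n. f (X i)) / real n"

definition sample_law :: "'m measure \<Rightarrow> ('m \<Rightarrow> real) \<Rightarrow> nat \<Rightarrow> (nat \<Rightarrow> 'm) measure" where
  "sample_law \<nu> u n = (\<Pi>\<^sub>M i\<in>{..<n}. density \<nu> (\<lambda>x. ennreal (exp_density \<nu> u x)))"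

definition spectral_cutoff :: "(nat \<Rightarrow> real) \<Rightarrow> real \<Rightarrow> nat set" where
  "spectral_cutoff \<mu> \<Lambda> = {j. 1 \<le> j \<and> \<mu> j \<le> \<Lambda>}"

definition sieve ::
  "'m measure \<Rightarrow> (nat \<Rightarrow> ('m \<Rightarrow> real) set) \<Rightarrow> nat set \<Rightarrow> real \<Rightarrow> ('m \<Rightarrow> real) set" where
  "sieve \<nu> E J b =
     {u. (\<exists>e. (\<forall>j\<in>J. e j \<in> E j) \<and> u = (\<lambda>x. \<Sum>j\<in>J. e j x)) \<and> Linf_norm \<nu> u \<le> ereal b}"

definition sieve_objective ::
  "'m measure \<Rightarrow> (nat \<Rightarrow> ('m \<Rightarrow> real) set) \<Rightarrow> nat set \<Rightarrow> (nat \<Rightarrow> real) \<Rightarrow> nat \<Rightarrow> (nat \<Rightarrow> 'm) \<Rightarrow>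
     ('m \<Rightarrow> real) \<Rightarrow> real"
where
  "sieve_objective \<nu> E J lam n X u =
     - empirical_mean n X u + log_partition \<nu> u
     + 4 * (\<Sum>j\<in>J. lam j * L2_norm \<nu> (proj \<nu> (E j) u))"

definition sieve_estimator ::
  "'m measure \<Rightarrow> (nat \<Rightarrow> ('m \<Rightarrow> real) set) \<Rightarrow> nat set \<Rightarrow> real \<Rightarrow> (nat \<Rightarrow> real) \<Rightarrow> nat \<Rightarrow>
     (nat \<Rightarrow> 'm) \<Rightarrow> 'm \<Rightarrow> real"
where
  "sieve_estimator \<nu> E J b lam n X =
     (THE u. is_arg_min (sieve_objective \<nu> E J lam n X) (\<lambda>v. v \<in> sieve \<nu> E J b) u)"

definition sieve_density ::
  "'m measure \<Rightarrow> (nat \<Rightarrow> ('m \<Rightarrow> real) set) \<Rightarrow> nat set \<Rightarrow> real \<Rightarrow> (nat \<Rightarrow> real) \<Rightarrow> nat \<Rightarrow>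
     (nat \<Rightarrow> 'm) \<Rightarrow> 'm \<Rightarrow> real"
where
  "sieve_density \<nu> E J b lam n X = exp_density \<nu> (sieve_estimator \<nu> E J b lam n X)"

definition score_fluctuation ::
  "'m measure \<Rightarrow> (nat \<Rightarrow> nat \<Rightarrow> 'm \<Rightarrow> real) \<Rightarrow> ('m \<Rightarrow> real) \<Rightarrow> nat \<Rightarrow> (nat \<Rightarrow> 'm) \<Rightarrow>
     nat \<Rightarrow> nat \<Rightarrow> real"
where
  "score_fluctuation \<nu> \<phi> u n X j l =
     empirical_mean n X (\<phi> j l) - (\<integral>x. \<phi> j l x * exp_density \<nu> u x \<partial>\<nu>)"

definition score_event ::
  "'m measure \<Rightarrow> (nat \<Rightarrow> nat) \<Rightarrow> (nat \<Rightarrow> nat \<Rightarrow> 'm \<Rightarrow> real) \<Rightarrow> nat set \<Rightarrow> (nat \<Rightarrow> real) \<Rightarrow>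
     ('m \<Rightarrow> real) \<Rightarrow> nat \<Rightarrow> (nat \<Rightarrow> 'm) set"
where
  "score_event \<nu> d \<phi> J lam u n =
     {X \<in> space (sample_law \<nu> u n).
        \<forall>j\<in>J. sqrt (\<Sum>l<d j. (score_fluctuation \<nu> \<phi> u n X j l)\<^sup>2) \<le> lam j}"

definition failure_prob ::
  "'m measure \<Rightarrow> (nat \<Rightarrow> nat) \<Rightarrow> (nat \<Rightarrow> nat \<Rightarrow> 'm \<Rightarrow> real) \<Rightarrow> nat set \<Rightarrow> (nat \<Rightarrow> real) \<Rightarrow>
     ('m \<Rightarrow> real) \<Rightarrow> nat \<Rightarrow> real"
where
  "failure_prob \<nu> d \<phi> J lam u n =
     measure (sample_law \<nu> u n) (space (sample_law \<nu> u n) - score_event \<nu> d \<phi> J lam u n)"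

text \<open>Expectations of the (nonnegative) losses are taken in \<open>[0, \<infinity>]\<close>, so that no
  integrability side condition is hidden.\<close>

definition worst_case_risk ::
  "'m measure \<Rightarrow> ('m \<Rightarrow> real) set \<Rightarrow> nat \<Rightarrow> (('m \<Rightarrow> real) \<Rightarrow> (nat \<Rightarrow> 'm) \<Rightarrow> real) \<Rightarrow> ennreal" where
  "worst_case_risk \<nu> \<U> n loss =
     (SUP u0\<in>\<U>. \<integral>\<^sup>+X. ennreal (loss (exp_density \<nu> u0) X) \<partial>sample_law \<nu> u0 n)"

end

theory Submission
  imports Defs
begin

text \<open>
  Write \<open>u\<^sub>0\<close> for the true log-density up to a constant, \<open>J\<close> for the index set of the sieve,
  \<open>t\<^sub>j\<close> for the \<open>L\<^sup>2\<close> norm of the component of \<open>u\<^sub>0\<close> in the \<open>j\<close>-th eigenspace, and \<open>\<rho>\<close> for the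
  rate. All log-densities in play are bounded by the sieve radius \<open>b\<close>. Up to factors depending
  on \<open>b\<close> only, the Kullback--Leibler divergence then dominates the squared Hellinger distance
  and the squared \<open>L\<^sup>2\<close> distance of the densities (\<open>hellinger_le_KL\<close>, \<open>L2_dist_le_hellinger\<close>),
  so that it suffices to control the Kullback--Leibler loss; and it is equivalent to the
  squared \<open>L\<^sup>2\<close> distance of the centred log-densities (\<open>L2_le_hellinger\<close>, \<open>KL_le_L2\<close>), in
  which approximation error is measured.

  The estimator minimizes a penalized empirical likelihood. Comparing it with the projection
  of \<open>u\<^sub>0\<close> onto the eigenspaces with index in a set \<open>K \<subseteq> J\<close>, and bounding the empirical
  fluctuation blockwise by the penalty weights \<open>\<lambda>\<^sub>j\<close> on the score event, gives an oracle
  inequality (\<open>sieve_oracle_inequality\<close>): for all \<open>S \<subseteq> K \<subseteq> J\<close> the loss is at most a constant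
  times \<open>\<Sum>\<^sub>j\<^sub>\<notin>\<^sub>K t\<^sub>j\<^sup>2 + \<Sum>\<^sub>j\<^sub>\<in>\<^sub>S \<lambda>\<^sub>j\<^sup>2 + \<Sum>\<^sub>j\<^sub>\<in>\<^sub>K\<^sub>-\<^sub>S \<lambda>\<^sub>j t\<^sub>j\<close>. On blocks of \<open>S\<close>
  the estimator pays its variance, on blocks of \<open>K - S\<close> it pays for shrinkage, and the other
  blocks are a bias. Membership in the smoothness class means
  \<open>\<Sum> (1 + \<mu>\<^sub>j)\<^sup>q\<^sup>/\<^sup>2 t\<^sub>j \<le> R\<close>. For \<open>q < \<gamma>\<close> one takes \<open>S\<close> empty and for \<open>K\<close> the
  frequencies below a threshold at which shrinkage and bias balance; for \<open>q \<ge> \<gamma>\<close> one takes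
  \<open>K = J\<close> and for \<open>S\<close> the frequencies below a threshold at which variance and shrinkage
  balance (\<open>rate_balancing_cutoff\<close>). Both choices give \<open>\<rho>\<close>. Off the score event the loss is
  still bounded by \<open>4 b\<close>, and that event fails with probability at most \<open>\<rho>\<close> for large \<open>n\<close>.

  Three facts about the spectral setting have to be supplied. The eigenspaces are mutually
  orthogonal, which follows from the convergence of the spectral expansion of a single
  eigenfunction (\<open>eigenspaces_orthogonal\<close>). The kernel of the Laplacian consists of the
  constants (\<open>harmonic_constant\<close>); otherwise the mean-zero condition would not remove the
  component of \<open>u\<^sub>0\<close> at frequency \<open>0\<close>, which the sieve does not see. This is the strong
  maximum principle, proved in charts with Hopf's barrier. Finally the minimizer exists and is
  unique (\<open>sieve_estimator_minimizes\<close>), by compactness of the set of admissible coefficients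
  and strict convexity of the log-partition function on mean-zero functions.
\<close>

section \<open>Linear algebra and the second derivative test\<close>

text \<open>
  Moving from \<open>A e\<close> along \<open>e\<close> changes the quadratic form linearly, with slope \<open>2 |A e|\<^sup>2\<close>, so
  a nonnegative form forces that slope to vanish.
\<close>
lemma psd_null_direction:
  fixes A :: "real^'n^'n"
  assumes sym: "transpose A = A" and psd: "\<And>x. 0 \<le> x \<bullet> (A *v x)"
    and e: "e \<bullet> (A *v e) = 0"
  shows "A *v e = 0"
proof (rule ccontr)
  assume ne: "A *v e \<noteq> 0"
  define c where "c = A *v e"
  define t where "t = - (c \<bullet> (A *v c) + 1) / (2 * (c \<bullet> c))"
  have cc: "c \<bullet> c > 0" using ne by (simp add: c_def)
  have sw: "e \<bullet> (A *v c) = c \<bullet> c"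
    using sym by (metis c_def dot_lmul_matrix transpose_matrix_vector)
  have "0 \<le> (c + t *\<^sub>R e) \<bullet> (A *v (c + t *\<^sub>R e))" by (rule psd)
  also have "\<dots> = c \<bullet> (A *v c) + 2 * t * (c \<bullet> c)"
    using e sw by (simp add: matrix_vector_right_distrib matrix_vector_mult_scaleR
        inner_add_left inner_add_right c_def[symmetric] inner_commute algebra_simps)
  also have "\<dots> = -1" using cc by (simp add: t_def field_simps)
  finally show False by simp
qed

text \<open>
  Gaussian elimination: subtracting \<open>c c\<^sup>T / \<alpha>\<close>, where \<open>c\<close> is the column of a nonzero diagonal
  entry \<open>\<alpha>\<close>, keeps \<open>A\<close> positive semidefinite and clears one more diagonal entry. The
  subtracted rank-one part contributes the nonpositive value \<open>c\<^sup>T H c / \<alpha>\<close>.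
\<close>
lemma sum_psd_times_nsd_nonpos:
  fixes A H :: "real^'n^'n"
  assumes "transpose A = A" and "\<And>x. 0 \<le> x \<bullet> (A *v x)" and nsd: "\<And>x. x \<bullet> (H *v x) \<le> 0"
  shows "(\<Sum>i\<in>UNIV. \<Sum>j\<in>UNIV. A$i$j * H$i$j) \<le> 0"
  using assms(1,2)
proof (induction "card {i. A$i$i \<noteq> 0}" arbitrary: A rule: less_induct)
  case less
  note sym = less.prems(1) and psd = less.prems(2)
  have diag: "A$i$i = axis i 1 \<bullet> (A *v axis i 1)" for i
    by (simp add: matrix_vector_mult_basis inner_axis' column_def)
  have null: "A$j$i = 0" if "A$i$i = 0" for i j
    using psd_null_direction[OF sym psd, of "axis i 1"] that diag[of i]
    by (simp add: matrix_vector_mult_basis column_def vec_eq_iff)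
  show ?case
  proof (cases "\<forall>i. A$i$i = 0")
    case True
    then show ?thesis using null by simp
  next
    case False
    then obtain k where k: "A$k$k \<noteq> 0" by auto
    define \<alpha> where "\<alpha> = A$k$k"
    define c where "c = column k A"
    have kpos: "\<alpha> > 0" using k psd[of "axis k 1"] by (simp add: \<alpha>_def diag[symmetric] less_le)
    define B where "B = (\<chi> i j. A$i$j - c$i * c$j / \<alpha>)"
    have symA: "A$i$j = A$j$i" for i j
      using sym by (metis transpose_def vec_lambda_beta)
    have Be: "B *v x = A *v x - ((c \<bullet> x) / \<alpha>) *\<^sub>R c" for x
      by (simp add: B_def vec_eq_iff matrix_vector_mult_def inner_vec_def sum_subtractf
          algebra_simps sum_distrib_left sum_divide_distrib)
    have Ak: "A *v axis k 1 = c" by (simp add: c_def matrix_vector_mult_basis)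
    have kA: "axis k 1 \<bullet> (A *v x) = c \<bullet> x" for x
      using sym Ak by (metis dot_lmul_matrix transpose_matrix_vector)
    have ck: "axis k 1 \<bullet> c = \<alpha>" "c \<bullet> axis k 1 = \<alpha>"
      by (simp_all add: c_def column_def \<alpha>_def inner_axis' inner_axis)
    have psdB: "0 \<le> x \<bullet> (B *v x)" for x
    proof -
      define s where "s = (c \<bullet> x) / \<alpha>"
      define y where "y = x - s *\<^sub>R axis k 1"
      have cx: "c \<bullet> x = s * \<alpha>" using kpos by (simp add: s_def)
      have Ay: "A *v y = A *v x - s *\<^sub>R c"
        by (simp add: y_def matrix_vector_mult_diff_distrib matrix_vector_mult_scaleR Ak)
      have "y \<bullet> (A *v y) = x \<bullet> (A *v x) - s * (x \<bullet> c) - s * (axis k 1 \<bullet> (A *v x)) + s * s * (axis k 1 \<bullet> c)"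
        unfolding Ay by (simp add: y_def inner_diff_left inner_diff_right algebra_simps)
      also have "\<dots> = x \<bullet> (A *v x) - s * (c \<bullet> x)"
        unfolding kA ck cx inner_commute[of x c] by simp
      also have "\<dots> = x \<bullet> (B *v x)"
        by (simp add: Be inner_diff_right s_def inner_commute)
      finally show ?thesis using psd[of y] by simp
    qed
    have symB: "transpose B = B"
      using symA by (simp add: B_def transpose_def vec_eq_iff mult.commute)
    have sub: "{i. B$i$i \<noteq> 0} \<subset> {i. A$i$i \<noteq> 0}"
    proof
      show "{i. B$i$i \<noteq> 0} \<subseteq> {i. A$i$i \<noteq> 0}"
        using null symA by (auto simp: B_def c_def column_def)
      have "B$k$k = 0" using kpos by (simp add: B_def c_def column_def \<alpha>_def)
      then show "{i. B$i$i \<noteq> 0} \<noteq> {i. A$i$i \<noteq> 0}" using k by auto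
    qed
    have "(\<Sum>i\<in>UNIV. \<Sum>j\<in>UNIV. B$i$j * H$i$j) \<le> 0"
      by (rule less.hyps[OF _ symB psdB]) (use sub in \<open>simp add: psubset_card_mono\<close>)
    moreover have "(\<Sum>i\<in>UNIV. \<Sum>j\<in>UNIV. A$i$j * H$i$j)
        = (\<Sum>i\<in>UNIV. \<Sum>j\<in>UNIV. B$i$j * H$i$j) + c \<bullet> (H *v c) / \<alpha>"
    proof -
      have "c \<bullet> (H *v c) / \<alpha> = (\<Sum>i\<in>UNIV. \<Sum>j\<in>UNIV. (c$i * c$j / \<alpha>) * H$i$j)"
        by (simp add: inner_vec_def matrix_vector_mult_def sum_divide_distrib sum_distrib_left mult_ac)
      then show ?thesis
        by (simp add: B_def sum.distrib[symmetric] left_diff_distrib)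
    qed
    moreover have "c \<bullet> (H *v c) / \<alpha> \<le> 0"
      using nsd[of c] kpos by (simp add: divide_nonpos_pos)
    ultimately show ?thesis by linarith
  qed
qed

text \<open>
  The restriction of \<open>v\<close> to the line through \<open>x\<close> in direction \<open>\<xi>\<close> has derivative \<open>0\<close> at the
  maximum; were its second derivative positive there, \<open>v\<close> would increase to the right of it.
\<close>
lemma second_order_at_local_max:
  fixes v :: "real^'n \<Rightarrow> real"
  assumes "open U" "x \<in> U"
    and v: "\<And>y. y \<in> U \<Longrightarrow> (v has_derivative (\<lambda>h. G y \<bullet> h)) (at y)"
    and G: "(G has_derivative (\<lambda>h. H *v h)) (at x)"
    and max: "\<And>y. y \<in> U \<Longrightarrow> v y \<le> v x"
  shows "G x = 0" and "\<xi> \<bullet> (H *v \<xi>) \<le> 0"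
proof -
  have "(\<lambda>h. G x \<bullet> h) = (\<lambda>h. 0)"
    using differential_zero_maxmin[OF \<open>x \<in> U\<close> \<open>open U\<close> v[OF \<open>x \<in> U\<close>]] max by blast
  then show G0: "G x = 0" by (metis inner_eq_zero_iff)
  show "\<xi> \<bullet> (H *v \<xi>) \<le> 0"
  proof (rule ccontr)
    assume pos: "\<not> \<xi> \<bullet> (H *v \<xi>) \<le> 0"
    define p where "p t = v (x + t *\<^sub>R \<xi>)" for t
    define p' where "p' t = G (x + t *\<^sub>R \<xi>) \<bullet> \<xi>" for t
    obtain e where e: "e > 0" "ball x e \<subseteq> U" using assms(1,2) by (meson openE)
    define s where "s = e / (norm \<xi> + 1)"
    have s: "s > 0" using e(1) by (simp add: s_def add_nonneg_pos)
    have inU: "x + t *\<^sub>R \<xi> \<in> U" if "\<bar>t\<bar> < s" for t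
    proof -
      have "\<bar>t\<bar> * norm \<xi> \<le> \<bar>t\<bar> * (norm \<xi> + 1)" by (simp add: mult_left_mono)
      also have "\<dots> < e" using that by (simp add: s_def pos_less_divide_eq add_nonneg_pos)
      finally show ?thesis using e(2) by (auto simp: dist_norm)
    qed
    have dp: "(p has_real_derivative p' t) (at t)" if "\<bar>t\<bar> < s" for t
    proof -
      have "((\<lambda>t. x + t *\<^sub>R \<xi>) has_derivative (\<lambda>h. h *\<^sub>R \<xi>)) (at t)"
        by (auto intro!: derivative_eq_intros)
      from has_derivative_compose[OF this v[OF inU[OF that]]]
      show ?thesis unfolding p_def p'_def has_field_derivative_def
        by (rule has_derivative_eq_rhs) (simp add: fun_eq_iff)
    qed
    have dp': "(p' has_real_derivative (\<xi> \<bullet> (H *v \<xi>))) (at 0)"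
    proof -
      have "((\<lambda>t. x + t *\<^sub>R \<xi>) has_derivative (\<lambda>h. h *\<^sub>R \<xi>)) (at 0)"
        by (auto intro!: derivative_eq_intros)
      from has_derivative_compose[OF this, of G "\<lambda>h. H *v h"] G
      have "((\<lambda>t. G (x + t *\<^sub>R \<xi>)) has_derivative (\<lambda>h. H *v (h *\<^sub>R \<xi>))) (at 0)" by simp
      from has_derivative_inner_left[OF this, of \<xi>]
      show ?thesis unfolding p'_def has_field_derivative_def
        by (rule has_derivative_eq_rhs) (simp add: fun_eq_iff matrix_vector_mult_scaleR inner_commute)
    qed
    obtain r where r: "r > 0" "\<And>h. 0 < h \<Longrightarrow> h < r \<Longrightarrow> p' 0 < p' h"
      using DERIV_pos_inc_right[OF dp'] pos by fastforce
    define h where "h = min r s / 2"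
    have h: "0 < h" "h < r" "h < s" using r(1) s by (auto simp: h_def)
    have "\<exists>y. 0 < y \<and> y < h \<and> p h - p 0 = (h - 0) * p' y"
      by (rule MVT2[OF h(1)]) (use h dp in auto)
    then obtain y where y: "0 < y" "y < h" "p h - p 0 = (h - 0) * p' y" by blast
    have "p' 0 = 0" by (simp add: p'_def G0)
    then have "p' y > 0" using r(2)[of y] y h by simp
    then have "p h > p 0" using y(3) h(1) by (simp add: algebra_simps)
    moreover have "p h \<le> p 0" using max[OF inU[of h]] h by (simp add: p_def)
    ultimately show False by simp
  qed
qed

section \<open>The strong maximum principle for elliptic operators\<close>

text \<open>
  For \<open>w = exp (- k |x - y|\<^sup>2)\<close> the operator gives \<open>2 k w (2 k \<theta> - N)\<close> with
  \<open>\<theta> = (x - y)\<^sup>T a (x - y)\<close> positive away from \<open>y\<close> and \<open>N\<close> independent of \<open>k\<close>. A large \<open>k\<close>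
  therefore makes \<open>w\<close> a strict subsolution on any compact set avoiding \<open>y\<close>.
\<close>
lemma hopf_barrier:
  fixes a :: "real^'n \<Rightarrow> real^'n^'n" and b :: "real^'n \<Rightarrow> real^'n"
  assumes K: "compact K" "y \<notin> K"
    and a: "continuous_on K a" and b: "continuous_on K b"
    and pd: "\<And>x \<xi>. x \<in> K \<Longrightarrow> \<xi> \<noteq> 0 \<Longrightarrow> 0 < \<xi> \<bullet> (a x *v \<xi>)"
  shows "\<exists>k>0. \<exists>w G H. w = (\<lambda>x. exp (- k * ((x - y) \<bullet> (x - y)))) \<and>
    (\<forall>x. (w has_derivative (\<lambda>h. G x \<bullet> h)) (at x)) \<and>
    (\<forall>x. (G has_derivative (\<lambda>h. H x *v h)) (at x)) \<and>
    (\<forall>x\<in>K. 0 < (\<Sum>i\<in>UNIV. \<Sum>j\<in>UNIV. a x$i$j * H x$i$j) + b x \<bullet> G x)"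
proof -
  define \<theta> where "\<theta> x = (x - y) \<bullet> (a x *v (x - y))" for x
  define N where "N x = (\<Sum>i\<in>UNIV. a x$i$i) + b x \<bullet> (x - y)" for x
  have \<theta>pos: "\<theta> x > 0" if "x \<in> K" for x
    using pd[of x "x - y"] that K by (auto simp: \<theta>_def)
  have "continuous_on K \<theta>"
    unfolding \<theta>_def inner_vec_def matrix_vector_mult_def
    by (auto intro!: continuous_intros a)
  moreover have "continuous_on K N"
    unfolding N_def by (auto intro!: continuous_intros a b)
  ultimately have "continuous_on K (\<lambda>x. N x / \<theta> x)"
    using \<theta>pos by (auto intro!: continuous_on_divide) force
  then have "bounded ((\<lambda>x. N x / \<theta> x) ` K)"
    using K(1) compact_continuous_image compact_imp_bounded by blast
  then obtain M where M: "\<And>x. x \<in> K \<Longrightarrow> \<bar>N x / \<theta> x\<bar> \<le> M"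
    unfolding bounded_iff by auto
  \<comment> \<open>any \<open>k > 0\<close> with \<open>2 k > M\<close> will do\<close>
  define k where "k = \<bar>M\<bar> + 1"
  define w where "w = (\<lambda>x. exp (- k * ((x - y) \<bullet> (x - y))))"
  define G where "G x = (- 2 * k * w x) *\<^sub>R (x - y)" for x
  define H where "H x = (\<chi> i j. w x * (4 * k\<^sup>2 * ((x - y)$i * (x - y)$j) - 2 * k * (if i = j then 1 else 0)))" for x
  have k: "k > 0" by (simp add: k_def)
  have dw: "(w has_derivative (\<lambda>h. G x \<bullet> h)) (at x)" for x
    unfolding w_def G_def
    by (auto intro!: derivative_eq_intros simp: fun_eq_iff inner_commute algebra_simps)
  have dG: "(G has_derivative (\<lambda>h. H x *v h)) (at x)" for x
  proof -
    have "(G has_derivative (\<lambda>h. (- 2 * k * w x) *\<^sub>R h + (- 2 * k * (G x \<bullet> h)) *\<^sub>R (x - y))) (at x)"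
      unfolding G_def[abs_def]
      by (rule derivative_eq_intros dw[unfolded G_def] refl | simp)+
    moreover have "H x *v h = (- 2 * k * w x) *\<^sub>R h + (- 2 * k * (G x \<bullet> h)) *\<^sub>R (x - y)" for h
    proof -
      have "(\<Sum>j\<in>UNIV. H x$i$j * h$j)
          = w x * 4 * k\<^sup>2 * (x - y)$i * ((x - y) \<bullet> h) - 2 * k * w x * h$i" for i
      proof -
        have "H x$i$j * h$j = w x * 4 * k\<^sup>2 * (x - y)$i * ((x - y)$j * h$j)
            - (if i = j then 2 * k * w x * h$j else 0)" for j
          by (simp add: H_def algebra_simps)
        then show ?thesis
          by (simp only: sum_subtractf sum_distrib_left[symmetric] inner_vec_def) simp
      qed
      then show ?thesis
        by (simp add: vec_eq_iff matrix_vector_mult_def G_def power2_eq_square)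
    qed
    ultimately show ?thesis by simp
  qed
  have pos: "0 < (\<Sum>i\<in>UNIV. \<Sum>j\<in>UNIV. a x$i$j * H x$i$j) + b x \<bullet> G x" if x: "x \<in> K" for x
  proof -
    have "(\<Sum>i\<in>UNIV. \<Sum>j\<in>UNIV. a x$i$j * H x$i$j)
        = w x * (4 * k\<^sup>2 * \<theta> x - 2 * k * (\<Sum>i\<in>UNIV. a x$i$i))"
    proof -
      have "(\<Sum>j\<in>UNIV. a x$i$j * H x$i$j)
          = w x * (4 * k\<^sup>2 * ((x - y)$i * (\<Sum>j\<in>UNIV. a x$i$j * (x - y)$j)) - 2 * k * a x$i$i)" for i
      proof -
        have "a x$i$j * H x$i$j = w x * 4 * k\<^sup>2 * (x - y)$i * (a x$i$j * (x - y)$j)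
            - (if i = j then w x * 2 * k * a x$i$j else 0)" for j
          by (simp add: H_def algebra_simps)
        then show ?thesis
          by (simp only: sum_subtractf sum_distrib_left[symmetric]) (simp add: algebra_simps)
      qed
      then show ?thesis
        by (simp add: \<theta>_def inner_vec_def matrix_vector_mult_def sum_distrib_left sum_subtractf
            right_diff_distrib)
    qed
    then have "(\<Sum>i\<in>UNIV. \<Sum>j\<in>UNIV. a x$i$j * H x$i$j) + b x \<bullet> G x
        = 2 * k * w x * (2 * k * \<theta> x - N x)"
      by (simp add: G_def N_def algebra_simps power2_eq_square)
    moreover have "N x < 2 * k * \<theta> x"
    proof -
      have "N x / \<theta> x < 2 * k" using abs_le_D1[OF M[OF x]] by (simp add: k_def del: abs_divide)
      then show ?thesis using \<theta>pos[OF x] by (simp add: pos_divide_less_eq)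
    qed
    ultimately show ?thesis using k by (simp add: w_def)
  qed
  show ?thesis using k w_def dw dG pos by blast
qed

text \<open>
  If \<open>F\<close> were smaller than \<open>m\<close> at a point \<open>y\<close> close to \<open>z0\<close>, a ball around \<open>y\<close> would touch the
  set \<open>{F = m}\<close> for the first time at some \<open>z\<close>. A ball of half the radius, centred at the
  midpoint \<open>p\<close> of \<open>y\<close> and \<open>z\<close>, meets that set in \<open>z\<close> only. Adding a small multiple of the
  barrier centred at \<open>p\<close> gives a function whose maximum over a small ball around \<open>z\<close> is
  interior, which the strict differential inequality forbids.
\<close>
lemma strong_maximum_principle_local:
  fixes F :: "real^'n \<Rightarrow> real" and G b :: "real^'n \<Rightarrow> real^'n" and H a :: "real^'n \<Rightarrow> real^'n^'n"
  assumes V: "open V"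
    and F: "\<And>x. x \<in> V \<Longrightarrow> (F has_derivative (\<lambda>h. G x \<bullet> h)) (at x)"
    and G: "\<And>x. x \<in> V \<Longrightarrow> (G has_derivative (\<lambda>h. H x *v h)) (at x)"
    and a: "continuous_on V a" and b: "continuous_on V b"
    and sym: "\<And>x. x \<in> V \<Longrightarrow> transpose (a x) = a x"
    and pd: "\<And>x \<xi>. x \<in> V \<Longrightarrow> \<xi> \<noteq> 0 \<Longrightarrow> 0 < \<xi> \<bullet> (a x *v \<xi>)"
    and L: "\<And>x. x \<in> V \<Longrightarrow> 0 \<le> (\<Sum>i\<in>UNIV. \<Sum>j\<in>UNIV. a x$i$j * H x$i$j) + b x \<bullet> G x"
    and max: "\<And>x. x \<in> V \<Longrightarrow> F x \<le> m"
    and z0: "z0 \<in> V" "F z0 = m"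
  shows "\<exists>r>0. ball z0 r \<subseteq> V \<and> (\<forall>x\<in>ball z0 r. F x = m)"
proof -
  obtain R where R: "R > 0" "ball z0 R \<subseteq> V" using V z0(1) by (meson openE)
  have contF: "continuous_on V F"
    using F by (meson continuous_at_imp_continuous_on has_derivative_continuous)
  have "F y = m" if y: "y \<in> ball z0 (R/3)" for y
  proof (rule ccontr)
    assume "F y \<noteq> m"
    define S where "S = {x \<in> cball z0 (2*R/3). F x = m}"
    have sub: "cball z0 (2*R/3) \<subseteq> V" using R by auto
    have "closed S"
      unfolding S_def by (rule continuous_closed_preimage_constant)
        (auto intro: continuous_on_subset[OF contF sub])
    moreover have "z0 \<in> S" using R z0 by (simp add: S_def)
    ultimately obtain z where z: "z \<in> S" "\<And>x. x \<in> S \<Longrightarrow> dist y z \<le> dist y x"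
      using distance_attains_inf[of S y] by blast
    define r where "r = dist y z"
    have yz0: "dist y z0 < R/3" using y by (simp add: dist_commute)
    have rR: "r < R/3" using z(2)[OF \<open>z0 \<in> S\<close>] yz0 by (simp add: r_def)
    have less: "F x < m" if "dist y x < r" for x
    proof -
      have "dist z0 x < 2*R/3"
        using dist_triangle[of z0 x y] that yz0 rR by (simp add: dist_commute)
      then have xb: "x \<in> cball z0 (2*R/3)" by simp
      then have "x \<notin> S" using z(2)[of x] that by (auto simp: r_def)
      then show ?thesis using xb sub max[of x] by (force simp: S_def)
    qed
    have rpos: "r > 0" using z(1) \<open>F y \<noteq> m\<close> by (auto simp: r_def S_def)
    define p where "p = (1/2) *\<^sub>R (y + z)"
    have inner_ball: "F x < m" if "dist p x \<le> r/2" "x \<noteq> z" for x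
    proof -
      \<comment> \<open>the parallelogram law: inside the half ball every point other than \<open>z\<close> is closer to \<open>y\<close> than \<open>z\<close> is\<close>
      have "(norm (x - y))\<^sup>2 + (norm (x - z))\<^sup>2 = 2 * (norm (x - p))\<^sup>2 + (norm (y - z))\<^sup>2 / 2"
        by (simp add: p_def power2_norm_eq_inner inner_add_left inner_add_right inner_diff_left
            inner_diff_right inner_commute field_simps)
      also have "\<dots> \<le> 2 * (r/2)\<^sup>2 + r\<^sup>2 / 2"
        using that(1) power_mono[of "norm (x - p)" "r/2" 2]
        by (simp add: r_def dist_norm norm_minus_commute)
      also have "\<dots> = r\<^sup>2" by (simp add: power2_eq_square)
      finally have "(norm (x - y))\<^sup>2 < r\<^sup>2" using that(2)
        by (smt (verit) eq_iff_diff_eq_0 norm_eq_zero zero_less_power2)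
      then show ?thesis
        using rpos by (intro less) (simp add: dist_norm norm_minus_commute power2_less_imp_less)
    qed
    have pz: "dist p z = r/2"
    proof -
      have "p - z = (1/2) *\<^sub>R (y - z)" by (simp add: p_def algebra_simps scaleR_2[symmetric] flip: scaleR_left.add)
      then show ?thesis by (simp add: r_def dist_norm)
    qed
    define \<epsilon> where "\<epsilon> = r/4"
    have \<epsilon>: "\<epsilon> > 0" "\<epsilon> < r/2" using rpos by (auto simp: \<epsilon>_def)
    define K where "K = cball z \<epsilon>"
    have "dist z0 z < 2*R/3" using dist_triangle[of z0 z y] yz0 rR by (simp add: r_def dist_commute)
    then have KV: "K \<subseteq> V"
    proof -
      have "x \<in> ball z0 R" if "x \<in> K" for x
        using dist_triangle[of z0 x z] that \<open>dist z0 z < 2*R/3\<close> \<epsilon> rR rpos by (auto simp: K_def)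
      then show ?thesis using R by blast
    qed
    have Kc: "compact K" by (simp add: K_def)
    have pK: "p \<notin> K" using pz \<epsilon> by (simp add: K_def dist_commute)
    have pdK: "0 < \<xi> \<bullet> (a x *v \<xi>)" if "x \<in> K" "\<xi> \<noteq> 0" for x \<xi>
      using pd that KV by blast
    obtain k w Gw Hw where k: "k > 0" and w: "w = (\<lambda>x. exp (- k * ((x - p) \<bullet> (x - p))))"
      and dw: "\<And>x. (w has_derivative (\<lambda>h. Gw x \<bullet> h)) (at x)"
      and dGw: "\<And>x. (Gw has_derivative (\<lambda>h. Hw x *v h)) (at x)"
      and Lw: "\<And>x. x \<in> K \<Longrightarrow> 0 < (\<Sum>i\<in>UNIV. \<Sum>j\<in>UNIV. a x$i$j * Hw x$i$j) + b x \<bullet> Gw x"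
      using hopf_barrier[OF Kc pK continuous_on_subset[OF a KV] continuous_on_subset[OF b KV]] pdK
      by blast
    have wlt: "w x < w z" if "dist p x > r/2" for x
    proof -
      have "(r/2)\<^sup>2 < (dist p x)\<^sup>2" using that rpos by (intro power_strict_mono) auto
      then have "(z - p) \<bullet> (z - p) < (x - p) \<bullet> (x - p)"
        using pz by (metis dist_commute dist_norm power2_norm_eq_inner)
      then show ?thesis using k by (simp add: w)
    qed
    define T where "T = sphere z \<epsilon> \<inter> cball p (r/2)"
    obtain \<eta> where \<eta>: "\<eta> > 0" "\<And>x. x \<in> T \<Longrightarrow> F x + \<eta> < m"
    proof (cases "T = {}")
      case True
      then show ?thesis using that[of 1] by simp
    next
      case False
      have "compact T" by (simp add: T_def compact_Int_closed)
      moreover have TV: "T \<subseteq> V" using KV by (auto simp: T_def K_def)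
      ultimately obtain t where t: "t \<in> T" "\<And>x. x \<in> T \<Longrightarrow> F x \<le> F t"
        using continuous_attains_sup[OF _ False continuous_on_subset[OF contF TV]] by blast
      have "F t < m" using inner_ball[of t] t(1) \<epsilon> by (auto simp: T_def)
      then show ?thesis using t(2) by (intro that[of "(m - F t)/2"]) (auto simp: field_simps, force)
    qed
    define v where "v x = F x + \<eta> * (w x - w z)" for x
    have w1: "w x \<le> 1" "w x > 0" for x using k by (simp_all add: w)
    have "continuous_on K v"
    proof -
      have "continuous_on K w"
        using dw by (meson continuous_at_imp_continuous_on has_derivative_continuous)
      then show ?thesis unfolding v_def using continuous_on_subset[OF contF KV]
        by (auto intro!: continuous_intros)
    qed
    then obtain x where x: "x \<in> K" "\<And>t. t \<in> K \<Longrightarrow> v t \<le> v x"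
      using continuous_attains_sup[OF Kc] \<epsilon> by (metis K_def centre_in_cball empty_iff less_imp_le)
    have "z \<in> K" using \<epsilon> by (simp add: K_def)
    have Fz: "F z = m" using z(1) by (simp add: S_def)
    have vx: "v x \<ge> m" using x(2)[OF \<open>z \<in> K\<close>] Fz by (simp add: v_def)
    have "dist z x \<noteq> \<epsilon>"
    proof
      assume sph: "dist z x = \<epsilon>"
      show False
      proof (cases "dist p x \<le> r/2")
        case True
        then have "F x + \<eta> < m" using sph by (intro \<eta>) (simp add: T_def)
        moreover have "\<eta> * (w x - w z) \<le> \<eta> * 1"
          using \<eta>(1) w1[of x] w1[of z] by (intro mult_left_mono) auto
        ultimately show False using vx by (simp add: v_def)
      next
        case False
        then have "\<eta> * (w x - w z) < 0" using wlt[of x] \<eta>(1) by (simp add: mult_pos_neg)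
        then show False using vx max[of x] x(1) KV by (force simp: v_def)
      qed
    qed
    then have xin: "x \<in> ball z \<epsilon>" using x(1) by (simp add: K_def)
    have BV: "ball z \<epsilon> \<subseteq> K" by (auto simp: K_def)
    have dv: "(v has_derivative (\<lambda>h. (G t + \<eta> *\<^sub>R Gw t) \<bullet> h)) (at t)" if "t \<in> ball z \<epsilon>" for t
    proof -
      have "t \<in> V" using that BV KV by blast
      show ?thesis unfolding v_def
        by (rule derivative_eq_intros F[OF \<open>t \<in> V\<close>] dw refl)+
          (simp add: fun_eq_iff inner_add_left)
    qed
    have xV: "x \<in> V" using x(1) KV by blast
    have dG: "((\<lambda>t. G t + \<eta> *\<^sub>R Gw t) has_derivative (\<lambda>h. (H x + \<eta> *\<^sub>R Hw x) *v h)) (at x)"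
    proof -
      have "((\<lambda>t. G t + \<eta> *\<^sub>R Gw t) has_derivative (\<lambda>h. H x *v h + \<eta> *\<^sub>R (Hw x *v h))) (at x)"
        by (rule derivative_intros G[OF xV] dGw)+
      then show ?thesis
        by (simp add: matrix_vector_mult_add_rdistrib scaleR_matrix_vector_assoc)
    qed
    note crit = second_order_at_local_max[OF open_ball xin dv dG]
    have gz: "G x + \<eta> *\<^sub>R Gw x = 0" and nsd: "\<And>\<xi>. \<xi> \<bullet> ((H x + \<eta> *\<^sub>R Hw x) *v \<xi>) \<le> 0"
      using crit x(2) BV by blast+
    have "0 \<le> \<xi> \<bullet> (a x *v \<xi>)" for \<xi>
      using pd[OF xV, of \<xi>] by (cases "\<xi> = 0") auto
    from sum_psd_times_nsd_nonpos[OF sym[OF xV] this nsd]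
    have "(\<Sum>i\<in>UNIV. \<Sum>j\<in>UNIV. a x$i$j * (H x + \<eta> *\<^sub>R Hw x)$i$j) + b x \<bullet> (G x + \<eta> *\<^sub>R Gw x) \<le> 0"
      using gz by simp
    moreover have "(\<Sum>i\<in>UNIV. \<Sum>j\<in>UNIV. a x$i$j * (H x + \<eta> *\<^sub>R Hw x)$i$j) + b x \<bullet> (G x + \<eta> *\<^sub>R Gw x)
       = ((\<Sum>i\<in>UNIV. \<Sum>j\<in>UNIV. a x$i$j * H x$i$j) + b x \<bullet> G x)
         + \<eta> * ((\<Sum>i\<in>UNIV. \<Sum>j\<in>UNIV. a x$i$j * Hw x$i$j) + b x \<bullet> Gw x)"
      by (simp add: inner_add_right sum.distrib sum_distrib_left distrib_left mult.left_commute)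
    ultimately show False
      using L[OF xV] mult_pos_pos[OF \<eta>(1) Lw[OF x(1)]] by linarith
  qed
  then show ?thesis using R by (intro exI[of _ "R/3"]) (auto simp: subset_iff)
qed

section \<open>Continuously differentiable coefficients\<close>

lemma has_derivative_frechet_on_open:
  fixes f :: "real^'n \<Rightarrow> real"
  assumes "open V" "f differentiable_on V" "y \<in> V"
  shows "(f has_derivative frechet_derivative f (at y)) (at y)"
  using assms by (metis differentiable_on_eq_differentiable_at frechet_derivative_works)

lemma partial_eqI:
  assumes "(f has_derivative D) (at y)"
  shows "partial i f y = D (axis i 1)"
  using frechet_derivative_at[OF assms] by (simp add: partial_def)

lemma has_derivative_partials:
  fixes f :: "real^'n \<Rightarrow> real"
  assumes "(f has_derivative D) (at y)"
  shows "(f has_derivative (\<lambda>h. (\<chi> i. partial i f y) \<bullet> h)) (at y)"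
proof -
  interpret D: bounded_linear D using assms by (rule has_derivative_bounded_linear)
  have "D h = (\<chi> i. partial i f y) \<bullet> h" for h
  proof -
    have "D h = D (\<Sum>i\<in>UNIV. (h$i) *\<^sub>R axis i 1)"
      using basis_expansion[of h] by (simp add: scalar_mult_eq_scaleR)
    also have "\<dots> = (\<chi> i. partial i f y) \<bullet> h"
      by (simp add: D.sum D.scaleR inner_vec_def partial_eqI[OF assms] mult.commute)
    finally show ?thesis .
  qed
  then show ?thesis using assms by (metis (no_types, lifting) ext)
qed

text \<open>
  Closure under algebraic operations is shown on the level of Frechet derivatives, where the
  rules of calculus are stated; the partial derivatives are their values on the axes.
\<close>
lemma C1I:
  assumes "\<And>y. y \<in> V \<Longrightarrow> (f has_derivative D y) (at y)"
    and "\<And>i. continuous_on V (\<lambda>y. D y (axis i 1))"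
  shows "Ck_on (Suc 0) V f"
proof -
  have "continuous_on V (partial i f)" for i
    using assms(2)[of i] by (rule continuous_on_eq) (simp add: partial_eqI[OF assms(1)])
  moreover have "f differentiable_on V"
    using assms(1) by (meson differentiable_at_imp_differentiable_on differentiable_def)
  ultimately show ?thesis by simp
qed

lemma C1D:
  fixes f :: "real^'n \<Rightarrow> real"
  assumes "Ck_on (Suc 0) V f" "open V"
  shows "\<And>y. y \<in> V \<Longrightarrow> (f has_derivative frechet_derivative f (at y)) (at y)"
    and "\<And>i. continuous_on V (\<lambda>y. frechet_derivative f (at y) (axis i 1))"
    and "continuous_on V f"
  using assms has_derivative_frechet_on_open[of V f] differentiable_imp_continuous_on[of f V]
  by (auto simp: partial_def[abs_def])

lemma C1_const: "Ck_on (Suc 0) V (\<lambda>_. c)"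
  by (rule C1I[where D = "\<lambda>_ _. 0"]) auto

lemma C1_add:
  assumes "open V" "Ck_on (Suc 0) V f" "Ck_on (Suc 0) V g"
  shows "Ck_on (Suc 0) V (\<lambda>y. f y + g y)"
proof (rule C1I)
  show "((\<lambda>y. f y + g y) has_derivative
      (\<lambda>h. frechet_derivative f (at y) h + frechet_derivative g (at y) h)) (at y)" if "y \<in> V" for y
    using C1D(1)[OF assms(2,1) that] C1D(1)[OF assms(3,1) that] by (rule has_derivative_add)
  show "continuous_on V (\<lambda>y. frechet_derivative f (at y) (axis i 1) + frechet_derivative g (at y) (axis i 1))" for i
    using C1D(2)[OF assms(2,1)] C1D(2)[OF assms(3,1)] by (rule continuous_on_add)
qed

lemma C1_mult:
  assumes "open V" "Ck_on (Suc 0) V f" "Ck_on (Suc 0) V g"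
  shows "Ck_on (Suc 0) V (\<lambda>y. f y * g y)"
proof (rule C1I)
  show "((\<lambda>y. f y * g y) has_derivative
      (\<lambda>h. f y * frechet_derivative g (at y) h + frechet_derivative f (at y) h * g y)) (at y)" if "y \<in> V" for y
    using C1D(1)[OF assms(2,1) that] C1D(1)[OF assms(3,1) that] by (rule has_derivative_mult)
  show "continuous_on V (\<lambda>y. f y * frechet_derivative g (at y) (axis i 1) + frechet_derivative f (at y) (axis i 1) * g y)" for i
    by (intro continuous_on_add continuous_on_mult C1D(2)[OF assms(2,1)] C1D(2)[OF assms(3,1)]
        C1D(3)[OF assms(2,1)] C1D(3)[OF assms(3,1)])
qed

lemma C1_sum:
  assumes "open V" "\<And>i. i \<in> I \<Longrightarrow> Ck_on (Suc 0) V (f i)"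
  shows "Ck_on (Suc 0) V (\<lambda>y. \<Sum>i\<in>I. f i y)"
  using assms(2) by (induction I rule: infinite_finite_induct)
    (simp_all add: C1_const C1_add[OF assms(1)] del: Ck_on.simps)

lemma C1_prod:
  assumes "open V" "\<And>i. i \<in> I \<Longrightarrow> Ck_on (Suc 0) V (f i)"
  shows "Ck_on (Suc 0) V (\<lambda>y. \<Prod>i\<in>I. f i y)"
  using assms(2) by (induction I rule: infinite_finite_induct)
    (simp_all add: C1_const C1_mult[OF assms(1)] del: Ck_on.simps)

lemma C1_inverse:
  assumes "open V" "Ck_on (Suc 0) V f" "\<And>y. y \<in> V \<Longrightarrow> f y \<noteq> 0"
  shows "Ck_on (Suc 0) V (\<lambda>y. inverse (f y))"
proof (rule C1I)
  show "((\<lambda>y. inverse (f y)) has_derivative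
      (\<lambda>h. - (inverse (f y) * frechet_derivative f (at y) h * inverse (f y)))) (at y)" if "y \<in> V" for y
    using Deriv.has_derivative_inverse[OF assms(3)[OF that] C1D(1)[OF assms(2,1) that]] .
  show "continuous_on V (\<lambda>y. - (inverse (f y) * frechet_derivative f (at y) (axis i 1) * inverse (f y)))" for i
    using assms(3) by (intro continuous_on_minus continuous_on_mult continuous_on_inverse
        C1D(2)[OF assms(2,1)] C1D(3)[OF assms(2,1)]) auto
qed

lemma C1_sqrt:
  assumes "open V" "Ck_on (Suc 0) V f" "\<And>y. y \<in> V \<Longrightarrow> f y > 0"
  shows "Ck_on (Suc 0) V (\<lambda>y. sqrt (f y))"
proof (rule C1I)
  show "((\<lambda>y. sqrt (f y)) has_derivative
      (\<lambda>h. frechet_derivative f (at y) h * (inverse (sqrt (f y)) / 2))) (at y)" if "y \<in> V" for y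
    using has_derivative_compose[OF C1D(1)[OF assms(2,1) that]
        DERIV_real_sqrt[OF assms(3)[OF that], unfolded has_field_derivative_def]]
    by (simp add: mult.commute)
  show "continuous_on V (\<lambda>y. frechet_derivative f (at y) (axis i 1) * (inverse (sqrt (f y)) / 2))" for i
    using assms(3) by (intro continuous_on_mult continuous_on_divide continuous_on_inverse
        continuous_on_real_sqrt continuous_on_const C1D(2)[OF assms(2,1)] C1D(3)[OF assms(2,1)]) force+
qed

lemma C1_det:
  fixes g :: "real^'n \<Rightarrow> real^'k^'k"
  assumes "open V" "\<And>i j. Ck_on (Suc 0) V (\<lambda>y. g y $ i $ j)"
  shows "Ck_on (Suc 0) V (\<lambda>y. det (g y))"
  unfolding det_def by (intro C1_sum C1_mult C1_prod C1_const assms)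

lemma matrix_inv_mult:
  fixes A :: "'a::semiring_1^'n^'m"
  assumes "invertible A"
  shows "A ** matrix_inv A = mat 1" and "matrix_inv A ** A = mat 1"
  using someI_ex[OF assms[unfolded invertible_def]] by (simp_all add: matrix_inv_def)

text \<open>
  Cramer's rule makes the entries of the inverse metric rational in the entries of the metric,
  hence as smooth as these.
\<close>
lemma matrix_inv_cramer:
  fixes A :: "real^'n^'n"
  assumes "det A \<noteq> 0"
  shows "matrix_inv A $ k $ j = det (\<chi> i l. if l = k then axis j 1 $ i else A$i$l) / det A"
proof -
  have "A ** matrix_inv A = mat 1"
    using assms by (simp add: invertible_det_nz matrix_inv_mult)
  then have "A *v (matrix_inv A *v axis j 1) = axis j 1"
    by (simp add: matrix_vector_mul_assoc)
  then have "matrix_inv A *v axis j 1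
      = (\<chi> k. det (\<chi> i l. if l = k then axis j 1 $ i else A$i$l) / det A)"
    using cramer[OF assms] by blast
  then show ?thesis by (simp add: matrix_vector_mult_basis column_def vec_eq_iff)
qed

lemma C1_matrix_inv:
  fixes g :: "real^'n \<Rightarrow> real^'k^'k"
  assumes V: "open V" and g: "\<And>i j. Ck_on (Suc 0) V (\<lambda>y. g y $ i $ j)"
    and nz: "\<And>y. y \<in> V \<Longrightarrow> det (g y) \<noteq> 0"
  shows "Ck_on (Suc 0) V (\<lambda>y. matrix_inv (g y) $ k $ j)"
proof -
  define h where "h = (\<lambda>y. det (\<chi> i l. if l = k then axis j 1 $ i else g y$i$l) * inverse (det (g y)))"
  have "Ck_on (Suc 0) V (\<lambda>y. (\<chi> i l. if l = k then axis j 1 $ i else g y$i$l) $ i $ l)" for i l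
    by (cases "l = k") (simp_all add: C1_const g del: Ck_on.simps)
  then have 1: "Ck_on (Suc 0) V h"
    unfolding h_def by (intro C1_mult[OF V] C1_inverse[OF V] C1_det[OF V] nz g)
  show ?thesis
  proof (rule C1I[where D = "\<lambda>y. frechet_derivative h (at y)"])
    fix y assume y: "y \<in> V"
    show "((\<lambda>y. matrix_inv (g y) $ k $ j) has_derivative frechet_derivative h (at y)) (at y)"
      by (rule has_derivative_transform_within_open[OF C1D(1)[OF 1 V y] V y])
        (simp add: h_def matrix_inv_cramer nz divide_inverse)
  next
    show "continuous_on V (\<lambda>y. frechet_derivative h (at y) (axis i 1))" for i
      by (rule C1D(2)[OF 1 V])
  qed
qed

text \<open>
  Along the segment from the identity to \<open>A\<close> all matrices are positive definite, so the
  determinant does not vanish and keeps the sign it has at the identity.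
\<close>
lemma det_pos_of_positive_definite:
  fixes A :: "real^'n^'n"
  assumes pd: "\<And>v. v \<noteq> 0 \<Longrightarrow> 0 < v \<bullet> (A *v v)"
  shows "0 < det A"
proof (rule ccontr)
  assume neg: "\<not> 0 < det A"
  define P where "P t = t *\<^sub>R A + (1 - t) *\<^sub>R mat 1" for t
  have nz: "det (P t) \<noteq> 0" if "0 \<le> t" "t \<le> 1" for t
  proof -
    have "P t *v v \<noteq> 0" if "v \<noteq> 0" for v
    proof -
      have "v \<bullet> (P t *v v) = t * (v \<bullet> (A *v v)) + (1 - t) * (v \<bullet> v)"
        by (simp add: P_def matrix_vector_mult_add_rdistrib flip: scaleR_matrix_vector_assoc)
           (simp add: inner_add_right)
      also have "\<dots> > 0"
        using pd[OF that] that \<open>0 \<le> t\<close> \<open>t \<le> 1\<close>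
        by (cases "t = 0") (auto intro: add_pos_nonneg)
      finally show ?thesis by auto
    qed
    then have "\<exists>B. B ** P t = mat 1"
      using matrix_left_invertible_ker by blast
    then show ?thesis
      using invertible_det_nz invertible_left_inverse by blast
  qed
  have "continuous_on {0..1} (\<lambda>t. det (P t))"
    unfolding det_def P_def by (intro continuous_intros)
  moreover have "det (P 1) \<le> 0" "0 \<le> det (P 0)" using neg by (simp_all add: P_def)
  ultimately obtain t where "0 \<le> t" "t \<le> 1" "det (P t) = 0"
    using IVT2'[of "\<lambda>t. det (P t)" 1 0 0] by auto
  then show False using nz by blast
qed

lemma matrix_inv_positive_definite:
  fixes A :: "real^'n^'n"
  assumes sym: "transpose A = A" and pd: "\<And>v. v \<noteq> 0 \<Longrightarrow> 0 < v \<bullet> (A *v v)"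
  shows "transpose (matrix_inv A) = matrix_inv A"
    and "\<xi> \<noteq> 0 \<Longrightarrow> 0 < \<xi> \<bullet> (matrix_inv A *v \<xi>)"
proof -
  have inv: "invertible A" using det_pos_of_positive_definite[OF pd] invertible_det_nz by force
  then have AB: "A ** matrix_inv A = mat 1" "matrix_inv A ** A = mat 1"
    by (simp_all add: matrix_inv_mult)
  have "transpose (matrix_inv A) ** A = mat 1"
    using AB(1) by (metis matrix_transpose_mul sym transpose_mat)
  then show "transpose (matrix_inv A) = matrix_inv A"
    using AB by (metis matrix_mul_assoc matrix_mul_lid matrix_mul_rid)
  assume "\<xi> \<noteq> 0"
  define v where "v = matrix_inv A *v \<xi>"
  have Av: "A *v v = \<xi>" by (simp add: v_def matrix_vector_mul_assoc AB)
  then have "v \<noteq> 0" using \<open>\<xi> \<noteq> 0\<close> by auto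
  then have "0 < v \<bullet> (A *v v)" by (rule pd)
  then show "0 < \<xi> \<bullet> (matrix_inv A *v \<xi>)" by (simp add: Av v_def[symmetric] inner_commute)
qed

section \<open>Harmonic functions on compact connected manifolds\<close>

text \<open>
  The divergence form of the Laplacian expands to a nondivergence operator with leading
  coefficients \<open>a = sqrt (det g) g\<^sup>-\<^sup>1\<close> and drift the divergence of \<open>a\<close>. The barrier argument
  requires a locally bounded drift, and this is where \<open>C\<^sup>1\<close> regularity of \<open>a\<close> enters.
\<close>
lemma harmonic_locally_constant_at_max:
  fixes c :: "('m, 'n::finite) chart" and g :: "('m, 'n) chart \<Rightarrow> real^'n \<Rightarrow> real^'n^'n"
  assumes V: "open V"
    and g: "\<And>i j. Ck_on (Suc 0) V (\<lambda>y. g c y $ i $ j)"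
    and symg: "\<And>y. y \<in> V \<Longrightarrow> transpose (g c y) = g c y"
    and pd: "\<And>y v. y \<in> V \<Longrightarrow> v \<noteq> 0 \<Longrightarrow> 0 < v \<bullet> (g c y *v v)"
    and F: "Ck_on (Suc (Suc 0)) V F"
    and harm: "\<And>y. y \<in> V \<Longrightarrow> laplacian_coord g c F y = 0"
    and max: "\<And>y. y \<in> V \<Longrightarrow> F y \<le> m" and z0: "z0 \<in> V" "F z0 = m"
  shows "\<exists>r>0. ball z0 r \<subseteq> V \<and> (\<forall>x\<in>ball z0 r. F x = m)"
proof -
  have det_pos: "0 < det (g c y)" if "y \<in> V" for y
    using det_pos_of_positive_definite pd[OF that] by blast
  define a where "a y = sqrt (det (g c y)) *\<^sub>R matrix_inv (g c y)" for y
  have aC1: "Ck_on (Suc 0) V (\<lambda>y. a y $ i $ j)" for i j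
    unfolding a_def using det_pos
    by (simp del: Ck_on.simps,
        intro C1_mult[OF V] C1_sqrt[OF V] C1_det[OF V] C1_matrix_inv[OF V] g) force+
  have sym_a: "transpose (a y) = a y" if "y \<in> V" for y
    using matrix_inv_positive_definite(1)[OF symg[OF that] pd[OF that]]
    by (simp add: a_def transpose_def vec_eq_iff)
  define b where "b y = (\<chi> j. \<Sum>i\<in>UNIV. partial i (\<lambda>z. a z $ i $ j) y)" for y
  define G where "G y = (\<chi> j. partial j F y)" for y
  define H where "H y = (\<chi> j i. partial i (partial j F) y)" for y
  have pF: "Ck_on (Suc 0) V (partial j F)" for j using F by simp
  have FC1: "Ck_on (Suc 0) V F"
    using pF C1D(3)[OF pF V] F by simp
  have dF: "(F has_derivative (\<lambda>h. G y \<bullet> h)) (at y)" if "y \<in> V" for y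
    unfolding G_def by (rule has_derivative_partials[OF C1D(1)[OF FC1 V that]])
  have dG: "(G has_derivative (\<lambda>h. H y *v h)) (at y)" if "y \<in> V" for y
  proof -
    have "((\<lambda>y. G y $ j) has_derivative (\<lambda>h. (H y *v h) $ j)) (at y)" for j
      using has_derivative_partials[OF C1D(1)[OF pF[of j] V that]]
      by (simp add: G_def H_def matrix_vector_mult_def inner_vec_def)
    then have "\<forall>e\<in>Basis. ((\<lambda>y. G y \<bullet> e) has_derivative (\<lambda>h. (H y *v h) \<bullet> e)) (at y)"
      by (simp add: Basis_vec_def inner_axis)
    then show ?thesis
      unfolding has_derivative_componentwise_within[of G "\<lambda>h. H y *v h"] .
  qed
  have L: "0 = (\<Sum>i\<in>UNIV. \<Sum>j\<in>UNIV. a y$i$j * H y$i$j) + b y \<bullet> G y" if y: "y \<in> V" for y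
  proof -
    have "partial i (\<lambda>z. sqrt (det (g c z)) * (\<Sum>j\<in>UNIV. matrix_inv (g c z) $ i $ j * partial j F z)) y
        = (\<Sum>j\<in>UNIV. a y $ i $ j * H y $ j $ i + partial i (\<lambda>z. a z $ i $ j) y * G y $ j)" for i
    proof -
      have "((\<lambda>z. \<Sum>j\<in>UNIV. a z $ i $ j * partial j F z) has_derivative
         (\<lambda>h. \<Sum>j\<in>UNIV. a y $ i $ j * frechet_derivative (partial j F) (at y) h
            + frechet_derivative (\<lambda>z. a z $ i $ j) (at y) h * partial j F y)) (at y)"
        by (intro has_derivative_sum has_derivative_mult C1D(1)[OF aC1 V y] C1D(1)[OF pF V y])
      from partial_eqI[OF this, of i] show ?thesis
        by (simp add: a_def G_def H_def sum_distrib_left mult.assoc partial_def)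
    qed
    then have e0: "0 = (\<Sum>i\<in>UNIV. \<Sum>j\<in>UNIV. a y $ i $ j * H y $ j $ i + partial i (\<lambda>z. a z $ i $ j) y * G y $ j)"
      using harm[OF y] det_pos[OF y] by (simp add: laplacian_coord_def)
    have e1: "(\<Sum>i\<in>UNIV. \<Sum>j\<in>UNIV. a y $ i $ j * H y $ j $ i + partial i (\<lambda>z. a z $ i $ j) y * G y $ j)
        = (\<Sum>i\<in>UNIV. \<Sum>j\<in>UNIV. a y $ i $ j * H y $ j $ i)
        + (\<Sum>i\<in>UNIV. \<Sum>j\<in>UNIV. partial i (\<lambda>z. a z $ i $ j) y * G y $ j)"
      by (simp add: sum.distrib)
    have e2: "(\<Sum>i\<in>UNIV. \<Sum>j\<in>UNIV. partial i (\<lambda>z. a z $ i $ j) y * G y $ j) = b y \<bullet> G y"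
    proof -
      have "b y \<bullet> G y = (\<Sum>j\<in>UNIV. \<Sum>i\<in>UNIV. partial i (\<lambda>z. a z $ i $ j) y * G y $ j)"
        by (simp add: b_def inner_vec_def sum_distrib_right)
      also have "\<dots> = (\<Sum>i\<in>UNIV. \<Sum>j\<in>UNIV. partial i (\<lambda>z. a z $ i $ j) y * G y $ j)"
        by (rule sum.swap)
      finally show ?thesis by (rule sym)
    qed
    have e3: "(\<Sum>i\<in>UNIV. \<Sum>j\<in>UNIV. a y $ i $ j * H y $ j $ i) = (\<Sum>i\<in>UNIV. \<Sum>j\<in>UNIV. a y$i$j * H y$i$j)"
    proof -
      have "a y $ i $ j = a y $ j $ i" for i j
        using sym_a[OF y] by (metis transpose_def vec_lambda_beta)
      then have "(\<Sum>i\<in>UNIV. \<Sum>j\<in>UNIV. a y $ i $ j * H y $ j $ i)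
          = (\<Sum>i\<in>UNIV. \<Sum>j\<in>UNIV. a y $ j $ i * H y $ j $ i)" by presburger
      also have "\<dots> = (\<Sum>i\<in>UNIV. \<Sum>j\<in>UNIV. a y$i$j * H y$i$j)" by (rule sum.swap)
      finally show ?thesis .
    qed
    show ?thesis using e0 unfolding e1 e2 e3 .
  qed
  show ?thesis
  proof (rule strong_maximum_principle_local[OF V dF dG _ _ _ _ _ max z0])
    show "continuous_on V a"
    proof -
      have "continuous_on V (\<lambda>y. \<chi> i j. a y $ i $ j)"
        by (intro continuous_on_vec_lambda C1D(3)[OF aC1 V])
      then show ?thesis by simp
    qed
    show "continuous_on V b"
    proof -
      have "continuous_on V (\<lambda>y. \<Sum>i\<in>UNIV. partial i (\<lambda>z. a z $ i $ j) y)" for j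
        using aC1 by (intro continuous_on_sum) simp
      then show ?thesis
        unfolding b_def by (intro continuous_on_vec_lambda)
    qed
    show "transpose (a y) = a y" if "y \<in> V" for y by (rule sym_a[OF that])
    show "0 < \<xi> \<bullet> (a y *v \<xi>)" if "y \<in> V" "\<xi> \<noteq> 0" for y \<xi>
      using matrix_inv_positive_definite(2)[OF symg[OF that(1)] pd[OF that(1)] that(2)] det_pos[OF that(1)]
      by (simp add: a_def scaleR_matrix_vector_assoc[symmetric])
    show "0 \<le> (\<Sum>i\<in>UNIV. \<Sum>j\<in>UNIV. a y$i$j * H y$i$j) + b y \<bullet> G y" if "y \<in> V" for y
      using L[OF that] by simp
  qed assumption+
qed

lemma continuous_smooth_on_manifold:
  assumes atl: "smooth_atlas \<A>" and f: "smooth_on_manifold \<A> f"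
  shows "continuous_on UNIV f"
proof -
  have "continuous_on (fst c) f" if c: "c \<in> \<A>" for c
  proof -
    have hom: "homeomorphism (fst c) (chart_image c) (snd c) (chart_inv c)"
      using atl c by (simp add: smooth_atlas_def)
    have "Ck_on 0 (chart_image c) (f \<circ> chart_inv c)"
      using f c by (simp add: smooth_on_manifold_def smooth_fun_on_def del: Ck_on.simps)
    then have "continuous_on (chart_image c) (f \<circ> chart_inv c)" by simp
    then have "continuous_on (fst c) ((f \<circ> chart_inv c) \<circ> snd c)"
      using hom by (intro continuous_on_compose[of _ "snd c"]) (auto simp: homeomorphism_def)
    then show ?thesis
      by (rule continuous_on_eq) (use hom in \<open>auto simp: homeomorphism_def\<close>)
  qed
  then have "continuous_on (\<Union>c\<in>\<A>. fst c) f"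
    using atl by (intro continuous_on_open_UN) (auto simp: smooth_atlas_def)
  then show ?thesis using atl by (simp add: smooth_atlas_def)
qed

text \<open>
  The set where a harmonic function attains its maximum is closed, nonempty by compactness,
  and open by the strong maximum principle in a chart; connectedness makes it everything.
\<close>
lemma harmonic_constant:
  fixes \<A> :: "('m::topological_space, 'n::finite) chart set"
  assumes M: "compact (UNIV :: 'm set)" "connected (UNIV :: 'm set)"
    and atl: "smooth_atlas \<A>" and met: "riemannian_metric \<A> g"
    and f: "f \<in> eigenspace \<A> g 0"
  shows "\<exists>k. f = (\<lambda>x. k)"
proof -
  have sm: "smooth_on_manifold \<A> f" and lap: "has_laplacian \<A> g f (\<lambda>x. 0)"
    using f by (auto simp: eigenspace_def)
  have cont: "continuous_on UNIV f" by (rule continuous_smooth_on_manifold[OF atl sm])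
  obtain x0 where x0: "\<And>x. f x \<le> f x0"
    using continuous_attains_sup[OF M(1) _ cont] by auto
  define S where "S = {x. f x = f x0}"
  have "closed S"
    unfolding S_def using continuous_closed_preimage_constant[OF cont, of "f x0"] by simp
  moreover have "open S"
  proof (subst open_subopen, intro ballI)
    fix x assume x: "x \<in> S"
    have "x \<in> (\<Union>c\<in>\<A>. fst c)" using atl by (simp add: smooth_atlas_def)
    then obtain c where c: "c \<in> \<A>" "x \<in> fst c" by blast
    have V: "open (chart_image c)" and U: "open (fst c)"
      and hom: "homeomorphism (fst c) (chart_image c) (snd c) (chart_inv c)"
      using atl c(1) by (auto simp: smooth_atlas_def)
    have "\<exists>r>0. ball (snd c x) r \<subseteq> chart_image c \<and> (\<forall>y\<in>ball (snd c x) r. (f \<circ> chart_inv c) y = f x0)"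
    proof (rule harmonic_locally_constant_at_max[of _ g c])
      show "Ck_on (Suc 0) (chart_image c) (\<lambda>y. g c y $ i $ j)" for i j
        using met c(1) by (simp add: riemannian_metric_def smooth_fun_on_def del: Ck_on.simps)
      show "transpose (g c y) = g c y" if "y \<in> chart_image c" for y
        using met c(1) that by (simp add: riemannian_metric_def)
      show "0 < v \<bullet> (g c y *v v)" if "y \<in> chart_image c" "v \<noteq> 0" for y v
        using met c(1) that by (simp add: riemannian_metric_def)
      show "Ck_on (Suc (Suc 0)) (chart_image c) (f \<circ> chart_inv c)"
        using sm c(1) by (simp add: smooth_on_manifold_def smooth_fun_on_def del: Ck_on.simps)
      show "laplacian_coord g c (f \<circ> chart_inv c) y = 0" if "y \<in> chart_image c" for y
        using lap c(1) that by (auto simp: has_laplacian_def chart_image_def)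
      show "(f \<circ> chart_inv c) (snd c x) = f x0"
        using hom c(2) x by (simp add: homeomorphism_def S_def)
    qed (use V x0 c(2) in \<open>auto simp: chart_image_def\<close>)
    then obtain r where r: "r > 0" "\<And>y. y \<in> ball (snd c x) r \<Longrightarrow> (f \<circ> chart_inv c) y = f x0" by blast
    have "open (snd c -` ball (snd c x) r \<inter> fst c)"
      using hom U continuous_on_open_vimage[OF U] by (auto simp: homeomorphism_def)
    moreover have "x \<in> snd c -` ball (snd c x) r \<inter> fst c" using c(2) r(1) by simp
    moreover have "snd c -` ball (snd c x) r \<inter> fst c \<subseteq> S"
    proof
      fix y assume y: "y \<in> snd c -` ball (snd c x) r \<inter> fst c"
      then have "chart_inv c (snd c y) = y" using hom by (simp add: homeomorphism_def)
      then show "y \<in> S" using r(2)[of "snd c y"] y by (simp add: S_def)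
    qed
    ultimately show "\<exists>T. open T \<and> x \<in> T \<and> T \<subseteq> S" by blast
  qed
  ultimately have "S = UNIV"
    using M(2) unfolding connected_clopen by (auto simp: S_def)
  then show ?thesis by (auto simp: S_def fun_eq_iff intro!: exI[of _ "f x0"])
qed

lemma constant_in_eigenspace_0:
  fixes \<A> :: "('m, 'n::finite) chart set"
  shows "(\<lambda>x. k) \<in> eigenspace \<A> g 0"
proof -
  have p0: "partial i (\<lambda>z. k) = (\<lambda>z. 0)" for i :: 'n and k
    by (simp add: partial_def fun_eq_iff)
  have "Ck_on n V (\<lambda>z. k)" for n and V :: "(real^'n) set" and k
    by (induction n arbitrary: k) (simp_all add: p0)
  then show ?thesis
    by (simp add: eigenspace_def smooth_on_manifold_def smooth_fun_on_def has_laplacian_def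
        laplacian_coord_def p0 comp_def del: Ck_on.simps)
qed

section \<open>Losses between bounded log-densities\<close>

context prob_space
begin

lemma integrable_AE_bounded:
  fixes f :: "'a \<Rightarrow> real"
  assumes [measurable]: "f \<in> borel_measurable M" and f: "AE x in M. \<bar>f x\<bar> \<le> b"
  shows "integrable M f" and "integrable M (\<lambda>x. (f x)\<^sup>2)"
proof -
  show "integrable M f" by (rule integrable_const_bound[of _ b]) (use f in auto)
  show "integrable M (\<lambda>x. (f x)\<^sup>2)"
  proof (rule integrable_const_bound[of _ "b\<^sup>2"])
    show "AE x in M. norm ((f x)\<^sup>2) \<le> b\<^sup>2"
      using f
    proof eventually_elim
      case (elim x)
      then show ?case using power_mono[of "\<bar>f x\<bar>" b 2] by simp
    qed
  qed measurable
qed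

lemma integrable_exp_bounded:
  fixes u :: "'a \<Rightarrow> real"
  assumes [measurable]: "u \<in> borel_measurable M" and "AE x in M. \<bar>u x\<bar> \<le> b"
  shows "integrable M (\<lambda>x. exp (u x))"
  by (rule integrable_const_bound[of _ "exp b"]) (use assms(2) in auto)

lemma integral_exp_bounds:
  fixes u :: "'a \<Rightarrow> real"
  assumes [measurable]: "u \<in> borel_measurable M" and b: "AE x in M. \<bar>u x\<bar> \<le> b"
  shows "exp (- b) \<le> (\<integral>x. exp (u x) \<partial>M)" and "(\<integral>x. exp (u x) \<partial>M) \<le> exp b"
proof -
  note i = integrable_exp_bounded[OF assms]
  show "exp (- b) \<le> (\<integral>x. exp (u x) \<partial>M)" by (rule integral_ge_const[OF i]) (use b in auto)
  show "(\<integral>x. exp (u x) \<partial>M) \<le> exp b" by (rule integral_le_const[OF i]) (use b in auto)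
qed

lemma integral_exp_pos:
  fixes u :: "'a \<Rightarrow> real"
  assumes "u \<in> borel_measurable M" and "AE x in M. \<bar>u x\<bar> \<le> b"
  shows "0 < (\<integral>x. exp (u x) \<partial>M)"
  using integral_exp_bounds(1)[OF assms] by (smt (verit) exp_gt_zero)

lemma exp_log_partition:
  assumes "u \<in> borel_measurable M" and "AE x in M. \<bar>u x\<bar> \<le> b"
  shows "exp (log_partition M u) = (\<integral>x. exp (u x) \<partial>M)"
  using integral_exp_pos[OF assms] by (simp add: log_partition_def)

lemma log_partition_abs_le:
  assumes "u \<in> borel_measurable M" and "AE x in M. \<bar>u x\<bar> \<le> b"
  shows "\<bar>log_partition M u\<bar> \<le> b"
proof -
  have "exp (- b) \<le> exp (log_partition M u)" "exp (log_partition M u) \<le> exp b"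
    using integral_exp_bounds[OF assms] by (simp_all add: exp_log_partition[OF assms])
  then show ?thesis by simp
qed

lemma measurable_exp_density [measurable]:
  assumes [measurable]: "u \<in> borel_measurable M"
  shows "exp_density M u \<in> borel_measurable M"
  unfolding exp_density_def[abs_def] by measurable

lemma integrable_exp_density:
  assumes "u \<in> borel_measurable M" and "AE x in M. \<bar>u x\<bar> \<le> b"
  shows "integrable M (exp_density M u)" and "(\<integral>x. exp_density M u x \<partial>M) = 1"
proof -
  have e: "exp_density M u = (\<lambda>x. exp (u x) / exp (log_partition M u))"
    by (simp add: exp_density_def fun_eq_iff exp_diff)
  show "integrable M (exp_density M u)"
    unfolding e using integrable_exp_bounded[OF assms] by simp
  show "(\<integral>x. exp_density M u x \<partial>M) = 1"
    unfolding e using exp_log_partition[OF assms] by simp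
      (metis divide_self_if exp_not_eq_zero)
qed

lemma log_density_AE_le:
  assumes "u \<in> borel_measurable M" and "AE x in M. \<bar>u x\<bar> \<le> b"
  shows "AE x in M. \<bar>u x - log_partition M u\<bar> \<le> 2 * b"
  using assms(2) log_partition_abs_le[OF assms] by auto

lemma KL_div_exp_density:
  "KL_div M (exp_density M u) (exp_density M v)
    = (\<integral>x. exp_density M u x * ((u x - log_partition M u) - (v x - log_partition M v)) \<partial>M)"
  unfolding KL_div_def by (simp add: exp_density_def ln_div)

lemma integrable_bounded_mult_exp:
  assumes [measurable]: "u \<in> borel_measurable M" "f \<in> borel_measurable M"
    and u: "AE x in M. \<bar>u x\<bar> \<le> b" and f: "AE x in M. \<bar>f x\<bar> \<le> c"
  shows "integrable M (\<lambda>x. exp_density M u x * f x)"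
proof (rule integrable_const_bound[of _ "exp (2 * b) * c"])
  show "AE x in M. norm (exp_density M u x * f x) \<le> exp (2 * b) * c"
    using log_density_AE_le[OF assms(1) u] f
  proof eventually_elim
    case (elim x)
    then have "exp_density M u x \<le> exp (2 * b)" by (simp add: exp_density_def)
    then show ?case using elim(2)
      by (simp add: abs_mult mult_mono exp_density_def)
  qed
qed measurable

text \<open>
  In this form the divergence is affine in the linear statistics of \<open>v\<close>, so it can be compared
  with the penalized likelihood term by term.
\<close>
lemma KL_div_eq_log_partition_diff:
  assumes [measurable]: "u \<in> borel_measurable M" "v \<in> borel_measurable M"
    and u: "AE x in M. \<bar>u x\<bar> \<le> b" and v: "AE x in M. \<bar>v x\<bar> \<le> b"
  shows "KL_div M (exp_density M u) (exp_density M v)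
    = (\<integral>x. exp_density M u x * u x \<partial>M) - (\<integral>x. exp_density M u x * v x \<partial>M)
      + log_partition M v - log_partition M u"
proof -
  note i = integrable_bounded_mult_exp[OF _ _ u u] integrable_bounded_mult_exp[OF _ _ u v]
    integrable_exp_density[OF _ u]
  have "KL_div M (exp_density M u) (exp_density M v)
    = (\<integral>x. exp_density M u x * u x - exp_density M u x * v x
         + exp_density M u x * (log_partition M v - log_partition M u) \<partial>M)"
    unfolding KL_div_exp_density by (simp add: algebra_simps)
  then show ?thesis using i by simp
qed

lemma sqrt_exp_density: "sqrt (exp_density M u x) = exp ((u x - log_partition M u) / 2)"
  unfolding exp_density_def
  by (rule real_sqrt_unique) (simp_all add: power2_eq_square flip: exp_add)

lemma integrable_hellinger:
  assumes [measurable]: "u \<in> borel_measurable M" "v \<in> borel_measurable M"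
    and u: "AE x in M. \<bar>u x\<bar> \<le> b" and v: "AE x in M. \<bar>v x\<bar> \<le> b"
  shows "integrable M (\<lambda>x. (sqrt (exp_density M u x) - sqrt (exp_density M v x))\<^sup>2)"
proof (rule Bochner_Integration.integrable_bound)
  show "integrable M (\<lambda>x. 2 * exp_density M u x + 2 * exp_density M v x)"
    using integrable_exp_density[OF _ u] integrable_exp_density[OF _ v] by simp
  have "(sqrt p - sqrt r)\<^sup>2 \<le> 2 * p + 2 * r" if "0 \<le> p" "0 \<le> r" for p r :: real
  proof -
    have "(sqrt p - sqrt r)\<^sup>2 + (sqrt p + sqrt r)\<^sup>2 = 2 * p + 2 * r"
      using that by (simp add: power2_sum power2_diff)
    then show ?thesis by (smt (verit) zero_le_power2)
  qed
  then show "AE x in M. norm ((sqrt (exp_density M u x) - sqrt (exp_density M v x))\<^sup>2)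
      \<le> norm (2 * exp_density M u x + 2 * exp_density M v x)"
    by (simp add: exp_density_def)
qed measurable

text \<open>
  The pointwise inequality \<open>(\<surd>p - \<surd>r)\<^sup>2 \<le> p ln (p / r) + r - p\<close> is \<open>1 + x \<le> exp x\<close> for
  \<open>x = ln (r / p) / 2\<close>, and \<open>r - p\<close> has integral \<open>0\<close>.
\<close>
lemma hellinger_le_KL:
  assumes [measurable]: "u \<in> borel_measurable M" "v \<in> borel_measurable M"
    and u: "AE x in M. \<bar>u x\<bar> \<le> b" and v: "AE x in M. \<bar>v x\<bar> \<le> b"
  shows "2 * hellinger_sq M (exp_density M u) (exp_density M v)
      \<le> KL_div M (exp_density M u) (exp_density M v)"
proof -
  define s where "s x = u x - log_partition M u" for x
  define t where "t x = v x - log_partition M v" for x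
  have [measurable]: "s \<in> borel_measurable M" "t \<in> borel_measurable M"
    unfolding s_def t_def by measurable
  have st: "AE x in M. \<bar>s x - t x\<bar> \<le> 4 * b"
    using log_density_AE_le[OF _ u] log_density_AE_le[OF _ v] by (auto simp: s_def t_def)
  note i = integrable_exp_density[OF _ u] integrable_exp_density[OF _ v]
    integrable_bounded_mult_exp[OF _ _ u st]
  have ptw: "(exp (a / 2) - exp (c / 2))\<^sup>2 \<le> exp a * (a - c) + exp c - exp a" for a c :: real
  proof -
    have "exp (a / 2) * exp (a / 2) = exp a" "exp (c / 2) * exp (c / 2) = exp c"
      by (simp_all flip: exp_add)
    then have "(exp (a / 2) - exp (c / 2))\<^sup>2 = exp a + exp c - 2 * (exp (a / 2) * exp (c / 2))"
      by (simp add: power2_eq_square algebra_simps)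
    also have "exp (a / 2) * exp (c / 2) = exp a * exp ((c - a) / 2)"
      by (simp add: field_simps flip: exp_add)
    also have "exp a + exp c - 2 * (exp a * exp ((c - a) / 2))
        \<le> exp a + exp c - 2 * (exp a * (1 + (c - a) / 2))"
      using mult_left_mono[OF exp_ge_add_one_self[of "(c - a) / 2"], of "exp a"] by simp
    also have "\<dots> = exp a * (a - c) + exp c - exp a" by (simp add: field_simps)
    finally show ?thesis .
  qed
  have "2 * hellinger_sq M (exp_density M u) (exp_density M v)
      = (\<integral>x. (sqrt (exp_density M u x) - sqrt (exp_density M v x))\<^sup>2 \<partial>M)"
    by (simp add: hellinger_sq_def)
  also have "\<dots> \<le> (\<integral>x. exp_density M u x * (s x - t x) + exp_density M v x - exp_density M u x \<partial>M)"
  proof (rule integral_mono[OF integrable_hellinger[OF assms]])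
    show "integrable M (\<lambda>x. exp_density M u x * (s x - t x) + exp_density M v x - exp_density M u x)"
      using i by auto
    show "(sqrt (exp_density M u x) - sqrt (exp_density M v x))\<^sup>2
        \<le> exp_density M u x * (s x - t x) + exp_density M v x - exp_density M u x" for x
      using ptw[of "s x" "t x"] unfolding sqrt_exp_density by (simp add: s_def t_def exp_density_def)
  qed
  also have "\<dots> = KL_div M (exp_density M u) (exp_density M v)"
    using i by (simp add: KL_div_exp_density s_def t_def)
  finally show ?thesis .
qed

text \<open>
  Factor \<open>p - r = (\<surd>p + \<surd>r) (\<surd>p - \<surd>r)\<close>; both square roots are at most \<open>exp b\<close>.
\<close>
lemma L2_dist_le_hellinger:
  assumes [measurable]: "u \<in> borel_measurable M" "v \<in> borel_measurable M"
    and u: "AE x in M. \<bar>u x\<bar> \<le> b" and v: "AE x in M. \<bar>v x\<bar> \<le> b"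
  shows "L2_dist_sq M (exp_density M u) (exp_density M v)
      \<le> 8 * exp (2 * b) * hellinger_sq M (exp_density M u) (exp_density M v)"
proof -
  let ?h = "\<lambda>x. (sqrt (exp_density M u x) - sqrt (exp_density M v x))\<^sup>2"
  have "L2_dist_sq M (exp_density M u) (exp_density M v)
      = (\<integral>x. (exp_density M u x - exp_density M v x)\<^sup>2 \<partial>M)"
    by (simp add: L2_dist_sq_def L2_norm_def)
  also have "\<dots> \<le> (\<integral>x. 4 * exp (2 * b) * ?h x \<partial>M)"
  proof (rule integral_mono_AE')
    show "integrable M (\<lambda>x. 4 * exp (2 * b) * ?h x)"
      using integrable_hellinger[OF assms] by simp
    show "AE x in M. (exp_density M u x - exp_density M v x)\<^sup>2 \<le> 4 * exp (2 * b) * ?h x"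
      using log_density_AE_le[OF assms(1) u] log_density_AE_le[OF assms(2) v]
    proof eventually_elim
      case (elim x)
      let ?p = "sqrt (exp_density M u x)" and ?r = "sqrt (exp_density M v x)"
      have pr: "?p \<le> exp b" "?r \<le> exp b" "0 \<le> ?p" "0 \<le> ?r"
        using elim by (simp_all add: sqrt_exp_density)
      have sq: "?p\<^sup>2 = exp_density M u x" "?r\<^sup>2 = exp_density M v x"
        by (simp_all add: exp_density_def)
      have "?p\<^sup>2 - ?r\<^sup>2 = (?p + ?r) * (?p - ?r)"
        by (simp add: power2_eq_square algebra_simps del: real_sqrt_mult_self)
      then have "exp_density M u x - exp_density M v x = (?p + ?r) * (?p - ?r)"
        unfolding sq .
      then have "(exp_density M u x - exp_density M v x)\<^sup>2 = (?p + ?r)\<^sup>2 * ?h x"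
        by (simp add: power_mult_distrib)
      also have "\<dots> \<le> (2 * exp b)\<^sup>2 * ?h x"
        using pr by (intro mult_right_mono power_mono) auto
      also have "(2 * exp b)\<^sup>2 = 4 * exp (2 * b)"
        by (simp add: power2_eq_square flip: exp_add)
      finally show ?case .
    qed
  qed auto
  finally show ?thesis by (simp add: hellinger_sq_def)
qed

lemma exp_half_diff_ge:
  fixes s t :: real
  assumes "\<bar>s\<bar> \<le> 2 * b" "\<bar>t\<bar> \<le> 2 * b"
  shows "exp (- 2 * b) / 4 * (s - t)\<^sup>2 \<le> (exp (s / 2) - exp (t / 2))\<^sup>2"
proof -
  have *: "exp (- b) * ((s - t) / 2) \<le> exp (s / 2) - exp (t / 2)" if "t \<le> s" "\<bar>t\<bar> \<le> 2 * b" for s t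
  proof -
    have "exp (- b) * ((s - t) / 2) \<le> exp (t / 2) * ((s - t) / 2)"
      using that by (intro mult_right_mono) auto
    also have "\<dots> \<le> exp (t / 2) * (exp ((s - t) / 2) - 1)"
    proof (intro mult_left_mono)
      show "(s - t) / 2 \<le> exp ((s - t) / 2) - 1"
        using exp_ge_add_one_self[of "(s - t) / 2"] by linarith
    qed simp
    also have "\<dots> = exp (s / 2) - exp (t / 2)"
      by (simp add: algebra_simps diff_divide_distrib flip: exp_add)
    finally show ?thesis .
  qed
  have "(exp (- b) * (\<bar>s - t\<bar> / 2))\<^sup>2 \<le> (exp (s / 2) - exp (t / 2))\<^sup>2"
  proof (cases "t \<le> s")
    case True
    then show ?thesis using *[of t s] assms by (intro power_mono) auto
  next
    case False
    then have "(exp (- b) * (\<bar>s - t\<bar> / 2))\<^sup>2 \<le> (exp (t / 2) - exp (s / 2))\<^sup>2"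
      using *[of s t] assms by (intro power_mono) auto
    then show ?thesis by (simp add: power2_commute)
  qed
  moreover have "(exp (- b) * (\<bar>s - t\<bar> / 2))\<^sup>2 = exp (- 2 * b) / 4 * (s - t)\<^sup>2"
    by (simp add: power_mult_distrib power_divide exp_double[symmetric] flip: exp_of_nat_mult)
  ultimately show ?thesis by simp
qed

text \<open>
  The exponential is bi-Lipschitz on bounded sets, so the Hellinger distance controls the
  \<open>L\<^sup>2\<close> distance of the normalized log-densities. These differ from \<open>u\<close> and \<open>v\<close> by constants,
  and for mean-zero functions removing the constants only decreases the \<open>L\<^sup>2\<close> distance.
\<close>
lemma L2_le_hellinger:
  assumes [measurable]: "u \<in> borel_measurable M" "v \<in> borel_measurable M"
    and u: "AE x in M. \<bar>u x\<bar> \<le> b" and v: "AE x in M. \<bar>v x\<bar> \<le> b"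
    and mean: "(\<integral>x. u x \<partial>M) = 0" "(\<integral>x. v x \<partial>M) = 0"
  shows "(\<integral>x. (u x - v x)\<^sup>2 \<partial>M)
      \<le> 8 * exp (2 * b) * hellinger_sq M (exp_density M u) (exp_density M v)"
proof -
  define k where "k = log_partition M u - log_partition M v"
  have iu: "integrable M u" "integrable M v"
    using integrable_AE_bounded(1)[OF _ u] integrable_AE_bounded(1)[OF _ v] by simp_all
  have uv: "AE x in M. \<bar>u x - v x\<bar> \<le> 2 * b" using u v by auto
  have iuv: "integrable M (\<lambda>x. (u x - v x)\<^sup>2)"
    using integrable_AE_bounded(2)[OF _ uv] by simp
  have "(\<integral>x. (u x - v x)\<^sup>2 \<partial>M) \<le> (\<integral>x. (u x - v x)\<^sup>2 \<partial>M) + k\<^sup>2" by simp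
  also have "\<dots> = (\<integral>x. (u x - v x)\<^sup>2 - 2 * k * (u x - v x) + k\<^sup>2 \<partial>M)"
    using iu iuv mean by (simp add: prob_space)
  also have "\<dots> \<le> (\<integral>x. 4 * exp (2 * b) * (sqrt (exp_density M u x) - sqrt (exp_density M v x))\<^sup>2 \<partial>M)"
  proof (rule integral_mono_AE)
    show "AE x in M. (u x - v x)\<^sup>2 - 2 * k * (u x - v x) + k\<^sup>2
       \<le> 4 * exp (2 * b) * (sqrt (exp_density M u x) - sqrt (exp_density M v x))\<^sup>2"
      using log_density_AE_le[OF assms(1) u] log_density_AE_le[OF assms(2) v]
    proof eventually_elim
      case (elim x)
      have "(u x - v x)\<^sup>2 - 2 * k * (u x - v x) + k\<^sup>2
          = ((u x - log_partition M u) - (v x - log_partition M v))\<^sup>2"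
        by (simp add: k_def power2_eq_square algebra_simps)
      also have "\<dots> = 4 * exp (2 * b) * (exp (- 2 * b) / 4 * ((u x - log_partition M u) - (v x - log_partition M v))\<^sup>2)"
        by (simp add: exp_minus)
      also have "\<dots> \<le> 4 * exp (2 * b) * (sqrt (exp_density M u x) - sqrt (exp_density M v x))\<^sup>2"
        unfolding sqrt_exp_density using exp_half_diff_ge[OF elim] by (intro mult_left_mono) auto
      finally show ?case .
    qed
  qed (use iu iuv integrable_hellinger[OF assms(1-4)] in auto)
  finally show ?thesis by (simp add: hellinger_sq_def)
qed

lemma exp_taylor1_le:
  fixes h c :: real
  assumes "\<bar>h\<bar> \<le> c"
  shows "exp h - 1 - h \<le> exp c * h\<^sup>2"
proof -
  have d: "exp h - 1 \<le> h * exp h"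
    using mult_left_mono[OF exp_ge_add_one_self[of "-h"], of "exp h"]
    by (simp add: algebra_simps flip: exp_add)
  have "\<bar>exp h - 1\<bar> \<le> \<bar>h\<bar> * exp c"
  proof (cases "h \<ge> 0")
    case True
    have "h * exp h \<le> h * exp c" using True assms by (intro mult_left_mono) auto
    then show ?thesis using True d by simp
  next
    case False
    then have "1 - exp h \<le> \<bar>h\<bar> * 1" using exp_ge_add_one_self[of h] by linarith
    also have "\<dots> \<le> \<bar>h\<bar> * exp c" using assms by (intro mult_left_mono) auto
    finally show ?thesis using False by simp
  qed
  then have "\<bar>h\<bar> * \<bar>exp h - 1\<bar> \<le> \<bar>h\<bar> * (\<bar>h\<bar> * exp c)" by (intro mult_left_mono) auto
  moreover have "h * (exp h - 1) \<le> \<bar>h\<bar> * \<bar>exp h - 1\<bar>" by (metis abs_ge_self abs_mult)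
  moreover have "exp h - 1 - h \<le> h * (exp h - 1)" using d by (simp add: algebra_simps)
  moreover have "\<bar>h\<bar> * (\<bar>h\<bar> * exp c) = exp c * h\<^sup>2"
    by (simp add: power2_eq_square mult_ac flip: abs_mult)
  ultimately show ?thesis by linarith
qed

text \<open>
  Bounding \<open>ln x \<le> x - 1\<close> in the difference of log-partition functions cancels the first-order
  term and leaves the integral of \<open>p (exp h - 1 - h)\<close> with \<open>h = v - u\<close>, which is quadratic in
  \<open>h\<close>.
\<close>
lemma KL_le_L2:
  assumes [measurable]: "u \<in> borel_measurable M" "v \<in> borel_measurable M"
    and u: "AE x in M. \<bar>u x\<bar> \<le> b" and v: "AE x in M. \<bar>v x\<bar> \<le> b"
  shows "KL_div M (exp_density M u) (exp_density M v) \<le> exp (4 * b) * (\<integral>x. (u x - v x)\<^sup>2 \<partial>M)"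
proof -
  have uv: "AE x in M. \<bar>u x - v x\<bar> \<le> 2 * b" using u v by auto
  have iuv: "integrable M (\<lambda>x. (u x - v x)\<^sup>2)"
    using integrable_AE_bounded(2)[OF _ uv] by simp
  note i = integrable_bounded_mult_exp[OF _ _ u uv] integrable_exp_density[OF _ u]
  have e: "exp_density M u x * exp (v x - u x) = exp (v x) / exp (log_partition M u)" for x
    by (simp add: exp_density_def exp_diff)
  have iv: "integrable M (\<lambda>x. exp_density M u x * exp (v x - u x))"
    unfolding e using integrable_exp_bounded[OF _ v] by simp
  have "log_partition M v - log_partition M u \<le> exp (log_partition M v - log_partition M u) - 1"
    using exp_ge_add_one_self[of "log_partition M v - log_partition M u"] by linarith
  also have "exp (log_partition M v - log_partition M u) = (\<integral>x. exp_density M u x * exp (v x - u x) \<partial>M)"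
    unfolding e using exp_log_partition[OF _ v] by (simp add: exp_diff)
  finally have A: "log_partition M v - log_partition M u
      \<le> (\<integral>x. exp_density M u x * exp (v x - u x) \<partial>M) - 1" .
  have "KL_div M (exp_density M u) (exp_density M v)
     = (\<integral>x. exp_density M u x * (u x - v x) + exp_density M u x * (log_partition M v - log_partition M u) \<partial>M)"
    unfolding KL_div_exp_density by (simp add: algebra_simps)
  also have "\<dots> = (\<integral>x. exp_density M u x * (u x - v x) \<partial>M) + (log_partition M v - log_partition M u)"
    using i by simp
  also have "\<dots> \<le> (\<integral>x. exp_density M u x * (u x - v x) \<partial>M)
      + ((\<integral>x. exp_density M u x * exp (v x - u x) \<partial>M) - (\<integral>x. exp_density M u x \<partial>M))"
    using A i by simp
  also have "\<dots> = (\<integral>x. exp_density M u x * (u x - v x) + (exp_density M u x * exp (v x - u x) - exp_density M u x) \<partial>M)"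
    using i iv by simp
  also have "\<dots> \<le> (\<integral>x. exp (4 * b) * (u x - v x)\<^sup>2 \<partial>M)"
  proof (rule integral_mono_AE)
    show "AE x in M. exp_density M u x * (u x - v x) + (exp_density M u x * exp (v x - u x) - exp_density M u x)
        \<le> exp (4 * b) * (u x - v x)\<^sup>2"
      using uv log_density_AE_le[OF assms(1) u]
    proof eventually_elim
      case (elim x)
      have p: "0 \<le> exp_density M u x" "exp_density M u x \<le> exp (2 * b)"
        using elim(2) by (simp_all add: exp_density_def)
      have "exp_density M u x * (u x - v x) + (exp_density M u x * exp (v x - u x) - exp_density M u x)
          = exp_density M u x * (exp (v x - u x) - 1 - (v x - u x))" by (simp add: algebra_simps)
      also have "\<dots> \<le> exp_density M u x * (exp (2 * b) * (v x - u x)\<^sup>2)"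
        using elim(1) p by (intro mult_left_mono exp_taylor1_le) auto
      also have "\<dots> \<le> exp (2 * b) * (exp (2 * b) * (v x - u x)\<^sup>2)"
        using p by (intro mult_right_mono) auto
      also have "\<dots> = exp (4 * b) * (u x - v x)\<^sup>2"
        by (simp add: power2_commute mult.assoc[symmetric] flip: exp_add)
      finally show ?case .
    qed
  qed (use i iv iuv in auto)
  finally show ?thesis by simp
qed

text \<open>
  Quantitative midpoint convexity: the Hellinger affinity of the two densities equals \<open>exp\<close> of
  minus the convexity defect of the log-partition function.
\<close>
lemma log_partition_midpoint:
  assumes [measurable]: "u \<in> borel_measurable M" "v \<in> borel_measurable M"
    and u: "AE x in M. \<bar>u x\<bar> \<le> b" and v: "AE x in M. \<bar>v x\<bar> \<le> b"
  shows "log_partition M (\<lambda>x. (u x + v x) / 2)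
      \<le> (log_partition M u + log_partition M v) / 2 - hellinger_sq M (exp_density M u) (exp_density M v)"
proof -
  let ?m = "\<lambda>x. (u x + v x) / 2" and ?k = "(log_partition M u + log_partition M v) / 2"
  have m: "AE x in M. \<bar>?m x\<bar> \<le> b" using u v by auto
  note i = integrable_exp_density[OF _ u] integrable_exp_density[OF _ v]
  have im: "integrable M (\<lambda>x. exp (?m x))" using integrable_exp_bounded[OF _ m] by simp
  have e: "(sqrt (exp_density M u x) - sqrt (exp_density M v x))\<^sup>2
      = exp_density M u x + exp_density M v x - 2 * (exp (?m x) / exp ?k)" for x
  proof -
    have "sqrt (exp_density M u x) * sqrt (exp_density M v x) = exp (?m x) / exp ?k"
      unfolding sqrt_exp_density by (simp add: field_simps flip: exp_add exp_diff)
    moreover have "(sqrt (exp_density M u x))\<^sup>2 = exp_density M u x" "(sqrt (exp_density M v x))\<^sup>2 = exp_density M v x"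
      by (simp_all add: exp_density_def)
    ultimately show ?thesis by (simp add: power2_diff)
  qed
  have "hellinger_sq M (exp_density M u) (exp_density M v) = 1 - (\<integral>x. exp (?m x) \<partial>M) / exp ?k"
    unfolding hellinger_sq_def e using i im by simp
  also have "(\<integral>x. exp (?m x) \<partial>M) = exp (log_partition M ?m)"
    using exp_log_partition[OF _ m] by simp
  also have "1 - exp (log_partition M ?m) / exp ?k = 1 - exp (log_partition M ?m - ?k)"
    by (simp add: exp_diff)
  also have "\<dots> \<le> ?k - log_partition M ?m"
    using exp_ge_add_one_self[of "log_partition M ?m - ?k"] by linarith
  finally show ?thesis by linarith
qed

end

section \<open>Orthonormal systems in blocks\<close>

text \<open>
  Coefficient families are functions on the naturals, so compactness of a coefficient box is
  Tychonoff's theorem for the product topology.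
\<close>
lemma compact_function_box:
  fixes S :: "'a \<Rightarrow> 'b::topological_space set"
  assumes "\<And>i. compact (S i)"
  shows "compact (PiE UNIV S)"
proof -
  have "compactin (product_topology (\<lambda>i. euclidean) UNIV) (PiE UNIV S)"
    using assms by (subst compactin_PiE) auto
  then show ?thesis by (simp add: euclidean_product_topology)
qed

lemma continuous_on_coordinate2:
  "continuous_on UNIV (\<lambda>a :: 'a \<Rightarrow> 'b \<Rightarrow> real. a j l)"
proof -
  have "continuous_on UNIV ((\<lambda>f :: 'b \<Rightarrow> real. f l) \<circ> (\<lambda>a :: 'a \<Rightarrow> 'b \<Rightarrow> real. a j))"
    by (intro continuous_on_compose continuous_on_product_coordinates
        continuous_on_subset[OF continuous_on_product_coordinates]) auto
  then show ?thesis by (simp add: comp_def)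
qed

lemma continuous_on_if_dominated:
  fixes f :: "'a::topological_space \<Rightarrow> real" and g :: "'a \<Rightarrow> 'a \<Rightarrow> real"
  assumes g: "\<And>c. continuous_on UNIV (g c)" and g0: "\<And>c. g c c = 0"
    and le: "\<And>a c. \<bar>f a - f c\<bar> \<le> g c a"
  shows "continuous_on UNIV f"
  unfolding continuous_on_def
proof safe
  fix c
  have "(g c \<longlongrightarrow> g c c) (at c within UNIV)"
    using g by (simp add: continuous_on_def)
  then have "(g c \<longlongrightarrow> 0) (at c)" by (simp add: g0)
  then have "((\<lambda>a. f a - f c) \<longlongrightarrow> 0) (at c)"
    by (rule Lim_null_comparison[rotated]) (use le in auto)
  then show "(f \<longlongrightarrow> f c) (at c)" by (rule LIM_zero_cancel)
qed

context prob_space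
begin

lemma log_partition_lipschitz:
  assumes [measurable]: "u \<in> borel_measurable M" "v \<in> borel_measurable M"
    and u: "AE x in M. \<bar>u x\<bar> \<le> b" and v: "AE x in M. \<bar>v x\<bar> \<le> b'"
    and uv: "AE x in M. \<bar>u x - v x\<bar> \<le> s"
  shows "\<bar>log_partition M u - log_partition M v\<bar> \<le> s"
proof -
  have *: "log_partition M u - log_partition M v \<le> s"
    if [measurable]: "u \<in> borel_measurable M" "v \<in> borel_measurable M"
      and u: "AE x in M. \<bar>u x\<bar> \<le> b" and v: "AE x in M. \<bar>v x\<bar> \<le> b'"
      and uv: "AE x in M. \<bar>u x - v x\<bar> \<le> s" for u v b b'
  proof -
    have "(\<integral>x. exp (u x) \<partial>M) \<le> (\<integral>x. exp s * exp (v x) \<partial>M)"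
    proof (rule integral_mono_AE)
      show "AE x in M. exp (u x) \<le> exp s * exp (v x)"
        using uv by eventually_elim (simp flip: exp_add)
    qed (use integrable_exp_bounded[OF _ u] integrable_exp_bounded[OF _ v] in auto)
    then have "exp (log_partition M u) \<le> exp (s + log_partition M v)"
      by (simp add: exp_log_partition[OF _ u] exp_log_partition[OF _ v] exp_add)
    then show ?thesis by simp
  qed
  have "AE x in M. \<bar>v x - u x\<bar> \<le> s" using uv by (simp add: abs_minus_commute)
  then show ?thesis
    using *[OF assms] *[OF assms(2,1) v u] by linarith
qed

end

lemma Linf_norm_le_iff:
  assumes [measurable]: "f \<in> borel_measurable \<nu>"
  shows "Linf_norm \<nu> f \<le> ereal b \<longleftrightarrow> (AE x in \<nu>. \<bar>f x\<bar> \<le> b)"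
proof
  assume *: "Linf_norm \<nu> f \<le> ereal b"
  show "AE x in \<nu>. \<bar>f x\<bar> \<le> b"
    using esssup_AE[of "\<lambda>x. ereal \<bar>f x\<bar>" \<nu>]
  proof eventually_elim
    case (elim x)
    have "ereal \<bar>f x\<bar> \<le> ereal b" by (rule order_trans[OF elim *[unfolded Linf_norm_def]])
    then show ?case by simp
  qed
next
  assume "AE x in \<nu>. \<bar>f x\<bar> \<le> b"
  then show "Linf_norm \<nu> f \<le> ereal b"
    unfolding Linf_norm_def by (intro esssup_I) auto
qed

text \<open>
  The statistical argument sees the geometry only through an orthonormal system of bounded functions
  that is split into finite blocks.
\<close>
locale eigen_system = prob_space \<nu> for \<nu> :: "'m measure" +
  fixes E :: "nat \<Rightarrow> ('m \<Rightarrow> real) set" and d :: "nat \<Rightarrow> nat"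
    and \<phi> :: "nat \<Rightarrow> nat \<Rightarrow> 'm \<Rightarrow> real"
  assumes phi_measurable [measurable]: "l < d j \<Longrightarrow> \<phi> j l \<in> borel_measurable \<nu>"
    and phi_bounded: "l < d j \<Longrightarrow> \<exists>b. \<forall>x. \<bar>\<phi> j l x\<bar> \<le> b"
    and orthonormal: "l < d j \<Longrightarrow> m < d k \<Longrightarrow>
      (\<integral>x. \<phi> j l x * \<phi> k m x \<partial>\<nu>) = (if j = k \<and> l = m then 1 else 0)"
    and E_span: "E j = {f. \<exists>a. f = (\<lambda>x. \<Sum>l<d j. a l * \<phi> j l x)}"
begin

text \<open>
  An arbitrary uniform bound of a basis function, the Lipschitz constant of a linear
  combination in the corresponding coefficient.
\<close>
definition basis_bound :: "nat \<Rightarrow> nat \<Rightarrow> real" where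
  "basis_bound j l = (SOME b. \<forall>x. \<bar>\<phi> j l x\<bar> \<le> b)"

lemma phi_le_basis_bound: "l < d j \<Longrightarrow> \<bar>\<phi> j l x\<bar> \<le> basis_bound j l"
  unfolding basis_bound_def using someI_ex[OF phi_bounded] by blast

lemma basis_bound_nonneg: "l < d j \<Longrightarrow> 0 \<le> basis_bound j l"
  using phi_le_basis_bound by (meson abs_ge_zero order_trans)

definition coef :: "('m \<Rightarrow> real) \<Rightarrow> nat \<Rightarrow> nat \<Rightarrow> real" where
  "coef f j l = (\<integral>x. f x * \<phi> j l x \<partial>\<nu>)"

definition comb :: "nat set \<Rightarrow> (nat \<Rightarrow> nat \<Rightarrow> real) \<Rightarrow> 'm \<Rightarrow> real" where
  "comb J a x = (\<Sum>j\<in>J. \<Sum>l<d j. a j l * \<phi> j l x)"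

definition block_norm :: "(nat \<Rightarrow> nat \<Rightarrow> real) \<Rightarrow> nat \<Rightarrow> real" where
  "block_norm a j = L2_set (a j) {..<d j}"

lemma block_norm_nonneg [simp]: "0 \<le> block_norm a j" by (simp add: block_norm_def)

lemma block_norm_sq: "(block_norm a j)\<^sup>2 = (\<Sum>l<d j. (a j l)\<^sup>2)"
  by (simp add: block_norm_def L2_set_def sum_nonneg)

lemma block_norm_triangle: "block_norm (\<lambda>j l. a j l + c j l) j \<le> block_norm a j + block_norm c j"
  unfolding block_norm_def by (rule L2_set_triangle_ineq)

lemma block_norm_scale: "block_norm (\<lambda>j l. r * a j l) j = \<bar>r\<bar> * block_norm a j"
  by (simp add: block_norm_def L2_set_def power_mult_distrib real_sqrt_mult flip: sum_distrib_left)

lemma block_norm_diff_triangle: "block_norm a j \<le> block_norm (\<lambda>j l. a j l - c j l) j + block_norm c j"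
  using block_norm_triangle[of "\<lambda>j l. a j l - c j l" c j] by simp

lemma block_norm_diff_commute: "block_norm (\<lambda>j l. a j l - c j l) j = block_norm (\<lambda>j l. c j l - a j l) j"
  by (simp add: block_norm_def L2_set_def power2_commute)

lemma block_norm_cong: "(\<And>l. l < d j \<Longrightarrow> a j l = c j l) \<Longrightarrow> block_norm a j = block_norm c j"
  by (simp add: block_norm_def L2_set_def)

lemma comb_measurable [measurable]: "comb J a \<in> borel_measurable \<nu>"
proof -
  have "(\<lambda>x. \<Sum>l<d j. a j l * \<phi> j l x) \<in> borel_measurable \<nu>" for j
    by (intro borel_measurable_sum borel_measurable_times phi_measurable) auto
  then show ?thesis unfolding comb_def[abs_def] by measurable
qed

lemma comb_abs_le: "\<bar>comb J a x\<bar> \<le> (\<Sum>j\<in>J. \<Sum>l<d j. \<bar>a j l\<bar> * basis_bound j l)"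
proof -
  have "\<bar>comb J a x\<bar> \<le> (\<Sum>j\<in>J. \<Sum>l<d j. \<bar>a j l * \<phi> j l x\<bar>)"
    unfolding comb_def by (rule order_trans[OF sum_abs sum_mono[OF sum_abs]])
  also have "\<dots> \<le> (\<Sum>j\<in>J. \<Sum>l<d j. \<bar>a j l\<bar> * basis_bound j l)"
    by (intro sum_mono) (simp add: abs_mult mult_left_mono phi_le_basis_bound)
  finally show ?thesis .
qed

lemma comb_diff: "comb J a x - comb J c x = comb J (\<lambda>j l. a j l - c j l) x"
  by (simp add: comb_def left_diff_distrib sum_subtractf)

lemma comb_mono_index:
  assumes "finite J" "K \<subseteq> J"
  shows "comb K a = comb J (\<lambda>j l. if j \<in> K then a j l else 0)"
proof
  fix x
  have "comb J (\<lambda>j l. if j \<in> K then a j l else 0) x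
      = (\<Sum>j\<in>J. if j \<in> K then \<Sum>l<d j. a j l * \<phi> j l x else 0)"
    unfolding comb_def by (intro sum.cong) auto
  then show "comb K a x = comb J (\<lambda>j l. if j \<in> K then a j l else 0) x"
    using assms by (simp add: comb_def sum.If_cases Int_absorb1)
qed

lemma integrable_comb: "integrable \<nu> (comb J a)" "integrable \<nu> (\<lambda>x. (comb J a x)\<^sup>2)"
  using integrable_AE_bounded[OF comb_measurable] comb_abs_le by blast+

lemma integrable_mult_phi:
  assumes "integrable \<nu> f" "l < d j"
  shows "integrable \<nu> (\<lambda>x. f x * \<phi> j l x)"
proof (rule Bochner_Integration.integrable_bound[where f = "\<lambda>x. basis_bound j l * f x"])
  show "(\<lambda>x. f x * \<phi> j l x) \<in> borel_measurable \<nu>"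
    using assms phi_measurable by (intro borel_measurable_times) auto
  show "AE x in \<nu>. norm (f x * \<phi> j l x) \<le> norm (basis_bound j l * f x)"
    using assms(2) phi_le_basis_bound[of l j] basis_bound_nonneg[of l j]
    by (simp add: abs_mult mult.commute mult_left_mono)
qed (use assms in simp)

lemma integral_mult_comb:
  assumes "integrable \<nu> f"
  shows "integrable \<nu> (\<lambda>x. f x * comb J a x)"
    and "(\<integral>x. f x * comb J a x \<partial>\<nu>) = (\<Sum>j\<in>J. \<Sum>l<d j. a j l * coef f j l)"
proof -
  have e: "f x * comb J a x = (\<Sum>j\<in>J. \<Sum>l<d j. a j l * (f x * \<phi> j l x))" for x
    by (simp add: comb_def sum_distrib_left mult.left_commute)
  have i: "integrable \<nu> (\<lambda>x. \<Sum>l<d j. a j l * (f x * \<phi> j l x))" for j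
    by (intro Bochner_Integration.integrable_sum integrable_mult_right integrable_mult_phi assms) auto
  show "integrable \<nu> (\<lambda>x. f x * comb J a x)"
    unfolding e by (intro Bochner_Integration.integrable_sum i)
  have "(\<integral>x. f x * comb J a x \<partial>\<nu>) = (\<Sum>j\<in>J. \<integral>x. (\<Sum>l<d j. a j l * (f x * \<phi> j l x)) \<partial>\<nu>)"
    unfolding e by (rule Bochner_Integration.integral_sum) (rule i)
  also have "\<dots> = (\<Sum>j\<in>J. \<Sum>l<d j. a j l * coef f j l)"
  proof (rule sum.cong[OF refl])
    fix j
    have "(\<integral>x. (\<Sum>l<d j. a j l * (f x * \<phi> j l x)) \<partial>\<nu>)
        = (\<Sum>l<d j. \<integral>x. a j l * (f x * \<phi> j l x) \<partial>\<nu>)"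
      by (intro Bochner_Integration.integral_sum integrable_mult_right integrable_mult_phi assms) auto
    then show "(\<integral>x. (\<Sum>l<d j. a j l * (f x * \<phi> j l x)) \<partial>\<nu>) = (\<Sum>l<d j. a j l * coef f j l)"
      by (simp add: coef_def)
  qed
  finally show "(\<integral>x. f x * comb J a x \<partial>\<nu>) = (\<Sum>j\<in>J. \<Sum>l<d j. a j l * coef f j l)" .
qed

lemma integrable_phi: "l < d j \<Longrightarrow> integrable \<nu> (\<phi> j l)"
  using integrable_AE_bounded(1)[OF phi_measurable, of l j "basis_bound j l"] phi_le_basis_bound by simp

lemma coef_comb:
  assumes J: "finite J" and l: "l < d j"
  shows "coef (comb J a) j l = (if j \<in> J then a j l else 0)"
proof -
  have "coef (comb J a) j l = (\<integral>x. \<phi> j l x * comb J a x \<partial>\<nu>)"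
    by (simp add: coef_def mult.commute)
  also have "\<dots> = (\<Sum>k\<in>J. \<Sum>m<d k. a k m * coef (\<phi> j l) k m)"
    by (rule integral_mult_comb(2)[OF integrable_phi[OF l]])
  also have "\<dots> = (\<Sum>k\<in>J. if k = j then a j l else 0)"
  proof (rule sum.cong[OF refl])
    fix k
    have "(\<Sum>m<d k. a k m * coef (\<phi> j l) k m) = (\<Sum>m<d k. if m = l then (if k = j then a j l else 0) else 0)"
      by (rule sum.cong) (use l in \<open>auto simp: coef_def orthonormal\<close>)
    then show "(\<Sum>m<d k. a k m * coef (\<phi> j l) k m) = (if k = j then a j l else 0)"
      using l by auto
  qed
  finally show ?thesis using J by simp
qed

lemma integral_comb_sq:
  assumes "finite J"
  shows "(\<integral>x. (comb J a x)\<^sup>2 \<partial>\<nu>) = (\<Sum>j\<in>J. (block_norm a j)\<^sup>2)"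
proof -
  have "(\<integral>x. (comb J a x)\<^sup>2 \<partial>\<nu>) = (\<Sum>j\<in>J. \<Sum>l<d j. a j l * coef (comb J a) j l)"
    using integral_mult_comb(2)[OF integrable_comb(1)] by (simp add: power2_eq_square)
  also have "\<dots> = (\<Sum>j\<in>J. \<Sum>l<d j. a j l * a j l)"
    using assms by (intro sum.cong) (auto simp: coef_comb)
  finally show ?thesis unfolding block_norm_sq by (simp add: power2_eq_square)
qed

lemma L2_integrable: "f \<in> L2_space \<nu> \<Longrightarrow> integrable \<nu> f"
  unfolding L2_space_def by (auto intro: square_integrable_imp_integrable)

text \<open>
  \<open>proj\<close> is defined by a unique description among literal functions. Orthonormality determines
  the coefficients, and these determine the function at every point.
\<close>
lemma proj_eq_comb:
  assumes f: "integrable \<nu> f"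
  shows "proj \<nu> (E j) f = comb {j} (coef f)"
  unfolding proj_def
proof (rule the_equality)
  have E: "e \<in> E j \<longleftrightarrow> (\<exists>a. e = comb {j} a)" for e
  proof
    assume "e \<in> E j"
    then obtain a where "e = (\<lambda>x. \<Sum>l<d j. a l * \<phi> j l x)" by (auto simp: E_span)
    then have "e = comb {j} (\<lambda>_. a)" by (simp add: comb_def fun_eq_iff)
    then show "\<exists>a. e = comb {j} a" by blast
  next
    assume "\<exists>a. e = comb {j} a"
    then show "e \<in> E j" by (auto simp: E_span comb_def[abs_def])
  qed
  have orth: "(\<integral>x. (f x - comb {j} a x) * comb {j} c x \<partial>\<nu>) = (\<Sum>l<d j. c j l * (coef f j l - a j l))" for a c
  proof -
    have "(\<integral>x. (f x - comb {j} a x) * comb {j} c x \<partial>\<nu>)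
        = (\<integral>x. f x * comb {j} c x \<partial>\<nu>) - (\<integral>x. comb {j} a x * comb {j} c x \<partial>\<nu>)"
      using integral_mult_comb(1)[OF f] integral_mult_comb(1)[OF integrable_comb(1)]
      by (simp add: left_diff_distrib)
    then show ?thesis
      by (simp add: integral_mult_comb(2)[OF f] integral_mult_comb(2)[OF integrable_comb(1)]
          coef_comb right_diff_distrib sum_subtractf)
  qed
  show "comb {j} (coef f) \<in> E j \<and> (\<forall>e\<in>E j. (\<integral>x. (f x - comb {j} (coef f) x) * e x \<partial>\<nu>) = 0)"
    using E orth by auto
  fix h assume h: "h \<in> E j \<and> (\<forall>e\<in>E j. (\<integral>x. (f x - h x) * e x \<partial>\<nu>) = 0)"
  then obtain a where a: "h = comb {j} a" using E by blast
  have "(\<Sum>l<d j. (coef f j l - a j l) * (coef f j l - a j l)) = 0"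
  proof -
    have "comb {j} (\<lambda>j l. coef f j l - a j l) \<in> E j" using E by blast
    then have "(\<integral>x. (f x - comb {j} a x) * comb {j} (\<lambda>j l. coef f j l - a j l) x \<partial>\<nu>) = 0"
      using h unfolding a by blast
    then show ?thesis unfolding orth .
  qed
  then have "\<forall>l<d j. coef f j l = a j l"
    by (subst (asm) sum_nonneg_eq_0_iff) auto
  then show "h = comb {j} (coef f)" by (simp add: a comb_def fun_eq_iff)
qed

lemma L2_norm_proj:
  assumes "integrable \<nu> f"
  shows "L2_norm \<nu> (proj \<nu> (E j) f) = block_norm (coef f) j"
  by (simp add: L2_norm_def proj_eq_comb[OF assms] integral_comb_sq)

lemma block_norm_coef_comb:
  assumes "finite J"
  shows "block_norm (coef (comb J a)) j = (if j \<in> J then block_norm a j else 0)"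
  using assms by (auto simp: block_norm_def L2_set_def coef_comb)

lemma sieve_eq:
  assumes "finite J"
  shows "sieve \<nu> E J b = {comb J a | a. AE x in \<nu>. \<bar>comb J a x\<bar> \<le> b}"
proof -
  have eq: "(\<exists>e. (\<forall>j\<in>J. e j \<in> E j) \<and> u = (\<lambda>x. \<Sum>j\<in>J. e j x)) \<longleftrightarrow> (\<exists>a. u = comb J a)" for u
  proof
    assume "\<exists>e. (\<forall>j\<in>J. e j \<in> E j) \<and> u = (\<lambda>x. \<Sum>j\<in>J. e j x)"
    then obtain e where e: "\<forall>j\<in>J. \<exists>a. e j = (\<lambda>x. \<Sum>l<d j. a l * \<phi> j l x)" "u = (\<lambda>x. \<Sum>j\<in>J. e j x)"
      by (auto simp: E_span)
    then obtain a where "\<forall>j\<in>J. e j = (\<lambda>x. \<Sum>l<d j. a j l * \<phi> j l x)" by metis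
    then have "u = comb J a" using e(2) by (auto simp: comb_def fun_eq_iff intro!: sum.cong)
    then show "\<exists>a. u = comb J a" by blast
  next
    assume "\<exists>a. u = comb J a"
    then obtain a where a: "u = comb J a" ..
    show "\<exists>e. (\<forall>j\<in>J. e j \<in> E j) \<and> u = (\<lambda>x. \<Sum>j\<in>J. e j x)"
    proof (intro exI conjI ballI)
      show "u = (\<lambda>x. \<Sum>j\<in>J. (\<lambda>j x. \<Sum>l<d j. a j l * \<phi> j l x) j x)"
        by (simp add: a comb_def fun_eq_iff)
    qed (auto simp: E_span)
  qed
  show ?thesis unfolding sieve_def eq by (auto simp: Linf_norm_le_iff)
qed

lemma sieve_objective_comb:
  assumes "finite J"
  shows "sieve_objective \<nu> E J lam n X (comb J a)
    = - (\<Sum>j\<in>J. \<Sum>l<d j. a j l * empirical_mean n X (\<phi> j l)) + log_partition \<nu> (comb J a)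
      + 4 * (\<Sum>j\<in>J. lam j * block_norm a j)"
proof -
  have "(\<Sum>i<n. comb J a (X i)) = (\<Sum>j\<in>J. \<Sum>l<d j. a j l * (\<Sum>i<n. \<phi> j l (X i)))"
    unfolding comb_def by (subst sum.swap, rule sum.cong[OF refl], subst sum.swap)
      (simp add: sum_distrib_left)
  then have "empirical_mean n X (comb J a) = (\<Sum>j\<in>J. \<Sum>l<d j. a j l * empirical_mean n X (\<phi> j l))"
    by (simp add: empirical_mean_def sum_divide_distrib[of _ J]
        sum_divide_distrib[where A = "{..<d j}" for j])
  then show ?thesis
    using assms by (simp add: sieve_objective_def L2_norm_proj[OF integrable_comb(1)] block_norm_coef_comb)
qed

end

section \<open>Existence and uniqueness of the sieve estimator\<close>

context eigen_system
begin

text \<open>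
  A coordinatewise continuous modulus that dominates the uniform distance of the combinations.
  All continuity statements in the coefficients are reduced to it.
\<close>
definition coef_dist :: "nat set \<Rightarrow> (nat \<Rightarrow> nat \<Rightarrow> real) \<Rightarrow> (nat \<Rightarrow> nat \<Rightarrow> real) \<Rightarrow> real" where
  "coef_dist J c a = (\<Sum>j\<in>J. \<Sum>l<d j. \<bar>a j l - c j l\<bar> * basis_bound j l)"

lemma comb_diff_le_coef_dist: "\<bar>comb J a x - comb J c x\<bar> \<le> coef_dist J c a"
  unfolding comb_diff coef_dist_def by (rule comb_abs_le)

lemma continuous_on_coef_dist: "continuous_on UNIV (coef_dist J c)"
  unfolding coef_dist_def[abs_def] by (intro continuous_intros continuous_on_coordinate2)

lemma coef_dist_self: "coef_dist J c c = 0" by (simp add: coef_dist_def)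

lemma continuous_on_log_partition_comb:
  "continuous_on UNIV (\<lambda>a. log_partition \<nu> (comb J a))"
proof (rule continuous_on_if_dominated[OF continuous_on_coef_dist coef_dist_self])
  show "\<bar>log_partition \<nu> (comb J a) - log_partition \<nu> (comb J c)\<bar> \<le> coef_dist J c a" for a c
    by (rule log_partition_lipschitz[OF comb_measurable comb_measurable])
       (use comb_abs_le comb_diff_le_coef_dist in blast)+
qed

text \<open>
  The constraint is that the excess \<open>max 0 (|u| - b)\<close> has integral \<open>0\<close>, and this integral
  depends continuously on the coefficients.
\<close>
lemma closed_comb_bounded: "closed {a. AE x in \<nu>. \<bar>comb J a x\<bar> \<le> b}"
proof -
  define h where "h a = (\<integral>x. max 0 (\<bar>comb J a x\<bar> - b) \<partial>\<nu>)" for a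
  have i: "integrable \<nu> (\<lambda>x. max 0 (\<bar>comb J a x\<bar> - b))" for a
    using integrable_comb(1)[of J a] by auto
  have "\<bar>h a - h c\<bar> \<le> coef_dist J c a" for a c
  proof -
    have "\<bar>h a - h c\<bar> = \<bar>\<integral>x. max 0 (\<bar>comb J a x\<bar> - b) - max 0 (\<bar>comb J c x\<bar> - b) \<partial>\<nu>\<bar>"
      unfolding h_def using i by simp
    also have "\<dots> \<le> (\<integral>x. \<bar>max 0 (\<bar>comb J a x\<bar> - b) - max 0 (\<bar>comb J c x\<bar> - b)\<bar> \<partial>\<nu>)"
      by (rule integral_abs_bound)
    also have "\<dots> \<le> coef_dist J c a"
    proof (rule integral_le_const)
      show "AE x in \<nu>. \<bar>max 0 (\<bar>comb J a x\<bar> - b) - max 0 (\<bar>comb J c x\<bar> - b)\<bar> \<le> coef_dist J c a"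
      proof (rule AE_I2)
        fix x
        show "\<bar>max 0 (\<bar>comb J a x\<bar> - b) - max 0 (\<bar>comb J c x\<bar> - b)\<bar> \<le> coef_dist J c a"
          using comb_diff_le_coef_dist[of J a x c] by linarith
      qed
    qed (use i in auto)
    finally show ?thesis .
  qed
  then have "continuous_on UNIV h"
    by (intro continuous_on_if_dominated[OF continuous_on_coef_dist coef_dist_self])
  then have "closed {a. h a = 0}" by (intro closed_Collect_eq) auto
  moreover have "h a = 0 \<longleftrightarrow> (AE x in \<nu>. \<bar>comb J a x\<bar> \<le> b)" for a
  proof -
    have "h a = 0 \<longleftrightarrow> (AE x in \<nu>. max 0 (\<bar>comb J a x\<bar> - b) = 0)"
      unfolding h_def by (rule integral_nonneg_eq_0_iff_AE[OF i]) auto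
    also have "\<dots> \<longleftrightarrow> (AE x in \<nu>. \<bar>comb J a x\<bar> \<le> b)"
      by (rule AE_cong) (auto simp: max_def)
    finally show ?thesis .
  qed
  ultimately show ?thesis by simp
qed

lemma comb_normalize: "comb J (\<lambda>j l. if j \<in> J \<and> l < d j then a j l else 0) = comb J a"
  by (simp add: comb_def fun_eq_iff)

text \<open>
  By orthonormality a coefficient is at most the \<open>L\<^sup>2\<close> norm, which is at most the uniform
  bound. This makes the sieve compact in coefficient space.
\<close>
lemma coefficient_le:
  assumes "finite J" "j \<in> J" "l < d j" and b: "AE x in \<nu>. \<bar>comb J a x\<bar> \<le> b"
  shows "\<bar>a j l\<bar> \<le> \<bar>b\<bar>"
proof -
  have "(a j l)\<^sup>2 \<le> (block_norm a j)\<^sup>2"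
    unfolding block_norm_sq using assms(3) by (intro member_le_sum) auto
  also have "\<dots> \<le> (\<Sum>j\<in>J. (block_norm a j)\<^sup>2)"
    using assms by (intro member_le_sum) auto
  also have "\<dots> = (\<integral>x. (comb J a x)\<^sup>2 \<partial>\<nu>)" by (simp add: integral_comb_sq[OF assms(1)])
  also have "\<dots> \<le> b\<^sup>2"
  proof (rule integral_le_const[OF integrable_comb(2)])
    show "AE x in \<nu>. (comb J a x)\<^sup>2 \<le> b\<^sup>2"
      using b
    proof eventually_elim
      case (elim x)
      then show ?case by (metis abs_ge_zero power2_abs power_mono)
    qed
  qed
  finally show ?thesis by (simp add: abs_le_square_iff)
qed

lemma mean_zero_comb:
  assumes "\<And>j l. j \<in> J \<Longrightarrow> l < d j \<Longrightarrow> (\<integral>x. \<phi> j l x \<partial>\<nu>) = 0"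
  shows "(\<integral>x. comb J a x \<partial>\<nu>) = 0"
  using integral_mult_comb(2)[of "\<lambda>_. 1" J a] assms by (simp add: coef_def)

lemma sieve_minimizer_exists:
  assumes J: "finite J" and b: "0 \<le> b"
  shows "\<exists>u. is_arg_min (sieve_objective \<nu> E J lam n X) (\<lambda>v. v \<in> sieve \<nu> E J b) u"
proof -
  define C :: "nat \<Rightarrow> nat \<Rightarrow> real set" where "C j l = (if j \<in> J \<and> l < d j then {-b..b} else {0})" for j l
  define K where "K = (PiE UNIV (\<lambda>j. PiE UNIV (C j)))"
  define S where "S = {a. AE x in \<nu>. \<bar>comb J a x\<bar> \<le> b}"
  define F where "F a = sieve_objective \<nu> E J lam n X (comb J a)" for a
  have memK: "a \<in> K \<longleftrightarrow> (\<forall>j l. a j l \<in> C j l)" for a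
    by (auto simp: K_def PiE_iff)
  have "compact K"
    unfolding K_def by (intro compact_function_box) (auto simp: C_def)
  then have cpt: "compact (K \<inter> S)" using closed_comb_bounded unfolding S_def by (rule compact_Int_closed)
  have "(\<lambda>_ _. 0) \<in> K \<inter> S" using b by (simp add: memK C_def S_def comb_def)
  then have ne: "K \<inter> S \<noteq> {}" by blast
  have "continuous_on UNIV (\<lambda>a. block_norm a j)" for j
    unfolding block_norm_def L2_set_def by (intro continuous_intros continuous_on_coordinate2)
  then have "continuous_on UNIV F"
    unfolding F_def sieve_objective_comb[OF J]
    by (intro continuous_intros continuous_on_coordinate2 continuous_on_log_partition_comb)
  then have "continuous_on (K \<inter> S) F" by (rule continuous_on_subset) simp
  then obtain a where a: "a \<in> K \<inter> S" "\<And>c. c \<in> K \<inter> S \<Longrightarrow> F a \<le> F c"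
    using continuous_attains_inf[OF cpt ne] by blast
  have "F a \<le> sieve_objective \<nu> E J lam n X v" if v: "v \<in> sieve \<nu> E J b" for v
  proof -
    obtain c where c: "v = comb J c" "AE x in \<nu>. \<bar>comb J c x\<bar> \<le> b"
      using v by (auto simp: sieve_eq[OF J])
    define c' where "c' = (\<lambda>j l. if j \<in> J \<and> l < d j then c j l else 0)"
    have c': "comb J c' = comb J c" unfolding c'_def by (rule comb_normalize)
    have "c' \<in> K"
      using coefficient_le[OF J _ _ c(2)] b by (fastforce simp: memK C_def c'_def abs_le_iff)
    then have "F a \<le> F c'" using c c' by (intro a) (simp add: S_def)
    then show ?thesis by (simp add: F_def c' c)
  qed
  moreover have "comb J a \<in> sieve \<nu> E J b" using a(1) by (auto simp: sieve_eq[OF J] S_def)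
  ultimately have "is_arg_min (sieve_objective \<nu> E J lam n X) (\<lambda>v. v \<in> sieve \<nu> E J b) (comb J a)"
    by (auto simp: is_arg_min_def F_def not_less)
  then show ?thesis by blast
qed

text \<open>
  At the midpoint of two minimizers the objective drops by their squared Hellinger distance,
  which therefore vanishes. Mean-zero functions with the same density agree almost everywhere,
  so their coefficients agree and with them the functions themselves.
\<close>
lemma sieve_minimizer_unique:
  assumes J: "finite J" and mean: "\<And>j l. j \<in> J \<Longrightarrow> l < d j \<Longrightarrow> (\<integral>x. \<phi> j l x \<partial>\<nu>) = 0"
    and lam: "\<And>j. j \<in> J \<Longrightarrow> 0 \<le> lam j"
    and u: "is_arg_min (sieve_objective \<nu> E J lam n X) (\<lambda>v. v \<in> sieve \<nu> E J b) u"
    and v: "is_arg_min (sieve_objective \<nu> E J lam n X) (\<lambda>v. v \<in> sieve \<nu> E J b) v"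
  shows "u = v"
proof -
  let ?F = "sieve_objective \<nu> E J lam n X"
  obtain a where a: "u = comb J a" "AE x in \<nu>. \<bar>comb J a x\<bar> \<le> b"
    using u by (auto simp: is_arg_min_def sieve_eq[OF J])
  obtain c where c: "v = comb J c" "AE x in \<nu>. \<bar>comb J c x\<bar> \<le> b"
    using v by (auto simp: is_arg_min_def sieve_eq[OF J])
  have Fuv: "?F u = ?F v"
    using u v unfolding is_arg_min_def by (meson antisym not_less)
  define m where "m = (\<lambda>j l. (1/2) * (a j l + c j l))"
  have mx: "comb J m x = (comb J a x + comb J c x) / 2" for x
    by (simp add: comb_def m_def sum.distrib sum_divide_distrib add_divide_distrib distrib_right)
  have "AE x in \<nu>. \<bar>comb J m x\<bar> \<le> b"
    using a(2) c(2) by eventually_elim (simp add: mx)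
  then have "comb J m \<in> sieve \<nu> E J b" by (auto simp: sieve_eq[OF J])
  then have Fm: "?F u \<le> ?F (comb J m)"
    using u by (auto simp: is_arg_min_def not_less)
  let ?h = "hellinger_sq \<nu> (exp_density \<nu> (comb J a)) (exp_density \<nu> (comb J c))"
  have A: "log_partition \<nu> (comb J m)
      \<le> (log_partition \<nu> (comb J a) + log_partition \<nu> (comb J c)) / 2 - ?h"
    using log_partition_midpoint[OF comb_measurable comb_measurable a(2) c(2)]
    by (simp add: mx[symmetric] flip: fun_eq_iff)
  have "block_norm m j \<le> (block_norm a j + block_norm c j) / 2" for j
    using block_norm_scale[of "1/2" "\<lambda>j l. a j l + c j l" j] block_norm_triangle[of a c j] by (simp add: m_def)
  then have "(\<Sum>j\<in>J. lam j * block_norm m j) \<le> (\<Sum>j\<in>J. lam j * ((block_norm a j + block_norm c j) / 2))"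
    using lam by (intro sum_mono mult_left_mono) auto
  also have "\<dots> = ((\<Sum>j\<in>J. lam j * block_norm a j) + (\<Sum>j\<in>J. lam j * block_norm c j)) / 2"
    by (simp add: sum.distrib sum_divide_distrib add_divide_distrib distrib_left)
  finally have P: "(\<Sum>j\<in>J. lam j * block_norm m j)
      \<le> ((\<Sum>j\<in>J. lam j * block_norm a j) + (\<Sum>j\<in>J. lam j * block_norm c j)) / 2" .
  have Q: "(\<Sum>j\<in>J. \<Sum>l<d j. m j l * empirical_mean n X (\<phi> j l))
     = ((\<Sum>j\<in>J. \<Sum>l<d j. a j l * empirical_mean n X (\<phi> j l))
        + (\<Sum>j\<in>J. \<Sum>l<d j. c j l * empirical_mean n X (\<phi> j l))) / 2"
    by (simp add: m_def sum.distrib sum_divide_distrib add_divide_distrib distrib_right)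
  have "?F (comb J m) \<le> (?F u + ?F v) / 2 - ?h"
    unfolding a(1) c(1) sieve_objective_comb[OF J] Q using A P by (simp add: field_simps)
  then have "?h \<le> 0" using Fm Fuv by simp
  moreover have "(\<integral>x. (comb J a x - comb J c x)\<^sup>2 \<partial>\<nu>) \<le> 8 * exp (2 * b) * ?h"
    by (rule L2_le_hellinger[OF comb_measurable comb_measurable a(2) c(2)]) (simp_all add: mean_zero_comb mean)
  moreover have "8 * exp (2 * b) * ?h \<le> 0"
    using \<open>?h \<le> 0\<close> by (simp add: mult_nonneg_nonpos)
  ultimately have "(\<integral>x. (comb J a x - comb J c x)\<^sup>2 \<partial>\<nu>) \<le> 0" by linarith
  then have "(\<Sum>j\<in>J. (block_norm (\<lambda>j l. a j l - c j l) j)\<^sup>2) \<le> 0"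
    by (simp add: comb_diff integral_comb_sq[OF J])
  then have "(\<Sum>j\<in>J. (block_norm (\<lambda>j l. a j l - c j l) j)\<^sup>2) = 0"
    by (simp add: sum_nonneg antisym)
  then have "\<forall>j\<in>J. block_norm (\<lambda>j l. a j l - c j l) j = 0"
    using J by (simp add: sum_nonneg_eq_0_iff)
  then have "\<forall>j\<in>J. \<forall>l<d j. a j l = c j l"
    by (simp add: block_norm_def L2_set_eq_0_iff)
  then show ?thesis unfolding a(1) c(1) by (simp add: comb_def fun_eq_iff)
qed

lemma sieve_estimator_minimizes:
  assumes J: "finite J" and "0 \<le> b"
    and "\<And>j l. j \<in> J \<Longrightarrow> l < d j \<Longrightarrow> (\<integral>x. \<phi> j l x \<partial>\<nu>) = 0" and "\<And>j. j \<in> J \<Longrightarrow> 0 \<le> lam j"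
  shows "sieve_estimator \<nu> E J b lam n X \<in> sieve \<nu> E J b"
    and "v \<in> sieve \<nu> E J b \<Longrightarrow>
      sieve_objective \<nu> E J lam n X (sieve_estimator \<nu> E J b lam n X) \<le> sieve_objective \<nu> E J lam n X v"
proof -
  let ?P = "is_arg_min (sieve_objective \<nu> E J lam n X) (\<lambda>v. v \<in> sieve \<nu> E J b)"
  obtain u where u: "?P u"
    using sieve_minimizer_exists[OF assms(1,2)] by blast
  have "v = u" if "?P v" for v
    by (rule sieve_minimizer_unique[OF assms(1,3,4) that u])
  then have "?P (sieve_estimator \<nu> E J b lam n X)"
    unfolding sieve_estimator_def by (rule theI[of ?P, OF u])
  then show "sieve_estimator \<nu> E J b lam n X \<in> sieve \<nu> E J b"
    and "v \<in> sieve \<nu> E J b \<Longrightarrow>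
      sieve_objective \<nu> E J lam n X (sieve_estimator \<nu> E J b lam n X) \<le> sieve_objective \<nu> E J lam n X v"
    by (auto simp: is_arg_min_def not_less)
qed

end

section \<open>The oracle inequality\<close>

lemma mult_le_weighted_squares:
  fixes x y \<epsilon> :: real
  assumes "\<epsilon> > 0"
  shows "5 * (x * y) \<le> \<epsilon> * y\<^sup>2 + 25 / (4 * \<epsilon>) * x\<^sup>2"
proof -
  have "0 \<le> (\<epsilon> * y - 5 / 2 * x)\<^sup>2 / \<epsilon>" using assms by simp
  also have "\<dots> = \<epsilon> * y\<^sup>2 - 5 * (x * y) + 25 / (4 * \<epsilon>) * x\<^sup>2"
    using assms by (simp add: power2_eq_square field_simps)
  finally show ?thesis by simp
qed

context eigen_system
begin

lemma integral_exp_density_comb: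
  assumes "u \<in> borel_measurable \<nu>" "AE x in \<nu>. \<bar>u x\<bar> \<le> b"
  shows "(\<integral>x. exp_density \<nu> u x * comb J a x \<partial>\<nu>)
    = (\<Sum>j\<in>J. \<Sum>l<d j. a j l * (\<integral>x. \<phi> j l x * exp_density \<nu> u x \<partial>\<nu>))"
  using integral_mult_comb(2)[OF integrable_exp_density(1)[OF assms], of J a]
  by (simp add: coef_def mult.commute)

text \<open>
  The estimator is compared with an arbitrary element of the sieve in the penalized
  likelihood. The difference between empirical and true linear functional is bounded block by
  block by Cauchy--Schwarz and the score event.
\<close>
lemma penalized_excess_risk:
  assumes J: "finite J" and b: "0 \<le> b"
    and mean: "\<And>j l. j \<in> J \<Longrightarrow> l < d j \<Longrightarrow> (\<integral>x. \<phi> j l x \<partial>\<nu>) = 0"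
    and lam: "\<And>j. j \<in> J \<Longrightarrow> 0 \<le> lam j"
    and u0 [measurable]: "u0 \<in> borel_measurable \<nu>" and u0b: "AE x in \<nu>. \<bar>u0 x\<bar> \<le> b"
    and ev: "\<And>j. j \<in> J \<Longrightarrow> sqrt (\<Sum>l<d j. (score_fluctuation \<nu> \<phi> u0 n X j l)\<^sup>2) \<le> lam j"
    and a: "sieve_estimator \<nu> E J b lam n X = comb J a" "AE x in \<nu>. \<bar>comb J a x\<bar> \<le> b"
    and c: "AE x in \<nu>. \<bar>comb J c x\<bar> \<le> b"
  shows "KL_div \<nu> (exp_density \<nu> u0) (exp_density \<nu> (comb J a))
    \<le> KL_div \<nu> (exp_density \<nu> u0) (exp_density \<nu> (comb J c))
      + (\<Sum>j\<in>J. lam j * (block_norm (\<lambda>j l. a j l - c j l) j + 4 * (block_norm c j - block_norm a j)))"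
proof -
  let ?Z = "score_fluctuation \<nu> \<phi> u0 n X"
  have "comb J c \<in> sieve \<nu> E J b" using c by (auto simp: sieve_eq[OF J])
  then have "sieve_objective \<nu> E J lam n X (comb J a) \<le> sieve_objective \<nu> E J lam n X (comb J c)"
    using sieve_estimator_minimizes(2)[of J b lam "comb J c" n X, OF J b mean lam] unfolding a(1) by blast
  moreover have "KL_div \<nu> (exp_density \<nu> u0) (exp_density \<nu> (comb J e))
    = (\<integral>x. exp_density \<nu> u0 x * u0 x \<partial>\<nu>)
      - (\<Sum>j\<in>J. \<Sum>l<d j. e j l * (\<integral>x. \<phi> j l x * exp_density \<nu> u0 x \<partial>\<nu>))
      + log_partition \<nu> (comb J e) - log_partition \<nu> u0"
    if "AE x in \<nu>. \<bar>comb J e x\<bar> \<le> b" for e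
    using KL_div_eq_log_partition_diff[OF u0 comb_measurable u0b that] integral_exp_density_comb[OF u0 u0b] by simp
  note this[OF a(2)] this[OF c]
  moreover have "(\<Sum>j\<in>J. \<Sum>l<d j. (a j l - c j l) * ?Z j l)
     = (\<Sum>j\<in>J. \<Sum>l<d j. a j l * empirical_mean n X (\<phi> j l))
       - (\<Sum>j\<in>J. \<Sum>l<d j. c j l * empirical_mean n X (\<phi> j l))
       - (\<Sum>j\<in>J. \<Sum>l<d j. a j l * (\<integral>x. \<phi> j l x * exp_density \<nu> u0 x \<partial>\<nu>))
       + (\<Sum>j\<in>J. \<Sum>l<d j. c j l * (\<integral>x. \<phi> j l x * exp_density \<nu> u0 x \<partial>\<nu>))"
    by (simp add: score_fluctuation_def left_diff_distrib right_diff_distrib sum_subtractf)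
  moreover have "(\<Sum>j\<in>J. \<Sum>l<d j. (a j l - c j l) * ?Z j l)
      \<le> (\<Sum>j\<in>J. lam j * block_norm (\<lambda>j l. a j l - c j l) j)"
  proof (rule sum_mono)
    fix j assume j: "j \<in> J"
    have "(\<Sum>l<d j. (a j l - c j l) * ?Z j l) \<le> (\<Sum>l<d j. \<bar>a j l - c j l\<bar> * \<bar>?Z j l\<bar>)"
      by (rule sum_mono) (metis abs_ge_self abs_mult)
    also have "\<dots> \<le> block_norm (\<lambda>j l. a j l - c j l) j * L2_set (?Z j) {..<d j}"
      unfolding block_norm_def by (rule L2_set_mult_ineq)
    also have "\<dots> \<le> block_norm (\<lambda>j l. a j l - c j l) j * lam j"
      using ev[OF j] by (intro mult_left_mono) (auto simp: L2_set_def)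
    finally show "(\<Sum>l<d j. (a j l - c j l) * ?Z j l) \<le> lam j * block_norm (\<lambda>j l. a j l - c j l) j"
      by (simp add: mult.commute)
  qed
  moreover have "(\<Sum>j\<in>J. lam j * (block_norm (\<lambda>j l. a j l - c j l) j + 4 * (block_norm c j - block_norm a j)))
     = (\<Sum>j\<in>J. lam j * block_norm (\<lambda>j l. a j l - c j l) j)
       + 4 * (\<Sum>j\<in>J. lam j * block_norm c j) - 4 * (\<Sum>j\<in>J. lam j * block_norm a j)"
    by (simp add: algebra_simps sum.distrib sum_subtractf sum_distrib_left)
  ultimately show ?thesis
    unfolding sieve_objective_comb[OF J] by linarith
qed

text \<open>
  The factor 4 in the penalty dominates the fluctuation: a block of \<open>S\<close> costs at most
  \<open>5 \<lambda>\<^sub>j |w\<^sub>j|\<close>, with \<open>w\<close> the difference of estimator and comparison function, a block of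
  \<open>K - S\<close> at most \<open>8 \<lambda>\<^sub>j |\<theta>\<^sub>j|\<close>, and a block outside \<open>K\<close> nothing. The first cost is absorbed:
  its quadratic part is at most half of the divergence on the left-hand side, because the
  divergence controls the squared \<open>L\<^sup>2\<close> norm of \<open>w\<close> up to the approximation error.
\<close>
lemma sieve_oracle_inequality:
  assumes J: "finite J" and b: "0 \<le> b"
    and mean: "\<And>j l. j \<in> J \<Longrightarrow> l < d j \<Longrightarrow> (\<integral>x. \<phi> j l x \<partial>\<nu>) = 0"
    and lam: "\<And>j. j \<in> J \<Longrightarrow> 0 \<le> lam j"
    and u0 [measurable]: "u0 \<in> borel_measurable \<nu>" and u0b: "AE x in \<nu>. \<bar>u0 x\<bar> \<le> b"
    and u0m: "(\<integral>x. u0 x \<partial>\<nu>) = 0"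
    and ev: "\<And>j. j \<in> J \<Longrightarrow> sqrt (\<Sum>l<d j. (score_fluctuation \<nu> \<phi> u0 n X j l)\<^sup>2) \<le> lam j"
    and K: "K \<subseteq> J" and S: "S \<subseteq> K"
    and c: "AE x in \<nu>. \<bar>comb K \<theta> x\<bar> \<le> b"
  shows "KL_div \<nu> (exp_density \<nu> u0) (sieve_density \<nu> E J b lam n X)
    \<le> 200 * exp (4 * b) * ((\<integral>x. (u0 x - comb K \<theta> x)\<^sup>2 \<partial>\<nu>)
        + (\<Sum>j\<in>S. (lam j)\<^sup>2) + (\<Sum>j\<in>K - S. lam j * block_norm \<theta> j))"
proof -
  \<comment> \<open>the comparison function, with coefficients indexed by all of \<open>J\<close>\<close>
  define c where "c j l = (if j \<in> K then \<theta> j l else 0)" for j l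
  have cK: "comb K \<theta> = comb J c"
    unfolding c_def[abs_def] by (rule comb_mono_index[OF J K])
  obtain a where a: "sieve_estimator \<nu> E J b lam n X = comb J a" "AE x in \<nu>. \<bar>comb J a x\<bar> \<le> b"
    using sieve_estimator_minimizes(1)[of J b lam n X, OF J b mean lam] unfolding sieve_eq[OF J] by blast
  have cb: "AE x in \<nu>. \<bar>comb J c x\<bar> \<le> b" using assms(11) by (simp add: cK)
  define W where "W = block_norm (\<lambda>j l. a j l - c j l)"
  define D where "D = (\<integral>x. (u0 x - comb J c x)\<^sup>2 \<partial>\<nu>)"
  define k where "k = KL_div \<nu> (exp_density \<nu> u0) (exp_density \<nu> (comb J a))"
  define x where "x = sqrt (\<Sum>j\<in>S. (lam j)\<^sup>2)"
  define y where "y = sqrt (\<integral>x. (comb J a x - comb J c x)\<^sup>2 \<partial>\<nu>)"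
  define T where "T = (\<Sum>j\<in>K - S. lam j * block_norm \<theta> j)"
  have "k \<le> KL_div \<nu> (exp_density \<nu> u0) (exp_density \<nu> (comb J c))
      + (\<Sum>j\<in>J. lam j * (W j + 4 * (block_norm c j - block_norm a j)))"
    unfolding k_def W_def by (rule penalized_excess_risk[OF J b mean lam u0 u0b ev a cb])
  also have "KL_div \<nu> (exp_density \<nu> u0) (exp_density \<nu> (comb J c)) \<le> exp (4 * b) * D"
    unfolding D_def by (rule KL_le_L2[OF u0 comb_measurable u0b cb])
  also have "(\<Sum>j\<in>J. lam j * (W j + 4 * (block_norm c j - block_norm a j))) \<le> 5 * (x * y) + 8 * T"
  proof -
    have "(\<Sum>j\<in>J. lam j * (W j + 4 * (block_norm c j - block_norm a j)))
       \<le> (\<Sum>j\<in>J. if j \<in> S then 5 * (lam j * W j) else if j \<in> K then 8 * (lam j * block_norm \<theta> j) else 0)"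
    proof (rule sum_mono)
      fix j assume j: "j \<in> J"
      have w1: "block_norm c j \<le> W j + block_norm a j"
        using block_norm_diff_triangle[where a = c and c = a] block_norm_diff_commute[where a = a and c = c and j = j]
        by (simp add: W_def)
      have w2: "W j \<le> block_norm a j + block_norm c j"
        using block_norm_triangle[where a = a and c = "\<lambda>j l. - c j l" and j = j]
          block_norm_scale[where r = "-1" and a = c and j = j] by (simp add: W_def)
      show "lam j * (W j + 4 * (block_norm c j - block_norm a j))
        \<le> (if j \<in> S then 5 * (lam j * W j) else if j \<in> K then 8 * (lam j * block_norm \<theta> j) else 0)"
      proof (cases "j \<in> S")
        case True
        then show ?thesis
          using mult_left_mono[OF _ lam[OF j], of "W j + 4 * (block_norm c j - block_norm a j)" "5 * W j"] w1
          by (simp add: mult.left_commute)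
      next
        case notS: False
        show ?thesis
        proof (cases "j \<in> K")
          case True
          have "block_norm c j = block_norm \<theta> j" using True by (intro block_norm_cong) (simp add: c_def)
          have "W j + 4 * (block_norm c j - block_norm a j) \<le> 8 * block_norm c j"
            using w2 block_norm_nonneg[of a j] block_norm_nonneg[of c j] by argo
          then have "W j + 4 * (block_norm c j - block_norm a j) \<le> 8 * block_norm \<theta> j"
            unfolding \<open>block_norm c j = block_norm \<theta> j\<close> .
          from mult_left_mono[OF this lam[OF j]] show ?thesis
            using notS True by (simp add: mult.left_commute)
        next
          case False
          then have "block_norm c j = 0" by (simp add: block_norm_def L2_set_def c_def)
          then have "W j + 4 * (block_norm c j - block_norm a j) \<le> 0"
            using w2 block_norm_nonneg[of a j] by argo
          then show ?thesis
            using lam[OF j] notS False by (simp add: mult_nonneg_nonpos)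
        qed
      qed
    qed
    also have "\<dots> = 5 * (\<Sum>j\<in>S. lam j * W j) + 8 * T"
    proof -
      have "J \<inter> {j. j \<in> S} = S" "J \<inter> - {j. j \<in> S} \<inter> {j. j \<in> K} = K - S" using K S by auto
      moreover have "J \<inter> - S \<inter> K = K - S" using K S by auto
      ultimately show ?thesis
        using J by (simp add: sum.If_cases T_def sum_distrib_left)
    qed
    also have "(\<Sum>j\<in>S. lam j * W j) \<le> x * y"
    proof -
      have "(\<Sum>j\<in>S. lam j * W j) \<le> (\<Sum>j\<in>S. \<bar>lam j\<bar> * \<bar>W j\<bar>)"
        by (rule sum_mono) (simp add: W_def mult_right_mono)
      also have "\<dots> \<le> L2_set lam S * L2_set W S" by (rule L2_set_mult_ineq)
      also have "L2_set lam S = x" by (simp add: L2_set_def x_def)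
      also have "L2_set W S \<le> y"
        unfolding L2_set_def y_def W_def comb_diff integral_comb_sq[OF J]
        by (intro real_sqrt_le_mono sum_mono2 J) (use K S in auto)
      finally show ?thesis by (simp add: mult_left_mono x_def sum_nonneg)
    qed
    finally show ?thesis by simp
  qed
  finally have main: "k \<le> exp (4 * b) * D + 5 * (x * y) + 8 * T" by simp
  have kL2: "(\<integral>x. (u0 x - comb J a x)\<^sup>2 \<partial>\<nu>) \<le> 4 * exp (2 * b) * k"
  proof -
    have "(\<integral>x. (u0 x - comb J a x)\<^sup>2 \<partial>\<nu>)
        \<le> 8 * exp (2 * b) * hellinger_sq \<nu> (exp_density \<nu> u0) (exp_density \<nu> (comb J a))"
      by (rule L2_le_hellinger[OF u0 comb_measurable u0b a(2) u0m]) (simp add: mean_zero_comb mean)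
    also have "\<dots> = 4 * exp (2 * b) * (2 * hellinger_sq \<nu> (exp_density \<nu> u0) (exp_density \<nu> (comb J a)))"
      by simp
    also have "\<dots> \<le> 4 * exp (2 * b) * k"
      unfolding k_def by (intro mult_left_mono hellinger_le_KL[OF u0 comb_measurable u0b a(2)]) simp
    finally show ?thesis .
  qed
  have ysq: "y\<^sup>2 \<le> 8 * exp (2 * b) * k + 2 * D"
  proof -
    have b1: "AE x in \<nu>. \<bar>u0 x - comb J a x\<bar> \<le> 2 * b" and b2: "AE x in \<nu>. \<bar>u0 x - comb J c x\<bar> \<le> 2 * b"
      using u0b a(2) cb by auto
    have i1: "integrable \<nu> (\<lambda>x. (u0 x - comb J a x)\<^sup>2)"
      using integrable_AE_bounded(2)[OF _ b1] by simp
    have i2: "integrable \<nu> (\<lambda>x. (u0 x - comb J c x)\<^sup>2)"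
      using integrable_AE_bounded(2)[OF _ b2] by simp
    have "y\<^sup>2 = (\<integral>x. (comb J a x - comb J c x)\<^sup>2 \<partial>\<nu>)" by (simp add: y_def)
    also have "\<dots> \<le> (\<integral>x. 2 * (u0 x - comb J a x)\<^sup>2 + 2 * (u0 x - comb J c x)\<^sup>2 \<partial>\<nu>)"
    proof (rule integral_mono)
      show "integrable \<nu> (\<lambda>x. (comb J a x - comb J c x)\<^sup>2)" unfolding comb_diff by (rule integrable_comb)
      show "(comb J a x - comb J c x)\<^sup>2 \<le> 2 * (u0 x - comb J a x)\<^sup>2 + 2 * (u0 x - comb J c x)\<^sup>2" for x
        using zero_le_power2[of "(u0 x - comb J a x) + (u0 x - comb J c x)"]
        by (simp add: power2_eq_square algebra_simps)
    qed (use i1 i2 in auto)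
    also have "\<dots> = 2 * (\<integral>x. (u0 x - comb J a x)\<^sup>2 \<partial>\<nu>) + 2 * D"
      using i1 i2 by (simp add: D_def)
    finally show ?thesis using kL2 by simp
  qed
  have E1: "1 \<le> exp (2 * b)" "exp (2 * b) \<le> exp (4 * b)" using b by auto
  have D0: "0 \<le> D" and T0: "0 \<le> T"
    using K lam by (auto simp: D_def T_def intro!: sum_nonneg)
  \<comment> \<open>this weight turns the quadratic part of the cost of \<open>S\<close> into exactly half of the divergence \<open>k\<close>\<close>
  define \<epsilon> where "\<epsilon> = 1 / (16 * exp (2 * b))"
  have "5 * (x * y) \<le> \<epsilon> * y\<^sup>2 + 25 / (4 * \<epsilon>) * x\<^sup>2"
    by (rule mult_le_weighted_squares) (simp add: \<epsilon>_def)
  also have "\<epsilon> * y\<^sup>2 \<le> \<epsilon> * (8 * exp (2 * b) * k + 2 * D)"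
    using ysq by (intro mult_left_mono) (simp_all add: \<epsilon>_def)
  also have "\<dots> = k / 2 + D / (8 * exp (2 * b))" by (simp add: \<epsilon>_def field_simps)
  also have "D / (8 * exp (2 * b)) \<le> exp (4 * b) * D"
  proof -
    have "1 \<le> 8 * exp (2 * b)" using E1(1) by argo
    then have "D / (8 * exp (2 * b)) \<le> D / 1" using D0 by (intro divide_left_mono) auto
    also have "\<dots> \<le> exp (4 * b) * D" using E1 D0 mult_right_mono[of 1 "exp (4 * b)" D] by simp
    finally show ?thesis .
  qed
  also have "25 / (4 * \<epsilon>) * x\<^sup>2 = 100 * exp (2 * b) * x\<^sup>2" by (simp add: \<epsilon>_def)
  also have "\<dots> \<le> 100 * exp (4 * b) * x\<^sup>2" using E1 by (intro mult_right_mono) auto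
  finally have "k \<le> 4 * exp (4 * b) * D + 200 * exp (4 * b) * x\<^sup>2 + 16 * T"
    using main by simp
  also have "\<dots> \<le> 200 * exp (4 * b) * D + 200 * exp (4 * b) * x\<^sup>2 + 200 * exp (4 * b) * T"
  proof -
    have "16 \<le> 200 * exp (4 * b)" using E1 by argo
    then show ?thesis using D0 T0 by (intro add_mono mult_right_mono) auto
  qed
  also have "x\<^sup>2 = (\<Sum>j\<in>S. (lam j)\<^sup>2)" by (simp add: x_def sum_nonneg)
  finally show ?thesis
    by (simp add: k_def sieve_density_def a(1) D_def cK T_def algebra_simps)
qed

end

section \<open>Balancing penalty against approximation error\<close>

text \<open>
  With \<open>x\<^sub>j = (1 + m\<^sub>j)\<^sup>q\<^sup>/\<^sup>2 t\<^sub>j \<le> R\<close> one has \<open>t\<^sub>j\<^sup>2 = (1 + m\<^sub>j)\<^sup>-\<^sup>q x\<^sub>j\<^sup>2 \<le> (\<rho> / R) x\<^sub>j\<close>.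
\<close>
lemma sum_squares_le_of_weighted_sum:
  fixes t m :: "nat \<Rightarrow> real"
  assumes F: "finite F" and R: "R > 0"
    and m: "\<And>j. j \<in> F \<Longrightarrow> 0 \<le> m j" and t: "\<And>j. j \<in> F \<Longrightarrow> 0 \<le> t j"
    and sum: "(\<Sum>j\<in>F. (1 + m j) powr (q / 2) * t j) \<le> R"
    and tail: "\<And>j. j \<in> F \<Longrightarrow> R\<^sup>2 * (1 + m j) powr (- q) \<le> \<rho>"
    and \<rho>: "0 \<le> \<rho>"
  shows "(\<Sum>j\<in>F. (t j)\<^sup>2) \<le> \<rho>"
proof -
  define x where "x j = (1 + m j) powr (q / 2) * t j" for j
  have x0: "0 \<le> x j" if "j \<in> F" for j using t[OF that] by (simp add: x_def)
  have xR: "x j \<le> R" if "j \<in> F" for j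
  proof -
    have "x j \<le> (\<Sum>j\<in>F. x j)" using F that x0 by (intro member_le_sum) auto
    then show ?thesis using sum by (simp add: x_def)
  qed
  have "(t j)\<^sup>2 \<le> \<rho> / R * x j" if j: "j \<in> F" for j
  proof -
    have p: "0 < 1 + m j" using m[OF j] by simp
    have "(1 + m j) powr (- q) * (x j)\<^sup>2 = (t j)\<^sup>2"
    proof -
      have "((1 + m j) powr (q / 2))\<^sup>2 = (1 + m j) powr q"
        using p by (simp add: power2_eq_square flip: powr_add)
      then show ?thesis using p by (simp add: x_def power_mult_distrib powr_minus field_simps)
    qed
    then have "(t j)\<^sup>2 = (1 + m j) powr (- q) * (x j * x j)" by (simp add: power2_eq_square)
    also have "\<dots> \<le> (1 + m j) powr (- q) * (R * x j)"
      using x0[OF j] xR[OF j] by (intro mult_left_mono mult_right_mono) auto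
    also have "\<dots> = (R\<^sup>2 * (1 + m j) powr (- q)) / R * x j"
      using R by (simp add: power2_eq_square)
    also have "\<dots> \<le> \<rho> / R * x j"
      using tail[OF j] R x0[OF j] by (intro mult_right_mono divide_right_mono) auto
    finally show ?thesis .
  qed
  then have "(\<Sum>j\<in>F. (t j)\<^sup>2) \<le> (\<Sum>j\<in>F. \<rho> / R * x j)" by (rule sum_mono)
  also have "\<dots> = \<rho> / R * (\<Sum>j\<in>F. x j)" by (simp add: sum_distrib_left)
  also have "\<dots> \<le> \<rho> / R * R"
    using sum R \<rho> by (intro mult_left_mono) (auto simp: x_def)
  finally show ?thesis using R by simp
qed

lemma sqrt_eq_exp_half_ln:
  fixes x :: real
  assumes "x > 0"
  shows "sqrt x = exp (ln x / 2)"
  by (rule real_sqrt_unique) (use assms in \<open>simp_all add: power2_eq_square flip: exp_add\<close>)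

text \<open>
  At the threshold \<open>T\<close> the squared bias \<open>R\<^sup>2 T\<^sup>-\<^sup>q\<close> and the shrinkage cost
  \<open>\<surd>\<delta> R T\<^sup>(\<^sup>\<gamma>\<^sup>-\<^sup>q\<^sup>)\<^sup>/\<^sup>2\<close> coincide; the rate is their common value.
\<close>
lemma rate_low_smoothness:
  assumes "q < \<gamma>" "q > 0" "R > 0" "\<delta> > 0"
  defines "T \<equiv> (R\<^sup>2 / \<delta>) powr (1 / (q + \<gamma>))"
  shows "rate \<alpha> \<gamma> q R \<delta> = R\<^sup>2 * T powr (- q)"
    and "rate \<alpha> \<gamma> q R \<delta> = sqrt \<delta> * R * T powr ((\<gamma> - q) / 2)"
proof -
  have e: "R\<^sup>2 = exp (2 * ln R)" "sqrt \<delta> = exp (ln \<delta> / 2)"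
    using assms by (simp_all add: exp_double sqrt_eq_exp_half_ln)
  have T: "T powr c = exp (c * (2 * ln R - ln \<delta>) / (q + \<gamma>))" for c
    using assms by (simp add: T_def powr_def ln_div ln_realpow)
  have r: "rate \<alpha> \<gamma> q R \<delta> = exp (2 * \<gamma> / (q + \<gamma>) * ln R + q / (q + \<gamma>) * ln \<delta>)"
    using assms by (simp add: rate_def powr_def exp_add)
  have s: "q + \<gamma> \<noteq> 0" using assms by simp
  define s where "s = q + \<gamma>"
  have s0: "s \<noteq> 0" using s by (simp add: s_def)
  have "R\<^sup>2 * T powr (- q) = exp (2 * ln R + (- q) * (2 * ln R - ln \<delta>) / s)"
    unfolding T e(1) exp_add by (simp add: s_def)
  also have "2 * ln R + (- q) * (2 * ln R - ln \<delta>) / s = 2 * (s - q) / s * ln R + q / s * ln \<delta>"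
    using s0 by (simp add: field_simps)
  also have "s - q = \<gamma>" by (simp add: s_def)
  finally show "rate \<alpha> \<gamma> q R \<delta> = R\<^sup>2 * T powr (- q)" by (simp add: r s_def)
  have "sqrt \<delta> * R * T powr ((\<gamma> - q) / 2)
      = exp (ln \<delta> / 2 + ln R + (\<gamma> - q) / 2 * (2 * ln R - ln \<delta>) / s)"
    unfolding T e(2) exp_add using assms by (simp add: s_def)
  also have "ln \<delta> / 2 + ln R + (\<gamma> - q) / 2 * (2 * ln R - ln \<delta>) / s
      = (s + \<gamma> - q) / s * ln R + (s - \<gamma> + q) / (2 * s) * ln \<delta>"
    using s0 by (simp add: field_simps)
  also have "s + \<gamma> - q = 2 * \<gamma>" by (simp add: s_def)
  also have "(s - \<gamma> + q) / (2 * s) = q / s" using s0 by (simp add: s_def field_simps)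
  finally show "rate \<alpha> \<gamma> q R \<delta> = sqrt \<delta> * R * T powr ((\<gamma> - q) / 2)" by (simp add: r s_def)
qed

text \<open>
  At the threshold \<open>T\<close> the variance \<open>\<delta> T\<^sup>\<alpha>\<^sup>+\<^sup>\<gamma>\<close> of all frequencies below \<open>T\<close> and the shrinkage
  cost \<open>\<surd>\<delta> R T\<^sup>(\<^sup>\<gamma>\<^sup>-\<^sup>q\<^sup>)\<^sup>/\<^sup>2\<close> of the frequencies above coincide; the rate is their common
  value.
\<close>
lemma rate_high_smoothness:
  assumes "\<gamma> \<le> q" "q > 0" "\<gamma> \<ge> 0" "\<alpha> \<ge> 0" "R > 0" "\<delta> > 0"
  defines "T \<equiv> (R\<^sup>2 / \<delta>) powr (1 / (q + \<gamma> + 2 * \<alpha>))"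
  shows "rate \<alpha> \<gamma> q R \<delta> = \<delta> * T powr (\<alpha> + \<gamma>)"
    and "rate \<alpha> \<gamma> q R \<delta> = sqrt \<delta> * R * T powr ((\<gamma> - q) / 2)"
proof -
  define s where "s = q + \<gamma> + 2 * \<alpha>"
  have s: "s \<noteq> 0" using assms by (simp add: s_def)
  have e: "sqrt \<delta> = exp (ln \<delta> / 2)"
    using assms by (simp add: sqrt_eq_exp_half_ln)
  have T: "T powr c = exp (c * (2 * ln R - ln \<delta>) / s)" for c
    using assms by (simp add: T_def s_def powr_def ln_div ln_realpow)
  have r: "rate \<alpha> \<gamma> q R \<delta> = exp (2 * (\<alpha> + \<gamma>) / s * ln R + (q + \<alpha>) / s * ln \<delta>)"
    using assms by (simp add: rate_def powr_def exp_add s_def)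
  have "\<delta> * T powr (\<alpha> + \<gamma>) = exp (ln \<delta> + (\<alpha> + \<gamma>) * (2 * ln R - ln \<delta>) / s)"
    unfolding T exp_add using assms by simp
  also have "ln \<delta> + (\<alpha> + \<gamma>) * (2 * ln R - ln \<delta>) / s
      = 2 * (\<alpha> + \<gamma>) / s * ln R + (s - \<alpha> - \<gamma>) / s * ln \<delta>"
    using s by (simp add: field_simps)
  also have "s - \<alpha> - \<gamma> = q + \<alpha>" by (simp add: s_def)
  finally show "rate \<alpha> \<gamma> q R \<delta> = \<delta> * T powr (\<alpha> + \<gamma>)" by (simp add: r)
  have "sqrt \<delta> * R * T powr ((\<gamma> - q) / 2)
      = exp (ln \<delta> / 2 + ln R + (\<gamma> - q) / 2 * (2 * ln R - ln \<delta>) / s)"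
    unfolding T e exp_add using assms by simp
  also have "ln \<delta> / 2 + ln R + (\<gamma> - q) / 2 * (2 * ln R - ln \<delta>) / s
      = (s + \<gamma> - q) / s * ln R + (s - \<gamma> + q) / (2 * s) * ln \<delta>"
    using s by (simp add: field_simps)
  also have "s + \<gamma> - q = 2 * (\<alpha> + \<gamma>)" by (simp add: s_def)
  also have "(s - \<gamma> + q) / (2 * s) = (q + \<alpha>) / s" using s by (simp add: s_def field_simps)
  finally show "rate \<alpha> \<gamma> q R \<delta> = sqrt \<delta> * R * T powr ((\<gamma> - q) / 2)" by (simp add: r)
qed

lemma penalty_sum_le:
  fixes t m lam d :: "nat \<Rightarrow> real"
  assumes G: "finite G" and \<delta>: "\<delta> > 0" and P: "0 \<le> P"
    and m: "\<And>j. j \<in> G \<Longrightarrow> 0 \<le> m j" and t: "\<And>j. j \<in> G \<Longrightarrow> 0 \<le> t j"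
    and d: "\<And>j. j \<in> G \<Longrightarrow> 0 \<le> d j \<and> d j \<le> Cd * (1 + m j) powr \<gamma>"
    and lam2: "\<And>j. j \<in> G \<Longrightarrow> (lam j)\<^sup>2 \<le> Clam * \<delta> * d j"
    and sum: "(\<Sum>j\<in>G. (1 + m j) powr (q / 2) * t j) \<le> R"
    and powP: "\<And>j. j \<in> G \<Longrightarrow> (1 + m j) powr ((\<gamma> - q) / 2) \<le> P"
  shows "(\<Sum>j\<in>G. lam j * t j) \<le> sqrt \<bar>Clam * Cd\<bar> * sqrt \<delta> * P * R"
proof -
  have "lam j * t j \<le> sqrt \<bar>Clam * Cd\<bar> * sqrt \<delta> * P * ((1 + m j) powr (q / 2) * t j)" if j: "j \<in> G" for j
  proof -
    have p: "0 < 1 + m j" using m[OF j] by simp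
    have "(lam j)\<^sup>2 \<le> Clam * \<delta> * d j" by (rule lam2[OF j])
    also have "\<dots> \<le> \<bar>Clam\<bar> * \<delta> * d j"
      using d[OF j] \<delta> by (intro mult_right_mono) auto
    also have "\<dots> \<le> \<bar>Clam\<bar> * \<delta> * (\<bar>Cd\<bar> * (1 + m j) powr \<gamma>)"
    proof (intro mult_left_mono)
      have "d j \<le> Cd * (1 + m j) powr \<gamma>" using d[OF j] by simp
      also have "\<dots> \<le> \<bar>Cd\<bar> * (1 + m j) powr \<gamma>" by (intro mult_right_mono) auto
      finally show "d j \<le> \<bar>Cd\<bar> * (1 + m j) powr \<gamma>" .
    qed (use \<delta> in auto)
    also have "(1 + m j) powr \<gamma> = ((1 + m j) powr (\<gamma> / 2))\<^sup>2"
      using p by (simp add: power2_eq_square flip: powr_add)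
    also have "\<bar>Clam\<bar> * \<delta> * (\<bar>Cd\<bar> * ((1 + m j) powr (\<gamma> / 2))\<^sup>2)
        = (sqrt \<bar>Clam * Cd\<bar> * sqrt \<delta> * (1 + m j) powr (\<gamma> / 2))\<^sup>2"
      using \<delta> by (simp add: power_mult_distrib abs_mult)
    finally have "lam j \<le> sqrt \<bar>Clam * Cd\<bar> * sqrt \<delta> * (1 + m j) powr (\<gamma> / 2)"
      by (rule power2_le_imp_le) (use \<delta> in auto)
    also have "(1 + m j) powr (\<gamma> / 2) = (1 + m j) powr ((\<gamma> - q) / 2) * (1 + m j) powr (q / 2)"
      by (simp add: diff_divide_distrib flip: powr_add)
    also have "\<dots> \<le> P * (1 + m j) powr (q / 2)"
      using powP[OF j] by (intro mult_right_mono) auto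
    finally have "lam j \<le> sqrt \<bar>Clam * Cd\<bar> * sqrt \<delta> * (P * (1 + m j) powr (q / 2))"
      using \<delta> by (simp add: mult_left_mono)
    from mult_right_mono[OF this t[OF j]] show ?thesis by (simp add: mult_ac)
  qed
  then have "(\<Sum>j\<in>G. lam j * t j)
      \<le> (\<Sum>j\<in>G. sqrt \<bar>Clam * Cd\<bar> * sqrt \<delta> * P * ((1 + m j) powr (q / 2) * t j))" by (rule sum_mono)
  also have "\<dots> = sqrt \<bar>Clam * Cd\<bar> * sqrt \<delta> * P * (\<Sum>j\<in>G. (1 + m j) powr (q / 2) * t j)"
    by (simp add: sum_distrib_left)
  also have "\<dots> \<le> sqrt \<bar>Clam * Cd\<bar> * sqrt \<delta> * P * R"
    using sum P \<delta> by (intro mult_left_mono) auto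
  finally show ?thesis .
qed

text \<open>
  For \<open>q < \<gamma>\<close> the shrinkage cost grows with frequency, and high frequencies are better dropped
  from the comparison function. For \<open>q \<ge> \<gamma>\<close> it decreases with frequency, and low frequencies
  are better charged by their variance. When \<open>T < 2\<close> the dimension bound cannot be applied at
  \<open>T - 1\<close>; there all blocks are charged by shrinkage, at the price of a factor
  \<open>2\<^sup>|\<^sup>q\<^sup>-\<^sup>\<gamma>\<^sup>|\<^sup>/\<^sup>2\<close>.
\<close>
lemma rate_balancing_cutoff:
  fixes t m lam d :: "nat \<Rightarrow> real"
  assumes par: "\<alpha> \<ge> 0" "\<gamma> \<ge> 0" "q > 0" "R > 0" "\<delta> > 0" and J: "finite J"
    and m: "\<And>j. j \<in> J \<Longrightarrow> 0 \<le> m j" and t: "\<And>j. j \<in> J \<Longrightarrow> 0 \<le> t j"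
    and d: "\<And>j. j \<in> J \<Longrightarrow> 0 \<le> d j \<and> d j \<le> Cd * (1 + m j) powr \<gamma>"
    and dim: "\<And>\<Lambda>. 1 \<le> \<Lambda> \<Longrightarrow> (\<Sum>j | j \<in> J \<and> m j \<le> \<Lambda>. d j) \<le> CD * (1 + \<Lambda>) powr (\<alpha> + \<gamma>)"
    and lam2: "\<And>j. j \<in> J \<Longrightarrow> (lam j)\<^sup>2 \<le> Clam * \<delta> * d j"
    and sum: "(\<Sum>j\<in>J. (1 + m j) powr (q / 2) * t j) \<le> R"
  shows "\<exists>K S. S \<subseteq> K \<and> K \<subseteq> J \<and> (\<forall>j\<in>J - K. R\<^sup>2 * (1 + m j) powr (- q) \<le> rate \<alpha> \<gamma> q R \<delta>) \<and>
    (\<Sum>j\<in>S. (lam j)\<^sup>2) + (\<Sum>j\<in>K - S. lam j * t j)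
      \<le> (\<bar>Clam * CD\<bar> + sqrt \<bar>Clam * Cd\<bar> * 2 powr (\<bar>q - \<gamma>\<bar> / 2)) * rate \<alpha> \<gamma> q R \<delta>"
proof -
  let ?\<rho> = "rate \<alpha> \<gamma> q R \<delta>"
  have \<rho>: "0 \<le> ?\<rho>" by (simp add: rate_def)
  have pen: "(\<Sum>j\<in>G. lam j * t j) \<le> sqrt \<bar>Clam * Cd\<bar> * sqrt \<delta> * P * R"
    if "G \<subseteq> J" "0 \<le> P" "\<And>j. j \<in> G \<Longrightarrow> (1 + m j) powr ((\<gamma> - q) / 2) \<le> P" for G P
  proof (rule penalty_sum_le[where d = d and m = m and \<gamma> = \<gamma> and q = q])
    show "finite G" using J that(1) finite_subset by blast
    have "(\<Sum>j\<in>G. (1 + m j) powr (q / 2) * t j) \<le> (\<Sum>j\<in>J. (1 + m j) powr (q / 2) * t j)"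
      using that(1) J t by (intro sum_mono2) auto
    then show "(\<Sum>j\<in>G. (1 + m j) powr (q / 2) * t j) \<le> R" using sum by simp
  qed (use that par m t d lam2 in blast)+
  have two: "1 \<le> (2::real) powr (\<bar>q - \<gamma>\<bar> / 2)" by (simp add: ge_one_powr_ge_zero)
  have const: "c * ?\<rho> \<le> (\<bar>Clam * CD\<bar> + sqrt \<bar>Clam * Cd\<bar> * 2 powr (\<bar>q - \<gamma>\<bar> / 2)) * ?\<rho>"
    if "c \<le> \<bar>Clam * CD\<bar> + sqrt \<bar>Clam * Cd\<bar> * 2 powr (\<bar>q - \<gamma>\<bar> / 2)" for c
    using that \<rho> by (rule mult_right_mono)
  have sq1: "sqrt \<bar>Clam * Cd\<bar> \<le> sqrt \<bar>Clam * Cd\<bar> * 2 powr (\<bar>q - \<gamma>\<bar> / 2)"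
    using mult_left_mono[OF two, of "sqrt \<bar>Clam * Cd\<bar>"] by simp
  show ?thesis
  proof (cases "q < \<gamma>")
    case True
    define T where "T = (R\<^sup>2 / \<delta>) powr (1 / (q + \<gamma>))"
    have T: "T > 0" using par by (simp add: T_def)
    note r = rate_low_smoothness[OF True par(3,4,5), of \<alpha>, folded T_def]
    define K where "K = {j\<in>J. 1 + m j \<le> T}"
    have "(\<Sum>j\<in>K. lam j * t j) \<le> sqrt \<bar>Clam * Cd\<bar> * sqrt \<delta> * T powr ((\<gamma> - q) / 2) * R"
    proof (rule pen)
      show "(1 + m j) powr ((\<gamma> - q) / 2) \<le> T powr ((\<gamma> - q) / 2)" if "j \<in> K" for j
        using that m[of j] True by (intro powr_mono2) (auto simp: K_def)
    qed (auto simp: K_def)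
    also have "\<dots> = sqrt \<bar>Clam * Cd\<bar> * ?\<rho>" unfolding r(2) by (simp add: mult_ac)
    also have "\<dots> \<le> (\<bar>Clam * CD\<bar> + sqrt \<bar>Clam * Cd\<bar> * 2 powr (\<bar>q - \<gamma>\<bar> / 2)) * ?\<rho>"
      by (rule const) (use sq1 in linarith)
    finally have "(\<Sum>j\<in>K. lam j * t j) \<le> (\<bar>Clam * CD\<bar> + sqrt \<bar>Clam * Cd\<bar> * 2 powr (\<bar>q - \<gamma>\<bar> / 2)) * ?\<rho>" .
    moreover have "R\<^sup>2 * (1 + m j) powr (- q) \<le> ?\<rho>" if "j \<in> J - K" for j
      unfolding r(1) using that T par by (intro mult_left_mono powr_mono2') (auto simp: K_def)
    ultimately show ?thesis
      by (intro exI[of _ K] exI[of _ "{}"]) (auto simp: K_def)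
  next
    case False
    then have q\<gamma>: "\<gamma> \<le> q" by simp
    define T where "T = (R\<^sup>2 / \<delta>) powr (1 / (q + \<gamma> + 2 * \<alpha>))"
    have T: "T > 0" using par by (simp add: T_def)
    note r = rate_high_smoothness[OF q\<gamma> par(3,2,1,4,5), folded T_def]
    show ?thesis
    proof (cases "T < 2")
      case True
      have "(\<Sum>j\<in>J. lam j * t j) \<le> sqrt \<bar>Clam * Cd\<bar> * sqrt \<delta> * 1 * R"
      proof (rule pen)
        show "(1 + m j) powr ((\<gamma> - q) / 2) \<le> 1" if "j \<in> J" for j
          using m[OF that] q\<gamma> powr_mono2'[of "(\<gamma> - q) / 2" 1 "1 + m j"] by simp
      qed auto
      also have "\<dots> \<le> sqrt \<bar>Clam * Cd\<bar> * 2 powr (\<bar>q - \<gamma>\<bar> / 2) * ?\<rho>"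
      proof -
        have "2 powr ((\<gamma> - q) / 2) \<le> T powr ((\<gamma> - q) / 2)"
          using True T q\<gamma> by (intro powr_mono2') auto
        then have "2 powr (\<bar>q - \<gamma>\<bar> / 2) * 2 powr ((\<gamma> - q) / 2) \<le> 2 powr (\<bar>q - \<gamma>\<bar> / 2) * T powr ((\<gamma> - q) / 2)"
          by (rule mult_left_mono) simp
        moreover have "(2::real) powr (\<bar>q - \<gamma>\<bar> / 2) * 2 powr ((\<gamma> - q) / 2) = 1"
        proof -
          have "\<bar>q - \<gamma>\<bar> / 2 + (\<gamma> - q) / 2 = 0" using q\<gamma> by (simp add: field_simps)
          then show ?thesis by (simp flip: powr_add)
        qed
        ultimately have "1 \<le> 2 powr (\<bar>q - \<gamma>\<bar> / 2) * T powr ((\<gamma> - q) / 2)" by simp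
        then have "sqrt \<bar>Clam * Cd\<bar> * sqrt \<delta> * R * 1
            \<le> sqrt \<bar>Clam * Cd\<bar> * sqrt \<delta> * R * (2 powr (\<bar>q - \<gamma>\<bar> / 2) * T powr ((\<gamma> - q) / 2))"
          using par by (intro mult_left_mono) auto
        then show ?thesis unfolding r(2) by (simp add: mult_ac)
      qed
      also have "\<dots> \<le> (\<bar>Clam * CD\<bar> + sqrt \<bar>Clam * Cd\<bar> * 2 powr (\<bar>q - \<gamma>\<bar> / 2)) * ?\<rho>"
        by (rule const) simp
      finally show ?thesis by (intro exI[of _ J] exI[of _ "{}"]) auto
    next
      case False
      \<comment> \<open>the dimension bound at \<open>\<Lambda> = T - 1 \<ge> 1\<close> produces exactly \<open>T\<close>\<close>
      define S where "S = {j\<in>J. m j \<le> T - 1}"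
      have SJ: "S \<subseteq> J" by (auto simp: S_def)
      have "(\<Sum>j\<in>S. (lam j)\<^sup>2) \<le> (\<Sum>j\<in>S. \<bar>Clam\<bar> * \<delta> * d j)"
      proof (rule sum_mono)
        fix j assume "j \<in> S"
        then have j: "j \<in> J" by (simp add: S_def)
        have "(lam j)\<^sup>2 \<le> Clam * \<delta> * d j" by (rule lam2[OF j])
        also have "\<dots> \<le> \<bar>Clam\<bar> * \<delta> * d j" using d[OF j] par by (intro mult_right_mono) auto
        finally show "(lam j)\<^sup>2 \<le> \<bar>Clam\<bar> * \<delta> * d j" .
      qed
      also have "\<dots> = \<bar>Clam\<bar> * \<delta> * (\<Sum>j\<in>S. d j)" by (simp add: sum_distrib_left)
      also have "\<dots> \<le> \<bar>Clam\<bar> * \<delta> * (\<bar>CD\<bar> * T powr (\<alpha> + \<gamma>))"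
      proof (intro mult_left_mono)
        have "(\<Sum>j\<in>S. d j) \<le> CD * (1 + (T - 1)) powr (\<alpha> + \<gamma>)"
          using dim[of "T - 1"] False by (simp add: S_def)
        also have "\<dots> = CD * T powr (\<alpha> + \<gamma>)" by simp
        also have "\<dots> \<le> \<bar>CD\<bar> * T powr (\<alpha> + \<gamma>)" by (intro mult_right_mono) auto
        finally show "(\<Sum>j\<in>S. d j) \<le> \<bar>CD\<bar> * T powr (\<alpha> + \<gamma>)" .
      qed (use par in auto)
      also have "\<dots> = \<bar>Clam * CD\<bar> * ?\<rho>" unfolding r(1) by (simp add: abs_mult mult_ac)
      finally have 1: "(\<Sum>j\<in>S. (lam j)\<^sup>2) \<le> \<bar>Clam * CD\<bar> * ?\<rho>" .
      have "(\<Sum>j\<in>J - S. lam j * t j) \<le> sqrt \<bar>Clam * Cd\<bar> * sqrt \<delta> * T powr ((\<gamma> - q) / 2) * R"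
      proof (rule pen)
        show "(1 + m j) powr ((\<gamma> - q) / 2) \<le> T powr ((\<gamma> - q) / 2)" if "j \<in> J - S" for j
          using that T q\<gamma> by (intro powr_mono2') (auto simp: S_def)
      qed auto
      also have "\<dots> = sqrt \<bar>Clam * Cd\<bar> * ?\<rho>" unfolding r(2) by (simp add: mult_ac)
      finally have 2: "(\<Sum>j\<in>J - S. lam j * t j) \<le> sqrt \<bar>Clam * Cd\<bar> * ?\<rho>" .
      have "(\<Sum>j\<in>S. (lam j)\<^sup>2) + (\<Sum>j\<in>J - S. lam j * t j)
          \<le> (\<bar>Clam * CD\<bar> + sqrt \<bar>Clam * Cd\<bar>) * ?\<rho>"
        using 1 2 by (simp add: distrib_right)
      also have "\<dots> \<le> (\<bar>Clam * CD\<bar> + sqrt \<bar>Clam * Cd\<bar> * 2 powr (\<bar>q - \<gamma>\<bar> / 2)) * ?\<rho>"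
        by (rule const) (use sq1 in linarith)
      finally show ?thesis using SJ by (intro exI[of _ J] exI[of _ S]) auto
    qed
  qed
qed

section \<open>Approximation error and expected loss\<close>

context prob_space
begin

lemma square_integral_le:
  fixes f :: "'a \<Rightarrow> real"
  assumes "integrable M f" "integrable M (\<lambda>x. (f x)\<^sup>2)"
  shows "(\<integral>x. f x \<partial>M)\<^sup>2 \<le> (\<integral>x. (f x)\<^sup>2 \<partial>M)"
  using variance_positive[of f] variance_eq[OF assms] by simp

lemma KL_div_le_oscillation:
  assumes [measurable]: "u \<in> borel_measurable M" "v \<in> borel_measurable M"
    and u: "AE x in M. \<bar>u x\<bar> \<le> b" and v: "AE x in M. \<bar>v x\<bar> \<le> b"
  shows "KL_div M (exp_density M u) (exp_density M v) \<le> 4 * b"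
proof -
  let ?f = "\<lambda>x. (u x - log_partition M u) - (v x - log_partition M v)"
  have f: "AE x in M. \<bar>?f x\<bar> \<le> 4 * b"
    using log_density_AE_le[OF _ u] log_density_AE_le[OF _ v] by auto
  have "(\<integral>x. exp_density M u x * ?f x \<partial>M) \<le> (\<integral>x. exp_density M u x * (4 * b) \<partial>M)"
  proof (rule integral_mono_AE)
    show "integrable M (\<lambda>x. exp_density M u x * ?f x)"
      by (rule integrable_bounded_mult_exp[OF _ _ u f]) measurable
    show "AE x in M. exp_density M u x * ?f x \<le> exp_density M u x * (4 * b)"
      using f by eventually_elim (intro mult_left_mono, auto simp: exp_density_def)
  qed (use integrable_exp_density[OF _ u] in auto)
  then show ?thesis
    using integrable_exp_density[OF _ u] by (simp add: KL_div_exp_density)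
qed

lemma prob_space_density_exp:
  assumes [measurable]: "u \<in> borel_measurable M" and u: "AE x in M. \<bar>u x\<bar> \<le> b"
  shows "prob_space (density M (\<lambda>x. ennreal (exp_density M u x)))"
proof
  have "emeasure (density M (\<lambda>x. ennreal (exp_density M u x))) (space M)
      = (\<integral>\<^sup>+x. ennreal (exp_density M u x) \<partial>M)"
    by (subst emeasure_density) (auto intro!: nn_integral_cong)
  also have "\<dots> = ennreal (\<integral>x. exp_density M u x \<partial>M)"
    by (rule nn_integral_eq_integral[OF integrable_exp_density(1)[OF assms]]) (simp add: exp_density_def)
  finally show "emeasure (density M (\<lambda>x. ennreal (exp_density M u x)))
      (space (density M (\<lambda>x. ennreal (exp_density M u x)))) = 1"
    using integrable_exp_density[OF _ u] by simp
qed

lemma prob_space_sample_law: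
  assumes "u \<in> borel_measurable M" and "AE x in M. \<bar>u x\<bar> \<le> b"
  shows "prob_space (sample_law M u n)"
  unfolding sample_law_def by (intro prob_space_PiM prob_space_density_exp[OF assms])

end

context eigen_system
begin

lemma integral_residual_sq:
  assumes f: "f \<in> L2_space \<nu>" and K: "finite K"
  shows "(\<integral>x. (f x - comb K (coef f) x)\<^sup>2 \<partial>\<nu>) = (\<integral>x. (f x)\<^sup>2 \<partial>\<nu>) - (\<Sum>j\<in>K. (block_norm (coef f) j)\<^sup>2)"
proof -
  note fi = L2_integrable[OF f]
  have f2: "integrable \<nu> (\<lambda>x. (f x)\<^sup>2)" using f by (simp add: L2_space_def)
  have "(\<integral>x. (f x - comb K (coef f) x)\<^sup>2 \<partial>\<nu>)
      = (\<integral>x. (f x)\<^sup>2 - 2 * (f x * comb K (coef f) x) + (comb K (coef f) x)\<^sup>2 \<partial>\<nu>)"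
    by (simp add: power2_diff algebra_simps)
  also have "\<dots> = (\<integral>x. (f x)\<^sup>2 \<partial>\<nu>) - 2 * (\<integral>x. f x * comb K (coef f) x \<partial>\<nu>)
      + (\<integral>x. (comb K (coef f) x)\<^sup>2 \<partial>\<nu>)"
    using f2 integral_mult_comb(1)[OF fi] integrable_comb(2) by simp
  also have "(\<integral>x. f x * comb K (coef f) x \<partial>\<nu>) = (\<Sum>j\<in>K. (block_norm (coef f) j)\<^sup>2)"
    unfolding integral_mult_comb(2)[OF fi] block_norm_sq by (simp add: power2_eq_square)
  finally show ?thesis by (simp add: integral_comb_sq[OF K])
qed

text \<open>
  By Pythagoras the residual of \<open>K\<close> is the residual of a long partial sum plus finitely many
  squared block norms outside \<open>K\<close>, so only finite tails have to be bounded.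
\<close>
lemma residual_sq_le_tail:
  assumes f: "f \<in> L2_space \<nu>" and K: "finite K"
    and complete: "(\<lambda>N. L2_norm \<nu> (\<lambda>x. f x - comb {..<N} (coef f) x)) \<longlonglongrightarrow> 0"
    and tail: "\<And>F. finite F \<Longrightarrow> F \<inter> K = {} \<Longrightarrow> (\<Sum>j\<in>F. (block_norm (coef f) j)\<^sup>2) \<le> \<rho>"
  shows "(\<integral>x. (f x - comb K (coef f) x)\<^sup>2 \<partial>\<nu>) \<le> \<rho>"
proof -
  let ?r = "\<lambda>N. \<integral>x. (f x - comb {..<N} (coef f) x)\<^sup>2 \<partial>\<nu>"
  have "(\<lambda>N. (L2_norm \<nu> (\<lambda>x. f x - comb {..<N} (coef f) x))\<^sup>2) \<longlonglongrightarrow> 0\<^sup>2"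
    using complete by (intro tendsto_power)
  then have lim: "?r \<longlonglongrightarrow> 0" by (simp add: L2_norm_def)
  obtain N0 where N0: "K \<subseteq> {..<N0}" using K finite_nat_iff_bounded by blast
  have "(\<integral>x. (f x - comb K (coef f) x)\<^sup>2 \<partial>\<nu>) \<le> ?r N + \<rho>" if "N \<ge> N0" for N
  proof -
    have sub: "K \<subseteq> {..<N}" using N0 that by auto
    have "(\<Sum>j<N. (block_norm (coef f) j)\<^sup>2)
        = (\<Sum>j\<in>{..<N} - K. (block_norm (coef f) j)\<^sup>2) + (\<Sum>j\<in>K. (block_norm (coef f) j)\<^sup>2)"
      by (rule sum.subset_diff[OF sub]) simp
    moreover have "(\<Sum>j\<in>{..<N} - K. (block_norm (coef f) j)\<^sup>2) \<le> \<rho>" by (rule tail) auto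
    ultimately show ?thesis
      using integral_residual_sq[OF f K] integral_residual_sq[OF f, of "{..<N}"] by simp
  qed
  moreover have "(\<lambda>N. ?r N + \<rho>) \<longlonglongrightarrow> 0 + \<rho>" by (intro tendsto_add lim tendsto_const)
  ultimately show ?thesis
    by (intro LIMSEQ_le_const[of "\<lambda>N. ?r N + \<rho>" \<rho>]) auto
qed

lemma comb_abs_le_kernel:
  "\<bar>comb K a x\<bar> \<le> (\<Sum>j\<in>K. block_norm a j * sqrt (eigen_kernel d \<phi> j x x))"
proof -
  have "\<bar>comb K a x\<bar> \<le> (\<Sum>j\<in>K. \<bar>\<Sum>l<d j. a j l * \<phi> j l x\<bar>)"
    unfolding comb_def by (rule sum_abs)
  also have "\<dots> \<le> (\<Sum>j\<in>K. block_norm a j * sqrt (eigen_kernel d \<phi> j x x))"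
  proof (rule sum_mono)
    fix j
    have "\<bar>\<Sum>l<d j. a j l * \<phi> j l x\<bar> \<le> (\<Sum>l<d j. \<bar>a j l\<bar> * \<bar>\<phi> j l x\<bar>)"
      by (rule order_trans[OF sum_abs]) (simp add: abs_mult)
    also have "\<dots> \<le> L2_set (a j) {..<d j} * L2_set (\<lambda>l. \<phi> j l x) {..<d j}"
      by (rule L2_set_mult_ineq)
    also have "\<dots> = block_norm a j * sqrt (eigen_kernel d \<phi> j x x)"
      by (simp add: block_norm_def L2_set_def eigen_kernel_def power2_eq_square)
    finally show "\<bar>\<Sum>l<d j. a j l * \<phi> j l x\<bar> \<le> block_norm a j * sqrt (eigen_kernel d \<phi> j x x)" .
  qed
  finally show ?thesis .
qed

lemma eigen_kernel_le_SUP: "eigen_kernel d \<phi> j x x \<le> (SUP x. eigen_kernel d \<phi> j x x)"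
proof (rule cSUP_upper)
  show "bdd_above (range (\<lambda>x. eigen_kernel d \<phi> j x x))"
  proof (rule bdd_aboveI2)
    fix x
    show "eigen_kernel d \<phi> j x x \<le> (\<Sum>l<d j. basis_bound j l * basis_bound j l)"
      unfolding eigen_kernel_def
    proof (rule sum_mono)
      fix l assume "l \<in> {..<d j}"
      then have "\<bar>\<phi> j l x\<bar> * \<bar>\<phi> j l x\<bar> \<le> basis_bound j l * basis_bound j l"
        using phi_le_basis_bound basis_bound_nonneg by (intro mult_mono) auto
      then show "\<phi> j l x * \<phi> j l x \<le> basis_bound j l * basis_bound j l" by simp
    qed
  qed
qed simp

lemma score_event_sets:
  assumes J: "finite J" and [measurable]: "u \<in> borel_measurable \<nu>"
  shows "score_event \<nu> d \<phi> J lam u n \<in> sets (sample_law \<nu> u n)"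
proof -
  let ?L = "sample_law \<nu> u n"
  have phi: "(\<lambda>X. \<phi> j l (X i)) \<in> borel_measurable ?L" if "l < d j" "i < n" for j l i
    unfolding sample_law_def
    by (rule measurable_compose[OF measurable_component_singleton])
      (use that phi_measurable[OF that(1)] in \<open>simp_all add: measurable_cong_sets[OF sets_density refl]\<close>)
  have "(\<lambda>X. score_fluctuation \<nu> \<phi> u n X j l) \<in> borel_measurable ?L" if "l < d j" for j l
    unfolding score_fluctuation_def empirical_mean_def
    by (intro borel_measurable_diff borel_measurable_divide borel_measurable_sum
        borel_measurable_const phi) (use that in auto)
  then have "(\<lambda>X. sqrt (\<Sum>l<d j. (score_fluctuation \<nu> \<phi> u n X j l)\<^sup>2)) \<in> borel_measurable ?L" for j
    by (intro measurable_compose[OF _ borel_measurable_sqrt] borel_measurable_sum borel_measurable_power) auto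
  then have "{X \<in> space ?L. sqrt (\<Sum>l<d j. (score_fluctuation \<nu> \<phi> u n X j l)\<^sup>2) \<le> lam j} \<in> sets ?L" for j
    by (intro borel_measurable_le) auto
  then show ?thesis
    unfolding score_event_def by (intro sets.sets_Collect_finite_All J) auto
qed

text \<open>
  The loss is dominated by a function that is constant on the score event and on its
  complement; that function is measurable because the score event is.
\<close>
lemma expected_loss_le:
  assumes J: "finite J" and u [measurable]: "u \<in> borel_measurable \<nu>" "AE x in \<nu>. \<bar>u x\<bar> \<le> b"
    and c: "0 \<le> c" "0 \<le> c'"
    and on: "\<And>X. X \<in> score_event \<nu> d \<phi> J lam u n \<Longrightarrow> loss X \<le> c"
    and off: "\<And>X. loss X \<le> c'"
  shows "(\<integral>\<^sup>+X. ennreal (loss X) \<partial>sample_law \<nu> u n) \<le> ennreal (c + c' * failure_prob \<nu> d \<phi> J lam u n)"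
proof -
  let ?L = "sample_law \<nu> u n"
  interpret L: prob_space ?L by (rule prob_space_sample_law[OF u])
  define B where "B = space ?L - score_event \<nu> d \<phi> J lam u n"
  have B: "B \<in> sets ?L" unfolding B_def using score_event_sets[OF J u(1)] by auto
  have "(\<integral>\<^sup>+X. ennreal (loss X) \<partial>?L) \<le> (\<integral>\<^sup>+X. ennreal c + ennreal c' * indicator B X \<partial>?L)"
  proof (rule nn_integral_mono)
    fix X assume X: "X \<in> space ?L"
    show "ennreal (loss X) \<le> ennreal c + ennreal c' * indicator B X"
    proof (cases "X \<in> B")
      case True
      then show ?thesis using off[of X] by (simp add: ennreal_leI add_increasing)
    next
      case False
      then show ?thesis using X on[of X] by (simp add: B_def ennreal_leI)
    qed
  qed
  also have "\<dots> = ennreal c + ennreal c' * emeasure ?L B"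
    using B by (simp add: nn_integral_add nn_integral_cmult_indicator L.emeasure_space_1)
  also have "\<dots> = ennreal (c + c' * failure_prob \<nu> d \<phi> J lam u n)"
    using c by (simp add: failure_prob_def B_def[symmetric] L.emeasure_eq_measure ennreal_mult ennreal_plus)
  finally show ?thesis .
qed

end

section \<open>Laplace eigenspaces as an orthonormal system\<close>

text \<open>
  A single space \<open>V\<close> is the block with index \<open>0\<close> of an orthonormal system whose other blocks
  are trivial. This makes the projection formula available before orthogonality of different
  eigenspaces is known.
\<close>
lemma (in prob_space) proj_orthonormal_basis:
  fixes \<psi> :: "nat \<Rightarrow> 'a \<Rightarrow> real"
  assumes basis: "orthonormal_basis M V m \<psi>"
    and meas: "\<And>l. l < m \<Longrightarrow> \<psi> l \<in> borel_measurable M"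
    and bdd: "\<And>l. l < m \<Longrightarrow> \<exists>b. \<forall>x. \<bar>\<psi> l x\<bar> \<le> b"
    and f: "integrable M f"
  shows "proj M V f = (\<lambda>x. \<Sum>l<m. (\<integral>y. f y * \<psi> l y \<partial>M) * \<psi> l x)"
proof -
  interpret S: eigen_system M "\<lambda>k. if k = 0 then V else {\<lambda>x. 0}" "\<lambda>k. if k = 0 then m else 0" "\<lambda>_. \<psi>"
    using basis meas bdd
    by unfold_locales (auto simp: orthonormal_basis_def split: if_splits)
  show ?thesis
    using S.proj_eq_comb[OF f, of 0] by (simp add: S.comb_def[abs_def] S.coef_def)
qed

context laplace_spectral_setting
begin

lemma sets_nu: "sets \<nu> = sets borel"
  using volume by (auto simp: normalized_volume_def riemannian_volume_def)

lemma phi_mem_E: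
  assumes "l < d j"
  shows "\<phi> j l \<in> E j"
proof -
  have "\<phi> j l = (\<lambda>x. \<Sum>k<d j. (if k = l then 1 else 0) * \<phi> j k x)"
    using assms by (simp add: if_distrib[of "\<lambda>t. t * _"] cong: if_cong)
  then have "\<exists>a. \<phi> j l = (\<lambda>x. \<Sum>k<d j. a k * \<phi> j k x)"
    by (rule exI[of _ "\<lambda>k. if k = l then 1 else 0"])
  moreover have "E j = {f. \<exists>a. f = (\<lambda>x. \<Sum>k<d j. a k * \<phi> j k x)}"
    using basis[of j] by (simp add: orthonormal_basis_def)
  ultimately show ?thesis by simp
qed

lemma phi_continuous: "l < d j \<Longrightarrow> continuous_on UNIV (\<phi> j l)"
  using phi_mem_E[of l j] continuous_smooth_on_manifold[OF atlas]
  by (simp add: E_def eigenspace_def)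

lemma phi_borel: "l < d j \<Longrightarrow> \<phi> j l \<in> borel_measurable \<nu>"
  using borel_measurable_continuous_onI[OF phi_continuous] measurable_cong_sets[OF sets_nu refl] by blast

lemma phi_bdd: "l < d j \<Longrightarrow> \<exists>b. \<forall>x. \<bar>\<phi> j l x\<bar> \<le> b"
  using compact_imp_bounded[OF compact_continuous_image[OF phi_continuous compact_M]]
  by (auto simp: bounded_iff)

lemma phi_orthonormal_block:
  "k < d j \<Longrightarrow> l < d j \<Longrightarrow> (\<integral>x. \<phi> j k x * \<phi> j l x \<partial>\<nu>) = (if k = l then 1 else 0)"
  using basis[of j] by (simp add: orthonormal_basis_def)

lemma d_pos: "0 < d j"
proof (rule ccontr)
  assume "\<not> 0 < d j"
  then have "E j = {\<lambda>x. 0}" using basis[of j] by (simp add: orthonormal_basis_def)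
  moreover have "\<mu> j \<in> range \<mu>" by simp
  ultimately show False unfolding mu_eigenvalues using E_def by auto
qed

lemma mu_nonneg: "0 \<le> \<mu> j"
  using strict_mono_leD[OF mu_increasing, of 0 j] mu_0 by simp

text \<open>
  If the Riemannian volume were \<open>0\<close> or infinite, normalization would produce the zero measure,
  on which no function has norm \<open>1\<close>; but there is a normalized eigenfunction.
\<close>
lemma prob_space_nu: "prob_space \<nu>"
proof -
  obtain vol where vol: "sets vol = sets borel" "\<nu> = uniform_measure vol UNIV"
    using volume by (auto simp: normalized_volume_def riemannian_volume_def)
  have U: "UNIV \<in> sets vol" using vol(1) by simp
  have em: "emeasure \<nu> UNIV = emeasure vol UNIV / emeasure vol UNIV"
    using U by (simp add: vol(2))
  have "emeasure \<nu> UNIV \<noteq> 0"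
  proof
    assume "emeasure \<nu> UNIV = 0"
    then have "AE x in \<nu>. \<phi> 0 0 x * \<phi> 0 0 x = 0"
      by (intro AE_I[of _ _ UNIV]) (auto simp: sets_nu)
    then have "(\<integral>x. \<phi> 0 0 x * \<phi> 0 0 x \<partial>\<nu>) = 0" by (rule integral_eq_zero_AE)
    then show False using phi_orthonormal_block[of 0 0 0] d_pos[of 0] by simp
  qed
  then have "emeasure vol UNIV \<noteq> 0" "emeasure vol UNIV \<noteq> \<infinity>"
    unfolding em by (auto simp: divide_ennreal_def)
  then show ?thesis unfolding vol(2) by (intro prob_space_uniform_measure)
qed

lemma proj_E:
  assumes "integrable \<nu> f"
  shows "proj \<nu> (E j) f = (\<lambda>x. \<Sum>l<d j. (\<integral>y. f y * \<phi> j l y \<partial>\<nu>) * \<phi> j l x)"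
proof -
  interpret prob_space \<nu> by (rule prob_space_nu)
  show ?thesis by (rule proj_orthonormal_basis[OF basis phi_borel phi_bdd assms])
qed

text \<open>
  Expand a basis function \<open>f\<close> of \<open>E k\<close>. The block \<open>k\<close> already reproduces \<open>f\<close>, so the inner
  product of \<open>f\<close> with the residual is minus the sum of the squared coefficients in all the
  other blocks. It tends to \<open>0\<close> because the residuals do.
\<close>
lemma eigenspaces_orthogonal:
  assumes "j \<noteq> k" "l < d j" "m < d k"
  shows "(\<integral>x. \<phi> k m x * \<phi> j l x \<partial>\<nu>) = 0"
proof -
  interpret prob_space \<nu> by (rule prob_space_nu)
  note [measurable] = phi_borel[OF assms(3)]
  obtain b where b: "\<And>x. \<bar>\<phi> k m x\<bar> \<le> b" using phi_bdd[OF assms(3)] by blast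
  let ?f = "\<phi> k m"
  define c where "c i p = (\<integral>x. ?f x * \<phi> i p x \<partial>\<nu>)" for i p
  define P where "P i x = (\<Sum>p<d i. c i p * \<phi> i p x)" for i x
  define r where "r N x = ?f x - (\<Sum>i<N. P i x)" for N x
  have fi: "integrable \<nu> ?f" "integrable \<nu> (\<lambda>x. (?f x)\<^sup>2)"
    using integrable_AE_bounded[OF _ AE_I2[of \<nu> "\<lambda>x. \<bar>?f x\<bar> \<le> b"]] b by auto
  have fphi: "integrable \<nu> (\<lambda>x. ?f x * \<phi> i p x)" if p: "p < d i" for i p
  proof -
    obtain b' where b': "\<And>x. \<bar>\<phi> i p x\<bar> \<le> b'" using phi_bdd[OF p] by blast
    have "\<bar>?f x * \<phi> i p x\<bar> \<le> b * b'" for x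
      using b[of x] b'[of x] by (simp add: abs_mult mult_mono')
    then show ?thesis
      using phi_borel[OF p] by (intro integrable_AE_bounded(1)[of _ "b * b'"]) auto
  qed
  have fP: "integrable \<nu> (\<lambda>x. ?f x * P i x)" "(\<integral>x. ?f x * P i x \<partial>\<nu>) = (\<Sum>p<d i. (c i p)\<^sup>2)" for i
  proof -
    have e: "?f x * P i x = (\<Sum>p<d i. c i p * (?f x * \<phi> i p x))" for x
      by (simp add: P_def sum_distrib_left mult.left_commute)
    show "integrable \<nu> (\<lambda>x. ?f x * P i x)"
      unfolding e by (intro Bochner_Integration.integrable_sum integrable_mult_right fphi) auto
    have "(\<integral>x. ?f x * P i x \<partial>\<nu>) = (\<Sum>p<d i. \<integral>x. c i p * (?f x * \<phi> i p x) \<partial>\<nu>)"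
      unfolding e by (intro Bochner_Integration.integral_sum integrable_mult_right fphi) auto
    then show "(\<integral>x. ?f x * P i x \<partial>\<nu>) = (\<Sum>p<d i. (c i p)\<^sup>2)"
      by (simp add: c_def power2_eq_square)
  qed
  have Pm: "P i \<in> borel_measurable \<nu>" for i
    unfolding P_def[abs_def] using phi_borel by (intro borel_measurable_sum borel_measurable_times) auto
  have Pb: "\<exists>B. \<forall>x. \<bar>P i x\<bar> \<le> B" for i
  proof -
    have "continuous_on UNIV (P i)"
      unfolding P_def[abs_def] by (intro continuous_intros phi_continuous) auto
    then show ?thesis
      using compact_imp_bounded[OF compact_continuous_image[OF _ compact_M]] by (fastforce simp: bounded_iff)
  qed
  have rm [measurable]: "r N \<in> borel_measurable \<nu>" for N
    unfolding r_def[abs_def] using Pm by (intro borel_measurable_diff borel_measurable_sum) auto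
  have ri: "integrable \<nu> (\<lambda>x. (r N x)\<^sup>2)" for N
  proof -
    obtain B where B: "\<And>i x. \<bar>P i x\<bar> \<le> B i" using Pb by metis
    have "\<bar>r N x\<bar> \<le> b + (\<Sum>i<N. B i)" for x
    proof -
      have "\<bar>\<Sum>i<N. P i x\<bar> \<le> (\<Sum>i<N. B i)"
        by (rule order_trans[OF sum_abs]) (intro sum_mono B)
      then show ?thesis using b[of x] unfolding r_def by linarith
    qed
    then show ?thesis by (intro integrable_AE_bounded(2)[of _ "b + (\<Sum>i<N. B i)"]) auto
  qed
  have fL2: "?f \<in> L2_space \<nu>" using fi by (simp add: L2_space_def)
  have "(\<lambda>N. L2_norm \<nu> (r N)) \<longlonglongrightarrow> 0"
    using spectral_theorem[OF fL2] by (simp add: proj_E[OF fi(1)] r_def[abs_def] P_def c_def)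
  then have "(\<lambda>N. (L2_norm \<nu> (r N))\<^sup>2) \<longlonglongrightarrow> 0\<^sup>2" by (rule tendsto_power)
  then have "(\<lambda>N. b\<^sup>2 * (L2_norm \<nu> (r N))\<^sup>2) \<longlonglongrightarrow> b\<^sup>2 * 0\<^sup>2" by (rule tendsto_mult_left)
  then have lim: "(\<lambda>N. b\<^sup>2 * (\<integral>x. (r N x)\<^sup>2 \<partial>\<nu>)) \<longlonglongrightarrow> 0" by (simp add: L2_norm_def)
  have ck: "(\<Sum>p<d k. (c k p)\<^sup>2) = 1"
  proof -
    have "(\<Sum>p<d k. (c k p)\<^sup>2) = (\<Sum>p<d k. if p = m then 1 else 0)"
      unfolding c_def using phi_orthonormal_block[OF assms(3)] by (intro sum.cong) auto
    then show ?thesis using assms(3) by simp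
  qed
  have "((c j l)\<^sup>2)\<^sup>2 \<le> b\<^sup>2 * (\<integral>x. (r N x)\<^sup>2 \<partial>\<nu>)" if N: "N > j" "N > k" for N
  proof -
    have fr: "?f x * r N x = ?f x * ?f x - (\<Sum>i<N. ?f x * P i x)" for x
      by (simp add: r_def right_diff_distrib sum_distrib_left)
    have ifr: "integrable \<nu> (\<lambda>x. ?f x * r N x)"
      unfolding fr using fi(2) fP(1) by (auto simp: power2_eq_square)
    \<comment> \<open>the square of the inner product is bounded by Jensen, using that the basis function is bounded\<close>
    have ptw: "(?f x * r N x)\<^sup>2 \<le> b\<^sup>2 * (r N x)\<^sup>2" for x
      unfolding power_mult_distrib using power_mono[OF b[of x], of 2]
      by (intro mult_right_mono) auto
    have ifr2: "integrable \<nu> (\<lambda>x. (?f x * r N x)\<^sup>2)"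
    proof (rule Bochner_Integration.integrable_bound[of _ "\<lambda>x. b\<^sup>2 * (r N x)\<^sup>2"])
      show "AE x in \<nu>. norm ((?f x * r N x)\<^sup>2) \<le> norm (b\<^sup>2 * (r N x)\<^sup>2)"
        using ptw by simp
    qed (use ri in auto)
    have "(\<integral>x. ?f x * r N x \<partial>\<nu>) = 1 - (\<Sum>i<N. \<Sum>p<d i. (c i p)\<^sup>2)"
      unfolding fr using fi(2) fP phi_orthonormal_block[OF assms(3,3)] by (simp add: power2_eq_square)
    also have "(\<Sum>i<N. \<Sum>p<d i. (c i p)\<^sup>2) = (\<Sum>p<d k. (c k p)\<^sup>2) + (\<Sum>i\<in>{..<N} - {k}. \<Sum>p<d i. (c i p)\<^sup>2)"
      using N by (intro sum.remove) auto
    finally have e: "(\<integral>x. ?f x * r N x \<partial>\<nu>) = - (\<Sum>i\<in>{..<N} - {k}. \<Sum>p<d i. (c i p)\<^sup>2)"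
      unfolding ck by simp
    have "(c j l)\<^sup>2 \<le> (\<Sum>p<d j. (c j p)\<^sup>2)"
      using assms(2) by (intro member_le_sum) auto
    also have "\<dots> \<le> (\<Sum>i\<in>{..<N} - {k}. \<Sum>p<d i. (c i p)\<^sup>2)"
      using assms(1) N by (intro member_le_sum[where f = "\<lambda>i. \<Sum>p<d i. (c i p)\<^sup>2"] sum_nonneg) auto
    finally have "((c j l)\<^sup>2)\<^sup>2 \<le> (\<integral>x. ?f x * r N x \<partial>\<nu>)\<^sup>2"
      unfolding e power2_minus by (intro power_mono) auto
    also have "\<dots> \<le> (\<integral>x. (?f x * r N x)\<^sup>2 \<partial>\<nu>)"
      by (rule square_integral_le[OF ifr ifr2])
    also have "\<dots> \<le> (\<integral>x. b\<^sup>2 * (r N x)\<^sup>2 \<partial>\<nu>)"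
    proof (rule integral_mono[OF ifr2])
      show "(?f x * r N x)\<^sup>2 \<le> b\<^sup>2 * (r N x)\<^sup>2" for x by (rule ptw)
    qed (use ri in auto)
    finally show ?thesis by simp
  qed
  then have "((c j l)\<^sup>2)\<^sup>2 \<le> 0"
    by (intro LIMSEQ_le_const[OF lim]) (auto intro!: exI[of _ "Suc (max j k)"])
  then show ?thesis by (simp add: c_def)
qed

lemma eigen_system_nu: "eigen_system \<nu> E d \<phi>"
proof -
  interpret prob_space \<nu> by (rule prob_space_nu)
  show ?thesis
  proof
    show "E j = {f. \<exists>a. f = (\<lambda>x. \<Sum>l<d j. a l * \<phi> j l x)}" for j
      using basis[of j] by (simp add: orthonormal_basis_def)
    show "(\<integral>x. \<phi> j l x * \<phi> k m x \<partial>\<nu>) = (if j = k \<and> l = m then 1 else 0)"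
      if "l < d j" "m < d k" for j k l m
      using that phi_orthonormal_block[of l j m] eigenspaces_orthogonal[of k j m l] by (cases "j = k") auto
  qed (use phi_borel phi_bdd in auto)
qed

sublocale eigen_system \<nu> E d \<phi> by (rule eigen_system_nu)

lemma E_0_eq_constants: "E 0 = {f. \<exists>k. f = (\<lambda>x. k)}"
  using harmonic_constant[OF compact_M connected_M atlas metric] constant_in_eigenspace_0
  by (auto simp: E_def mu_0)

text \<open>
  Constants lie in \<open>E 0\<close>, which is orthogonal to the other eigenspaces.
\<close>
lemma phi_mean_zero:
  assumes "1 \<le> j" "l < d j"
  shows "(\<integral>x. \<phi> j l x \<partial>\<nu>) = 0"
proof -
  have "(\<lambda>x. 1) \<in> E 0" by (auto simp: E_0_eq_constants)
  then obtain a where a: "(\<lambda>x. 1) = (\<lambda>x. \<Sum>p<d 0. a p * \<phi> 0 p x)" using E_span[of 0] by auto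
  have "comb {0} (\<lambda>_. a) x = 1" for x using fun_cong[OF a, of x] by (simp add: comb_def)
  then have "(\<integral>x. \<phi> j l x * 1 \<partial>\<nu>) = (\<integral>x. \<phi> j l x * comb {0} (\<lambda>_. a) x \<partial>\<nu>)"
    by simp
  also have "\<dots> = (\<Sum>p<d 0. a p * coef (\<phi> j l) 0 p)"
    by (simp add: integral_mult_comb(2)[OF integrable_phi[OF assms(2)]])
  also have "\<dots> = 0"
    using assms orthonormal[of l j _ 0] by (intro sum.neutral) (auto simp: coef_def)
  finally show ?thesis by simp
qed

lemma block_norm_0_of_mean_zero:
  assumes "(\<integral>x. f x \<partial>\<nu>) = 0"
  shows "block_norm (coef f) 0 = 0"
proof -
  have "coef f 0 l = 0" if l: "l < d 0" for l
  proof -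
    obtain k where "\<phi> 0 l = (\<lambda>x. k)" using phi_mem_E[OF l] by (auto simp: E_0_eq_constants)
    then show ?thesis using assms by (simp add: coef_def)
  qed
  then show ?thesis by (simp add: block_norm_def L2_set_def)
qed

end

section \<open>Risk bounds\<close>

text \<open>
  The constant of the oracle inequality times the constant of the balanced bound, for sieve
  radius \<open>b\<close>.
\<close>
definition oracle_const :: "real \<Rightarrow> real \<Rightarrow> real \<Rightarrow> real \<Rightarrow> real \<Rightarrow> real \<Rightarrow> real" where
  "oracle_const b q \<gamma> Cd CD Clam
    = 200 * exp (4 * b) * (1 + \<bar>Clam * CD\<bar> + sqrt \<bar>Clam * Cd\<bar> * 2 powr (\<bar>q - \<gamma>\<bar> / 2))"

lemma oracle_const_nonneg: "0 \<le> oracle_const b q \<gamma> Cd CD Clam"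
  by (simp add: oracle_const_def)

context laplace_spectral_setting
begin

lemma log_classD:
  assumes "u \<in> log_class \<nu> \<mu> E q R B"
  shows "u \<in> L2_space \<nu>" and "u \<in> borel_measurable \<nu>" and "(\<integral>x. u x \<partial>\<nu>) = 0"
    and "AE x in \<nu>. \<bar>u x\<bar> \<le> B"
  using assms by (auto simp: log_class_def L2_space_def Linf_norm_le_iff)

lemma log_class_weighted_sum_le:
  assumes u: "u \<in> log_class \<nu> \<mu> E q R B" and F: "finite F" and R: "0 \<le> R"
  shows "(\<Sum>j\<in>F. (1 + \<mu> j) powr (q / 2) * block_norm (coef u) j) \<le> R"
proof -
  let ?s = "\<lambda>j. (1 + \<mu> j) powr (q / 2) * block_norm (coef u) j"
  have "ennreal (\<Sum>j\<in>F. ?s j) = (\<Sum>j\<in>F. ennreal (?s j))"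
    by (simp add: sum_ennreal)
  also have "\<dots> \<le> (\<Sum>j. ennreal (?s j))"
    by (rule sum_le_suminf) (use F in auto)
  also have "\<dots> = spectral_norm \<nu> \<mu> E q u"
    by (simp add: spectral_norm_def L2_norm_proj[OF L2_integrable[OF log_classD(1)[OF u]]])
  also have "\<dots> \<le> ennreal R" using u by (simp add: log_class_def)
  finally show ?thesis using R by (simp add: ennreal_le_iff)
qed

text \<open>
  A block of norm \<open>t\<close> is at most \<open>t\<close> times the square root of the kernel on the diagonal,
  which grows no faster than the weight \<open>(1 + \<mu>\<^sub>j)\<^sup>q\<^sup>/\<^sup>2\<close>. This places the comparison
  functions in the sieve.
\<close>
lemma projection_sup_le:
  assumes u: "u \<in> log_class \<nu> \<mu> E q R B" and K: "finite K" "0 \<notin> K" and R: "0 \<le> R"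
    and kap: "\<And>j. 1 \<le> j \<Longrightarrow> (SUP x. eigen_kernel d \<phi> j x x) \<le> Ckap * (1 + \<mu> j) powr \<beta>"
    and \<beta>: "\<beta> \<le> q"
  shows "\<bar>comb K (coef u) x\<bar> \<le> sqrt Ckap * R"
proof -
  have Ckap: "0 \<le> Ckap"
  proof -
    have "0 \<le> eigen_kernel d \<phi> 1 x x" by (simp add: eigen_kernel_def sum_nonneg)
    also have "\<dots> \<le> (SUP x. eigen_kernel d \<phi> 1 x x)" by (rule eigen_kernel_le_SUP)
    also have "\<dots> \<le> Ckap * (1 + \<mu> 1) powr \<beta>" by (rule kap) simp
    finally show ?thesis using mu_nonneg[of 1] by (simp add: zero_le_mult_iff)
  qed
  have "\<bar>comb K (coef u) x\<bar> \<le> (\<Sum>j\<in>K. block_norm (coef u) j * sqrt (eigen_kernel d \<phi> j x x))"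
    by (rule comb_abs_le_kernel)
  also have "\<dots> \<le> (\<Sum>j\<in>K. sqrt Ckap * ((1 + \<mu> j) powr (q / 2) * block_norm (coef u) j))"
  proof (rule sum_mono)
    fix j assume "j \<in> K"
    then have j: "1 \<le> j" using K by (cases j) auto
    have "eigen_kernel d \<phi> j x x \<le> Ckap * (1 + \<mu> j) powr \<beta>"
      using eigen_kernel_le_SUP kap[OF j] by (rule order_trans)
    also have "\<dots> \<le> Ckap * (1 + \<mu> j) powr q"
      using mu_nonneg[of j] \<beta> Ckap by (intro mult_left_mono powr_mono) auto
    also have "(1 + \<mu> j) powr q = ((1 + \<mu> j) powr (q / 2))\<^sup>2"
      using mu_nonneg[of j] by (simp add: power2_eq_square flip: powr_add)
    finally have "sqrt (eigen_kernel d \<phi> j x x) \<le> sqrt (Ckap * ((1 + \<mu> j) powr (q / 2))\<^sup>2)"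
      by simp
    then have "sqrt (eigen_kernel d \<phi> j x x) \<le> sqrt Ckap * (1 + \<mu> j) powr (q / 2)"
      by (simp add: real_sqrt_mult)
    from mult_left_mono[OF this block_norm_nonneg[of "coef u" j]]
    show "block_norm (coef u) j * sqrt (eigen_kernel d \<phi> j x x)
        \<le> sqrt Ckap * ((1 + \<mu> j) powr (q / 2) * block_norm (coef u) j)"
      by (simp add: mult_ac)
  qed
  also have "\<dots> = sqrt Ckap * (\<Sum>j\<in>K. (1 + \<mu> j) powr (q / 2) * block_norm (coef u) j)"
    by (simp add: sum_distrib_left)
  also have "\<dots> \<le> sqrt Ckap * R"
    using log_class_weighted_sum_le[OF u K(1) R] Ckap by (intro mult_left_mono) auto
  finally show ?thesis .
qed

lemma finite_spectral_cutoff: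
  assumes "\<And>\<Lambda>. 1 \<le> \<Lambda> \<Longrightarrow> finite {j. 1 \<le> j \<and> \<mu> j \<le> \<Lambda>}"
  shows "finite (spectral_cutoff \<mu> \<Lambda>)"
  by (rule finite_subset[OF _ assms[of "max 1 \<Lambda>"]]) (auto simp: spectral_cutoff_def)

text \<open>
  A frequency outside the comparison set \<open>K\<close> is \<open>0\<close>, where the mean-zero condition removes it,
  or beyond the cutoff, where the bias assumption applies, or beyond the balancing threshold.
\<close>
lemma KL_le_rate_on_score_event:
  assumes par: "\<alpha> \<ge> 0" "\<gamma> \<ge> 0" "q > 0" "R > 0" "\<delta> > 0" "\<Lambda> > -1"
    and dj: "\<And>j. 1 \<le> j \<Longrightarrow> real (d j) \<le> Cd * (1 + \<mu> j) powr \<gamma>"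
    and fin: "\<And>\<Lambda>. 1 \<le> \<Lambda> \<Longrightarrow> finite {j. 1 \<le> j \<and> \<mu> j \<le> \<Lambda>}"
    and dim: "\<And>\<Lambda>. 1 \<le> \<Lambda> \<Longrightarrow> (\<Sum>j | 1 \<le> j \<and> \<mu> j \<le> \<Lambda>. real (d j)) \<le> CD * (1 + \<Lambda>) powr (\<alpha> + \<gamma>)"
    and kap: "\<And>j. 1 \<le> j \<Longrightarrow> (SUP x. eigen_kernel d \<phi> j x x) \<le> Ckap * (1 + \<mu> j) powr \<beta>"
    and \<beta>: "\<beta> \<le> q"
    and b: "B \<le> b" "sqrt Ckap * R \<le> b" "0 \<le> b"
    and lam0: "\<And>j. j \<in> spectral_cutoff \<mu> \<Lambda> \<Longrightarrow> 0 < lam j"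
    and lam2: "\<And>j. j \<in> spectral_cutoff \<mu> \<Lambda> \<Longrightarrow> (lam j)\<^sup>2 \<le> Clam * \<delta> * real (d j)"
    and bias: "R\<^sup>2 * (1 + \<Lambda>) powr (- q) \<le> rate \<alpha> \<gamma> q R \<delta>"
    and u: "u \<in> log_class \<nu> \<mu> E q R B"
    and X: "X \<in> score_event \<nu> d \<phi> (spectral_cutoff \<mu> \<Lambda>) lam u n"
  shows "KL_div \<nu> (exp_density \<nu> u) (sieve_density \<nu> E (spectral_cutoff \<mu> \<Lambda>) b lam n X)
    \<le> oracle_const b q \<gamma> Cd CD Clam * rate \<alpha> \<gamma> q R \<delta>"
proof -
  let ?J = "spectral_cutoff \<mu> \<Lambda>" and ?\<rho> = "rate \<alpha> \<gamma> q R \<delta>"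
  have J: "finite ?J" by (rule finite_spectral_cutoff[OF fin])
  have J1: "1 \<le> j" if "j \<in> ?J" for j using that by (simp add: spectral_cutoff_def)
  note ws = log_class_weighted_sum_le[OF u _ less_imp_le[OF par(4)]]
  have "\<exists>K S. S \<subseteq> K \<and> K \<subseteq> ?J \<and> (\<forall>j\<in>?J - K. R\<^sup>2 * (1 + \<mu> j) powr (- q) \<le> ?\<rho>) \<and>
    (\<Sum>j\<in>S. (lam j)\<^sup>2) + (\<Sum>j\<in>K - S. lam j * block_norm (coef u) j)
      \<le> (\<bar>Clam * CD\<bar> + sqrt \<bar>Clam * Cd\<bar> * 2 powr (\<bar>q - \<gamma>\<bar> / 2)) * ?\<rho>"
  proof (rule rate_balancing_cutoff[where d = "\<lambda>j. real (d j)", OF par(1-5) J])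
    show "(\<Sum>j | j \<in> ?J \<and> \<mu> j \<le> \<Lambda>'. real (d j)) \<le> CD * (1 + \<Lambda>') powr (\<alpha> + \<gamma>)" if "1 \<le> \<Lambda>'" for \<Lambda>'
    proof -
      have "(\<Sum>j | j \<in> ?J \<and> \<mu> j \<le> \<Lambda>'. real (d j)) \<le> (\<Sum>j | 1 \<le> j \<and> \<mu> j \<le> \<Lambda>'. real (d j))"
        using fin[OF that] J1 by (intro sum_mono2) auto
      then show ?thesis using dim[OF that] by linarith
    qed
  qed (use mu_nonneg dj J1 lam2 ws[OF J] in auto)
  then obtain K S where S: "S \<subseteq> K" and K: "K \<subseteq> ?J"
    and small: "\<And>j. j \<in> ?J - K \<Longrightarrow> R\<^sup>2 * (1 + \<mu> j) powr (- q) \<le> ?\<rho>"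
    and est: "(\<Sum>j\<in>S. (lam j)\<^sup>2) + (\<Sum>j\<in>K - S. lam j * block_norm (coef u) j)
      \<le> (\<bar>Clam * CD\<bar> + sqrt \<bar>Clam * Cd\<bar> * 2 powr (\<bar>q - \<gamma>\<bar> / 2)) * ?\<rho>"
    by blast
  have finK: "finite K" using finite_subset[OF K J] .
  have zK: "0 \<notin> K" using K J1 by force
  have \<rho>: "0 \<le> ?\<rho>" by (simp add: rate_def)
  have D: "(\<integral>x. (u x - comb K (coef u) x)\<^sup>2 \<partial>\<nu>) \<le> ?\<rho>"
  proof (rule residual_sq_le_tail[OF log_classD(1)[OF u] finK])
    have ui: "integrable \<nu> u" by (rule L2_integrable[OF log_classD(1)[OF u]])
    have "(\<Sum>j<N. proj \<nu> (E j) u x) = comb {..<N} (coef u) x" for N x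
      by (simp add: proj_eq_comb[OF ui] comb_def)
    then show "(\<lambda>N. L2_norm \<nu> (\<lambda>x. u x - comb {..<N} (coef u) x)) \<longlonglongrightarrow> 0"
      using spectral_theorem[OF log_classD(1)[OF u]] by simp
  next
    fix F assume F: "finite F" "F \<inter> K = {}"
    have tail: "R\<^sup>2 * (1 + \<mu> j) powr (- q) \<le> ?\<rho>" if j: "j \<in> F - {0}" for j
    proof (cases "j \<in> ?J")
      case True
      then show ?thesis using small[of j] j F by auto
    next
      case False
      then have "\<Lambda> < \<mu> j" using j by (auto simp: spectral_cutoff_def)
      then have "R\<^sup>2 * (1 + \<mu> j) powr (- q) \<le> R\<^sup>2 * (1 + \<Lambda>) powr (- q)"
        using par by (intro mult_left_mono powr_mono2') auto
      then show ?thesis using bias by linarith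
    qed
    have "(\<Sum>j\<in>F. (block_norm (coef u) j)\<^sup>2) = (\<Sum>j\<in>F - {0}. (block_norm (coef u) j)\<^sup>2)"
      using F block_norm_0_of_mean_zero[OF log_classD(3)[OF u]] by (intro sum.mono_neutral_right) auto
    also have "\<dots> \<le> ?\<rho>"
      by (rule sum_squares_le_of_weighted_sum[where m = \<mu> and q = q and R = R])
         (use F par mu_nonneg tail ws \<rho> in auto)
    finally show "(\<Sum>j\<in>F. (block_norm (coef u) j)\<^sup>2) \<le> ?\<rho>" .
  qed
  have "KL_div \<nu> (exp_density \<nu> u) (sieve_density \<nu> E ?J b lam n X)
    \<le> 200 * exp (4 * b) * ((\<integral>x. (u x - comb K (coef u) x)\<^sup>2 \<partial>\<nu>)
        + (\<Sum>j\<in>S. (lam j)\<^sup>2) + (\<Sum>j\<in>K - S. lam j * block_norm (coef u) j))"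
  proof (rule sieve_oracle_inequality[OF J b(3) _ _ log_classD(2)[OF u] _ log_classD(3)[OF u] _ K S])
    show "(\<integral>x. \<phi> j l x \<partial>\<nu>) = 0" if "j \<in> ?J" "l < d j" for j l
      using phi_mean_zero[OF J1] that by blast
    show "0 \<le> lam j" if "j \<in> ?J" for j using lam0[OF that] by simp
    show "AE x in \<nu>. \<bar>u x\<bar> \<le> b"
      using log_classD(4)[OF u] by eventually_elim (use b in linarith)
    show "sqrt (\<Sum>l<d j. (score_fluctuation \<nu> \<phi> u n X j l)\<^sup>2) \<le> lam j" if "j \<in> ?J" for j
      using X that by (simp add: score_event_def)
    show "AE x in \<nu>. \<bar>comb K (coef u) x\<bar> \<le> b"
      using projection_sup_le[OF u finK zK less_imp_le[OF par(4)] kap \<beta>] b(2)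
      by (intro AE_I2) (meson order_trans)
  qed
  also have "\<dots> \<le> 200 * exp (4 * b) * (?\<rho>
      + (\<bar>Clam * CD\<bar> + sqrt \<bar>Clam * Cd\<bar> * 2 powr (\<bar>q - \<gamma>\<bar> / 2)) * ?\<rho>)"
    using D est by (intro mult_left_mono) auto
  also have "\<dots> = oracle_const b q \<gamma> Cd CD Clam * ?\<rho>"
    by (simp add: oracle_const_def algebra_simps)
  finally show ?thesis .
qed

lemma losses_le_KL:
  fixes n :: nat and X :: "nat \<Rightarrow> 'm"
  assumes J: "finite J" "0 \<notin> J" and lam0: "\<And>j. j \<in> J \<Longrightarrow> 0 \<le> lam j" and b: "0 \<le> b"
    and u: "u \<in> borel_measurable \<nu>" "AE x in \<nu>. \<bar>u x\<bar> \<le> b"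
  defines "p \<equiv> exp_density \<nu> u" and "r \<equiv> sieve_density \<nu> E J b lam n X"
  shows "KL_div \<nu> p r \<le> 4 * b" and "0 \<le> KL_div \<nu> p r"
    and "hellinger_sq \<nu> r p \<le> KL_div \<nu> p r"
    and "L2_dist_sq \<nu> r p \<le> 4 * exp (2 * b) * KL_div \<nu> p r"
proof -
  have mean: "(\<integral>x. \<phi> j l x \<partial>\<nu>) = 0" if "j \<in> J" "l < d j" for j l
    using phi_mean_zero[of j l] that J by (cases j) auto
  obtain a where a: "sieve_estimator \<nu> E J b lam n X = comb J a" "AE x in \<nu>. \<bar>comb J a x\<bar> \<le> b"
    using sieve_estimator_minimizes(1)[of J b lam n X, OF J(1) b mean lam0]
    unfolding sieve_eq[OF J(1)] by blast
  have r: "r = exp_density \<nu> (comb J a)" by (simp add: r_def sieve_density_def a)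
  have sym: "hellinger_sq \<nu> r p = hellinger_sq \<nu> p r" "L2_dist_sq \<nu> r p = L2_dist_sq \<nu> p r"
    unfolding hellinger_sq_def L2_dist_sq_def L2_norm_def
    by (subst power2_commute, rule refl)+
  have H: "2 * hellinger_sq \<nu> p r \<le> KL_div \<nu> p r"
    unfolding p_def r by (rule hellinger_le_KL[OF u(1) comb_measurable u(2) a(2)])
  have H0: "0 \<le> hellinger_sq \<nu> p r" by (simp add: hellinger_sq_def)
  show "KL_div \<nu> p r \<le> 4 * b"
    unfolding p_def r by (rule KL_div_le_oscillation[OF u(1) comb_measurable u(2) a(2)])
  show "0 \<le> KL_div \<nu> p r" "hellinger_sq \<nu> r p \<le> KL_div \<nu> p r"
    using H H0 by (simp_all add: sym)
  have "L2_dist_sq \<nu> p r \<le> 8 * exp (2 * b) * hellinger_sq \<nu> p r"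
    unfolding p_def r by (rule L2_dist_le_hellinger[OF u(1) comb_measurable u(2) a(2)])
  also have "\<dots> = 4 * exp (2 * b) * (2 * hellinger_sq \<nu> p r)" by simp
  also have "\<dots> \<le> 4 * exp (2 * b) * KL_div \<nu> p r" using H by (intro mult_left_mono) auto
  finally show "L2_dist_sq \<nu> r p \<le> 4 * exp (2 * b) * KL_div \<nu> p r" by (simp add: sym)
qed

lemma failure_prob_le_SUP:
  assumes "u \<in> log_class \<nu> \<mu> E q R B"
  shows "failure_prob \<nu> d \<phi> J lam u n \<le> (SUP u0\<in>log_class \<nu> \<mu> E q R B. failure_prob \<nu> d \<phi> J lam u0 n)"
proof (rule cSUP_upper[OF assms], rule bdd_aboveI2)
  fix u0 assume u0: "u0 \<in> log_class \<nu> \<mu> E q R B"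
  interpret L: prob_space "sample_law \<nu> u0 n"
    by (rule prob_space_sample_law[OF log_classD(2,4)[OF u0]])
  show "failure_prob \<nu> d \<phi> J lam u0 n \<le> 1" unfolding failure_prob_def by (rule L.prob_le_1)
qed

end

theorem corollary5p2:
  fixes Bstar q \<alpha> \<gamma> Cd CD Clam Ckap :: real
  assumes "\<alpha> \<ge> 0" and "\<gamma> \<ge> 0" and "q > 0"
  shows "\<exists>C>0. \<forall>(\<A> :: ('m::{t2_space, second_countable_topology}, 'n::finite) chart set)
      (g :: ('m, 'n) chart \<Rightarrow> real^'n \<Rightarrow> real^'n^'n) (\<nu> :: 'm measure) (\<mu> :: nat \<Rightarrow> real)
      (E :: nat \<Rightarrow> ('m \<Rightarrow> real) set) (d :: nat \<Rightarrow> nat) (\<phi> :: nat \<Rightarrow> nat \<Rightarrow> 'm \<Rightarrow> real)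
      (\<beta> :: real) (R :: real) (B :: real)
      (\<Lambda>max :: nat \<Rightarrow> real) (\<delta> :: nat \<Rightarrow> real) (lam :: nat \<Rightarrow> nat \<Rightarrow> real).
      laplace_spectral_setting \<A> g \<nu> \<mu> E d \<phi> \<and>
      (\<forall>j\<ge>1. real (d j) \<le> Cd * (1 + \<mu> j) powr \<gamma>) \<and>
      (\<forall>\<Lambda>\<ge>1. finite {j. 1 \<le> j \<and> \<mu> j \<le> \<Lambda>} \<and>
          (\<Sum>j | 1 \<le> j \<and> \<mu> j \<le> \<Lambda>. real (d j)) \<le> CD * (1 + \<Lambda>) powr (\<alpha> + \<gamma>)) \<and>
      \<beta> \<ge> 0 \<and>
      (\<forall>j\<ge>1. (SUP x. eigen_kernel d \<phi> j x x) \<le> Ckap * (1 + \<mu> j) powr \<beta>) \<and>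
      q \<ge> \<beta> \<and> R > 0 \<and> B > 0 \<and> Bstar \<ge> max B (sqrt Ckap * R) \<and>
      (\<forall>n\<ge>1. \<Lambda>max n > - 1 \<and> \<delta> n > 0 \<and>
          (\<forall>j\<in>spectral_cutoff \<mu> (\<Lambda>max n). lam n j > 0 \<and> (lam n j)\<^sup>2 \<le> Clam * \<delta> n * real (d j)) \<and>
          R\<^sup>2 * (1 + \<Lambda>max n) powr (- q) \<le> rate \<alpha> \<gamma> q R (\<delta> n)) \<and>
      (\<lambda>n. SUP u0\<in>log_class \<nu> \<mu> E q R B.
          failure_prob \<nu> d \<phi> (spectral_cutoff \<mu> (\<Lambda>max n)) (lam n) u0 n)
        \<in> o(\<lambda>n. rate \<alpha> \<gamma> q R (\<delta> n))
      \<longrightarrow>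
      (\<forall>\<^sub>F n in sequentially.
        (let phat = sieve_density \<nu> E (spectral_cutoff \<mu> (\<Lambda>max n)) Bstar (lam n) n;
             \<U> = log_class \<nu> \<mu> E q R B;
             bound = ennreal (C * rate \<alpha> \<gamma> q R (\<delta> n))
         in worst_case_risk \<nu> \<U> n (\<lambda>p X. KL_div \<nu> p (phat X)) \<le> bound \<and>
            worst_case_risk \<nu> \<U> n (\<lambda>p X. hellinger_sq \<nu> (phat X) p) \<le> bound \<and>
            worst_case_risk \<nu> \<U> n (\<lambda>p X. L2_dist_sq \<nu> (phat X) p) \<le> bound))"
proof -
  define \<kappa> where "\<kappa> = 4 * exp (2 * \<bar>Bstar\<bar>)"
  define C1 where "C1 = oracle_const \<bar>Bstar\<bar> q \<gamma> Cd CD Clam"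
  \<comment> \<open>the factor \<open>\<kappa>\<close> converts divergence to every loss, the middle term pays for the failure event, and the last keeps \<open>C\<close> positive\<close>
  define C where "C = \<kappa> * C1 + \<kappa> * (4 * \<bar>Bstar\<bar>) + 1"
  have \<kappa>: "1 \<le> \<kappa>" using one_le_exp_iff[of "2 * \<bar>Bstar\<bar>"] unfolding \<kappa>_def by linarith
  have C1: "0 \<le> C1" unfolding C1_def by (rule oracle_const_nonneg)
  have C: "C > 0" unfolding C_def using \<kappa> C1 by (intro add_nonneg_pos add_nonneg_nonneg mult_nonneg_nonneg) auto
  show ?thesis
  proof (intro exI[of _ C] conjI C allI impI, elim conjE, goal_cases)
    case (1 \<A> g \<nu> \<mu> E d \<phi> \<beta> R B \<Lambda>max \<delta> lam)
    note H = 1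
    interpret laplace_spectral_setting \<A> g \<nu> \<mu> E d \<phi> by (rule H)
    let ?U = "log_class \<nu> \<mu> E q R B"
    let ?\<rho> = "\<lambda>n. rate \<alpha> \<gamma> q R (\<delta> n)" and ?J = "\<lambda>n. spectral_cutoff \<mu> (\<Lambda>max n)"
    have b: "B \<le> Bstar" "sqrt Ckap * R \<le> Bstar" "0 < Bstar" using H by auto
    have fin: "finite {j. 1 \<le> j \<and> \<mu> j \<le> \<Lambda>}" if "1 \<le> \<Lambda>" for \<Lambda> using H that by blast
    have fail: "\<forall>\<^sub>F n in sequentially.
        norm (SUP u0\<in>?U. failure_prob \<nu> d \<phi> (?J n) (lam n) u0 n) \<le> 1 * norm (?\<rho> n)"
      using H by (intro landau_o.smallD) auto
    show ?case
      using fail eventually_ge_at_top[of 1]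
    proof eventually_elim
      case (elim n)
      have J: "finite (?J n)" "0 \<notin> ?J n"
        using finite_spectral_cutoff[OF fin] by (auto simp: spectral_cutoff_def)
      have Hn: "\<Lambda>max n > - 1" "\<delta> n > 0" "R\<^sup>2 * (1 + \<Lambda>max n) powr (- q) \<le> ?\<rho> n"
        and lam0: "\<And>j. j \<in> ?J n \<Longrightarrow> 0 < lam n j"
        and lam2: "\<And>j. j \<in> ?J n \<Longrightarrow> (lam n j)\<^sup>2 \<le> Clam * \<delta> n * real (d j)"
        using H elim(2) by blast+
      have \<rho>: "0 \<le> ?\<rho> n" by (simp add: rate_def)
      let ?phat = "sieve_density \<nu> E (?J n) Bstar (lam n) n"
      have risk: "worst_case_risk \<nu> ?U n loss \<le> ennreal (C * ?\<rho> n)"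
        if loss: "\<And>u X. u \<in> ?U \<Longrightarrow> loss (exp_density \<nu> u) X \<le> \<kappa> * KL_div \<nu> (exp_density \<nu> u) (?phat X)" for loss
        unfolding worst_case_risk_def
      proof (rule SUP_least)
        fix u assume u: "u \<in> ?U"
        have ub: "AE x in \<nu>. \<bar>u x\<bar> \<le> Bstar"
          using log_classD(4)[OF u] by eventually_elim (use b in linarith)
        have "(\<integral>\<^sup>+X. ennreal (loss (exp_density \<nu> u) X) \<partial>sample_law \<nu> u n)
          \<le> ennreal (\<kappa> * (C1 * ?\<rho> n) + \<kappa> * (4 * Bstar) * failure_prob \<nu> d \<phi> (?J n) (lam n) u n)"
        proof (rule expected_loss_le[OF J(1) log_classD(2)[OF u] ub])
          fix X assume X: "X \<in> score_event \<nu> d \<phi> (?J n) (lam n) u n"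
          have "KL_div \<nu> (exp_density \<nu> u) (?phat X) \<le> oracle_const Bstar q \<gamma> Cd CD Clam * ?\<rho> n"
            by (rule KL_le_rate_on_score_event[OF assms(1,2,3) _ Hn(2,1) _ fin _ _ _ b(1,2) _ lam0 lam2 Hn(3) u X])
               (use H b in auto)
          then have "KL_div \<nu> (exp_density \<nu> u) (?phat X) \<le> C1 * ?\<rho> n"
            using b by (simp add: C1_def)
          then have "\<kappa> * KL_div \<nu> (exp_density \<nu> u) (?phat X) \<le> \<kappa> * (C1 * ?\<rho> n)"
            using \<kappa> by (intro mult_left_mono) auto
          then show "loss (exp_density \<nu> u) X \<le> \<kappa> * (C1 * ?\<rho> n)" using loss[OF u, of X] by linarith
        next
          fix X
          have "KL_div \<nu> (exp_density \<nu> u) (?phat X) \<le> 4 * Bstar"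
            by (rule losses_le_KL(1)[OF J less_imp_le[OF lam0] _ log_classD(2)[OF u] ub]) (use b in auto)
          then have "\<kappa> * KL_div \<nu> (exp_density \<nu> u) (?phat X) \<le> \<kappa> * (4 * Bstar)"
            using \<kappa> by (intro mult_left_mono) auto
          then show "loss (exp_density \<nu> u) X \<le> \<kappa> * (4 * Bstar)" using loss[OF u, of X] by linarith
        qed (use \<kappa> C1 \<rho> b in auto)
        also have "\<dots> \<le> ennreal (C * ?\<rho> n)"
        proof (rule ennreal_leI)
          have "failure_prob \<nu> d \<phi> (?J n) (lam n) u n
              \<le> (SUP u0\<in>?U. failure_prob \<nu> d \<phi> (?J n) (lam n) u0 n)"
            by (rule failure_prob_le_SUP[OF u])
          also have "\<dots> \<le> ?\<rho> n" using elim(1) \<rho> by simp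
          finally have "\<kappa> * (4 * Bstar) * failure_prob \<nu> d \<phi> (?J n) (lam n) u n \<le> \<kappa> * (4 * Bstar) * ?\<rho> n"
            using \<kappa> b by (intro mult_left_mono) auto
          moreover have "C * ?\<rho> n = \<kappa> * (C1 * ?\<rho> n) + \<kappa> * (4 * Bstar) * ?\<rho> n + ?\<rho> n"
            using b by (simp add: C_def distrib_right mult.assoc)
          ultimately show "\<kappa> * (C1 * ?\<rho> n) + \<kappa> * (4 * Bstar) * failure_prob \<nu> d \<phi> (?J n) (lam n) u n \<le> C * ?\<rho> n"
            using \<rho> by linarith
        qed
        finally show "(\<integral>\<^sup>+X. ennreal (loss (exp_density \<nu> u) X) \<partial>sample_law \<nu> u n) \<le> ennreal (C * ?\<rho> n)" .
      qed
      have L: "0 \<le> KL_div \<nu> (exp_density \<nu> u) (?phat X)"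
          "hellinger_sq \<nu> (?phat X) (exp_density \<nu> u) \<le> KL_div \<nu> (exp_density \<nu> u) (?phat X)"
          "L2_dist_sq \<nu> (?phat X) (exp_density \<nu> u) \<le> \<kappa> * KL_div \<nu> (exp_density \<nu> u) (?phat X)"
        if u: "u \<in> ?U" for u X
      proof -
        have ub: "AE x in \<nu>. \<bar>u x\<bar> \<le> Bstar"
          using log_classD(4)[OF u] by eventually_elim (use b in linarith)
        note L = losses_le_KL[OF J less_imp_le[OF lam0] less_imp_le[OF b(3)] log_classD(2)[OF u] ub]
        show "0 \<le> KL_div \<nu> (exp_density \<nu> u) (?phat X)" using L(2) by simp
        show "hellinger_sq \<nu> (?phat X) (exp_density \<nu> u) \<le> KL_div \<nu> (exp_density \<nu> u) (?phat X)"
          using L(3) by simp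
        show "L2_dist_sq \<nu> (?phat X) (exp_density \<nu> u) \<le> \<kappa> * KL_div \<nu> (exp_density \<nu> u) (?phat X)"
          using L(4)[where n = n and X = X] b by (simp add: \<kappa>_def)
      qed
      have K: "KL_div \<nu> (exp_density \<nu> u) (?phat X) \<le> \<kappa> * KL_div \<nu> (exp_density \<nu> u) (?phat X)"
        if "u \<in> ?U" for u X
        using mult_right_mono[OF \<kappa> L(1)[OF that, of X]] by simp
      show ?case
        unfolding Let_def
        by (intro conjI risk) (use K L(2,3) order_trans in blast)+
    qed
  qed
qed

end
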